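(* Let $n,d\ge1$ be integers with $n-d>4$, let $E=\mathbb{R}^d\subset\mathbb{R}^n$ be a hyperplane of dimension $d$, and let $\alpha>2+\varepsilon_0$ for some $0<\varepsilon_0<1$, with $\alpha\ne n-d-2$. Let $\mu$ be a $d$-Ahlfors regular measure on $E$ whose density with respect to the Hausdorff measure $\mathcal{H}^d$ on $E$ is not a constant but is of class $C^{2,\varepsilon}(\mathbb{R}^d)$ for some $0<\varepsilon<\varepsilon_0$. Then the function $D_{\alpha,\mu}$ is not a solution of the equation $L_{\alpha,\mu}D_{\alpha,\mu}=0$ in $\mathbb{R}^n\setminus E$.
   Context: Identify $\mathbb{R}^d$ with $\mathbb{R}^d\times\{0\}\subset\mathbb{R}^n$. A measure $\mu$ is a $d$-Ahlfors regular measure on a closed set $E$ if its closed support is $E$ and there is $C_0\ge1$ with $C_0^{-1}r^d\le\mu(B(x,r))\le C_0r^d$ for all $x\in E$ and $0<r<\mathrm{diam}(E)$. For such $\mu$ and $x\in\mathbb{R}^n\setminus E$ set $$D_{\alpha,\mu}(x)=\left(\int_E|x-y|^{-d-\alpha}\,d\mu(y)\right)^{-1/\alpha},\qquad L_{\alpha,\mu}=-\mathrm{div}\,\big(D_{\alpha,\mu}^{-n+d+1}\nabla\,\cdot\,\big).$$ A function $f$ on $\mathbb{R}^d$ is of class $C^{k,\gamma}(\mathbb{R}^d)$, $0<\gamma<1$, if it has continuous derivatives up to order $k$ and each $k$-th order partial derivative $g$ is Hölder continuous with exponent $\gamma$, i.e. $\sup_{x\ne y}\frac{|g(x)-g(y)|}{|x-y|^\gamma}<\infty$.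 *)

theory Defs
  imports "HOL-Analysis.Analysis"
begin

(* The library's real-valued diameter is unspecified on unbounded sets, hence an extended version. *)
definition ediam :: "'a::metric_space set \<Rightarrow> ennreal" where
  "ediam A = (SUP x\<in>A. SUP y\<in>A. ennreal (dist x y))"

(* Federer's normalisation.  The case distinction only matters for d = 0, since 0 ^ 0 = 1. *)
definition hausdorff_outer :: "nat \<Rightarrow> 'a::metric_space set \<Rightarrow> ennreal" where
  "hausdorff_outer d A =
     (SUP \<delta>\<in>{0::real<..}.
        INF U\<in>{U :: nat \<Rightarrow> 'a set. A \<subseteq> (\<Union>i. U i) \<and> (\<forall>i. ediam (U i) \<le> ennreal \<delta>)}.
          \<Sum>i. if U i = {} then 0
              else ennreal (unit_ball_vol (real d)) * (ediam (U i) / 2) ^ d)"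

(* The outer measure is a metric outer measure, so it is countably additive on the Borel sets and
   measure_of does not fall back to its default value 0. *)
definition hausdorff_measure :: "nat \<Rightarrow> 'a::metric_space measure" where
  "hausdorff_measure d = measure_of UNIV (sets borel) (hausdorff_outer d)"

definition closed_support :: "'a::topological_space measure \<Rightarrow> 'a set" where
  "closed_support \<mu> = - \<Union>{U. open U \<and> emeasure \<mu> U = 0}"

definition ahlfors_regular :: "nat \<Rightarrow> 'a::metric_space set \<Rightarrow> 'a measure \<Rightarrow> bool" where
  "ahlfors_regular d E \<mu> \<longleftrightarrow>
     closed E \<and> sets \<mu> = sets borel \<and> closed_support \<mu> = E \<and>
     (\<exists>C\<ge>1. \<forall>x\<in>E. \<forall>r>0. ennreal r < ediam E \<longrightarrow>
        ennreal (inverse C * r ^ d) \<le> emeasure \<mu> (ball x r) \<and>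
        emeasure \<mu> (ball x r) \<le> ennreal (C * r ^ d))"

definition partial_deriv :: "'a::euclidean_space \<Rightarrow> ('a \<Rightarrow> real) \<Rightarrow> 'a \<Rightarrow> real" where
  "partial_deriv b f x = frechet_derivative f (at x) b"

definition gradient :: "('a::euclidean_space \<Rightarrow> real) \<Rightarrow> 'a \<Rightarrow> 'a" where
  "gradient f x = (\<Sum>b\<in>Basis. partial_deriv b f x *\<^sub>R b)"

definition divergence :: "('a::euclidean_space \<Rightarrow> 'a) \<Rightarrow> 'a \<Rightarrow> real" where
  "divergence F x = (\<Sum>b\<in>Basis. partial_deriv b (\<lambda>z. F z \<bullet> b) x)"

(* bs lists the coordinate directions; foldr partial_deriv bs f is the corresponding iterated
   partial derivative of order length bs. *)
definition C_holder :: "nat \<Rightarrow> real \<Rightarrow> ('a::euclidean_space \<Rightarrow> real) \<Rightarrow> bool" where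
  "C_holder k \<gamma> f \<longleftrightarrow>
     (\<forall>bs\<in>lists Basis. length bs < k \<longrightarrow> foldr partial_deriv bs f differentiable_on UNIV) \<and>
     (\<forall>bs\<in>lists Basis. length bs \<le> k \<longrightarrow> continuous_on UNIV (foldr partial_deriv bs f)) \<and>
     (\<forall>bs\<in>lists Basis. length bs = k \<longrightarrow>
        bdd_above {\<bar>foldr partial_deriv bs f x - foldr partial_deriv bs f y\<bar> / norm (x - y) powr \<gamma>
                   | x y. x \<noteq> y})"

definition D_dist :: "nat \<Rightarrow> 'a::euclidean_space set \<Rightarrow> real \<Rightarrow> 'a measure \<Rightarrow> 'a \<Rightarrow> real" where
  "D_dist d E \<alpha> \<mu> x =
     (LINT y:E|\<mu>. norm (x - y) powr (- real d - \<alpha>)) powr (- 1 / \<alpha>)"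

definition L_op ::
    "nat \<Rightarrow> 'a::euclidean_space set \<Rightarrow> real \<Rightarrow> 'a measure \<Rightarrow> ('a \<Rightarrow> real) \<Rightarrow> 'a \<Rightarrow> real" where
  "L_op d E \<alpha> \<mu> u x =
     - divergence
         (\<lambda>z. D_dist d E \<alpha> \<mu> z powr (- real DIM('a) + real d + 1) *\<^sub>R gradient u z) x"

end

theory Submission
  imports Defs
begin

text \<open>
  Write \<open>m = n - d\<close>, and let \<open>c\<close> be the constant with \<open>H\<^sup>d = c \<cdot> Lebesgue\<close> on the plane \<open>E\<close>.
  Substituting \<open>y = x + r z\<close> with \<open>r = |t|\<close> in the integral that defines \<open>D\<close> gives
  \<open>D (x, t) = (c r powr (-\<alpha>) G (x, r)) powr (-1/\<alpha>)\<close>, where \<open>G (x, r)\<close> is the integral over \<open>z\<close> of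
  \<open>f (x + r z) (1 + |z|\<^sup>2) powr (-(d + \<alpha>)/2)\<close>. The function \<open>G\<close> is twice differentiable on all
  of \<open>\<real>\<^sup>d \<times> \<real>\<close>, up to and across \<open>r = 0\<close>, because all derivatives can be put on \<open>f\<close> and
  \<open>\<alpha> > 2 + \<epsilon>\<close> makes the resulting integrals converge.

  In terms of \<open>ln D\<close> the equation \<open>L D = 0\<close> reads \<open>\<Delta> (ln D) = (m - 2) |\<nabla> (ln D)|\<^sup>2\<close>, which is
  \<open>G (\<Delta>\<^sub>x G + G\<^sub>r\<^sub>r - (m - 3) G\<^sub>r / r) + ((m - 2)/\<alpha> - 1) |\<nabla> G|\<^sup>2 = 0\<close>
  (\<open>divergence_log_equation\<close>). As \<open>r\<close> tends to \<open>0\<close> both \<open>G\<^sub>r\<^sub>r\<close> and \<open>G\<^sub>r / r\<close> tend to the second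
  moment of the kernel times \<open>\<Delta> f\<close>, and that moment is \<open>1/(\<alpha> - 2)\<close> of its mass
  (\<open>integral_second_moment_kern\<close>). The limit equation (\<open>boundary_equation\<close>) says that
  \<open>\<alpha> - m + 2\<close>, which is not zero, times \<open>f \<Delta> f / (\<alpha> - 2) - |\<nabla> f|\<^sup>2 / \<alpha>\<close> vanishes. Hence
  \<open>f powr (2/\<alpha>)\<close> is harmonic on \<open>\<real>\<^sup>d\<close>. Ahlfors regularity bounds \<open>f\<close> from above and away from
  zero, so by Liouville's theorem (\<open>bounded_harmonic_constant\<close>) \<open>f\<close> is constant.

  Both the moments and Liouville's theorem are reduced to the vanishing of the integral of a partial
  derivative (\<open>integral_directional_derivative_zero\<close>).
\<close>

section \<open>Integrability and differentiation under the integral sign\<close>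

lemma integrable_one_plus_norm_powr:
  fixes q :: real
  assumes q: "q > real DIM('a::euclidean_space)"
  shows "integrable lborel (\<lambda>z::'a. (1 + norm z) powr (- q))"
proof (rule integrableI_bounded)
  show "(\<lambda>z::'a. (1 + norm z) powr (- q)) \<in> borel_measurable lborel" by measurable
  \<comment> \<open>If \<open>k\<close> is the integer part of \<open>log 2 (1 + |z|)\<close>, then \<open>z\<close> lies in the ball of radius \<open>2 ^ (k + 1)\<close>
    and the integrand at \<open>z\<close> is at most \<open>2 powr (-q k)\<close>. Summing over all \<open>k\<close>, the resulting
    series is geometric with ratio \<open>2 powr (d - q)\<close>, where \<open>d\<close> is the dimension.\<close>
  define c where "c = unit_ball_vol (real DIM('a)) * 2 ^ DIM('a)"
  define \<rho> where "\<rho> = 2 powr (real DIM('a) - q)"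
  have \<rho>: "0 < \<rho>" "\<rho> < 1" using q by (auto simp: \<rho>_def powr_less_one)
  have c0: "c \<ge> 0" by (simp add: c_def)
  have bd: "ennreal (norm ((1 + norm z) powr (- q)))
      \<le> (\<Sum>k. ennreal (2 powr (- q * real k)) * indicator (ball 0 (2 ^ (k + 1))) z)" for z :: 'a
  proof -
    define k where "k = nat \<lfloor>log 2 (1 + norm z)\<rfloor>"
    have l0: "log 2 (1 + norm z) \<ge> 0" by (simp add: zero_le_log_cancel_iff add_pos_nonneg)
    have k1: "real k \<le> log 2 (1 + norm z)" and k2: "log 2 (1 + norm z) < real k + 1"
      using l0 by (auto simp: k_def)
    have pos: "1 + norm z > 0" by (smt (verit) norm_ge_zero)
    have a1: "2 powr real k \<le> 1 + norm z" using k1 pos by (simp add: le_log_iff)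
    have a2: "1 + norm z < 2 powr (real k + 1)" using k2 pos by (simp add: log_less_iff)
    have zb: "z \<in> ball 0 (2 ^ (k + 1))" using a2 powr_realpow[of 2 "k+1"]
      by (simp add: add.commute)
    have "(1 + norm z) powr (- q) \<le> (2 powr real k) powr (- q)"
      using q a1 by (intro powr_mono2') auto
    hence "ennreal (norm ((1 + norm z) powr (- q))) \<le> ennreal (2 powr (- q * real k)) * indicator (ball 0 (2 ^ (k + 1))) z"
      using zb by (simp add: powr_powr mult.commute)
    also have "\<dots> \<le> (\<Sum>k. ennreal (2 powr (- q * real k)) * indicator (ball 0 (2 ^ (k + 1))) z)"
      using sum_le_suminf[of "\<lambda>k. ennreal (2 powr (- q * real k)) * indicator (ball 0 (2 ^ (k + 1))) z" "{k}"]
      by (simp only: sum.insert sum.empty finite.intros empty_iff add_0_right not_False_eq_True simp_thms zero_le summableI)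
    finally show ?thesis .
  qed
  have "(\<integral>\<^sup>+ (z::'a). ennreal (norm ((1 + norm z) powr (- q))) \<partial>lborel)
     \<le> (\<integral>\<^sup>+ (z::'a). (\<Sum>k. ennreal (2 powr (- q * real k)) * indicator (ball 0 (2 ^ (k + 1))) z) \<partial>lborel)"
    by (intro nn_integral_mono bd)
  also have "\<dots> = (\<Sum>k. (\<integral>\<^sup>+ (z::'a). ennreal (2 powr (- q * real k)) * indicator (ball 0 (2 ^ (k + 1))) z \<partial>lborel))"
  proof (rule nn_integral_suminf)
    fix k :: nat
    have "ball (0::'a) (2 ^ (k + 1)) \<in> sets lborel" by simp
    thus "(\<lambda>z::'a. ennreal (2 powr (- q * real k)) * indicator (ball 0 (2 ^ (k + 1))) z) \<in> borel_measurable lborel"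
      by (rule borel_measurable_times_ennreal[OF borel_measurable_const borel_measurable_indicator])
  qed
  also have "\<dots> = (\<Sum>k. ennreal (c * \<rho> ^ k))"
  proof (rule suminf_cong)
    fix k :: nat
    have "2 powr (- q * real k) * (2 ^ (k+1)) ^ DIM('a) = 2 ^ DIM('a) * \<rho> ^ k"
    proof -
      have "\<rho> ^ k = 2 powr (- q * real k) * 2 powr (real DIM('a) * real k)"
        by (simp add: \<rho>_def powr_power powr_add[symmetric] algebra_simps)
      moreover have "2 powr (real DIM('a) * real k) = (2::real) ^ (DIM('a) * k)"
        using powr_realpow[of 2 "DIM('a) * k"] by simp
      moreover have "((2::real) ^ (k+1)) ^ DIM('a) = 2 ^ DIM('a) * 2 ^ (DIM('a) * k)"
        by (simp add: power_mult_distrib power_mult[symmetric] mult.commute)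
      ultimately show ?thesis by simp
    qed
    hence e: "2 powr (- q * real k) * (unit_ball_vol (real DIM('a)) * (2 ^ (k+1)) ^ DIM('a)) = c * \<rho> ^ k"
      by (simp add: c_def mult.left_commute mult.assoc)
    have "(\<integral>\<^sup>+ (z::'a). ennreal (2 powr (- q * real k)) * indicator (ball 0 (2 ^ (k + 1))) z \<partial>lborel)
       = ennreal (2 powr (- q * real k)) * emeasure lborel (ball (0::'a) (2 ^ (k+1)))"
      by (rule nn_integral_cmult_indicator) simp
    also have "emeasure lborel (ball (0::'a) (2 ^ (k+1))) = ennreal (unit_ball_vol (real DIM('a)) * (2 ^ (k+1)) ^ DIM('a))"
      by (rule emeasure_ball) simp
    also have "ennreal (2 powr (- q * real k)) * \<dots> = ennreal (c * \<rho> ^ k)"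
      unfolding e[symmetric] by (rule ennreal_mult[symmetric]) auto
    finally show "(\<integral>\<^sup>+ (z::'a). ennreal (2 powr (- q * real k)) * indicator (ball 0 (2 ^ (k + 1))) z \<partial>lborel) = ennreal (c * \<rho> ^ k)" .
  qed
  also have "\<dots> < \<infinity>"
  proof -
    have "summable (\<lambda>k. c * \<rho> ^ k)" using \<rho> by (intro summable_mult summable_geometric) auto
    hence "(\<Sum>k. ennreal (c * \<rho> ^ k)) \<noteq> top"
      by (rule ennreal_suminf_neq_top) (use c0 \<rho> in auto)
    thus ?thesis by (simp add: less_top)
  qed
  finally show "(\<integral>\<^sup>+ (z::'a). ennreal (norm ((1 + norm z) powr (- q))) \<partial>lborel) < \<infinity>" .
qed

lemma has_derivative_integral_dominated:
  fixes \<phi> :: "'p::real_normed_vector \<Rightarrow> 'z \<Rightarrow> real"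
  assumes e: "e > 0"
    and der: "\<And>\<xi> z. \<xi> \<in> ball \<xi>\<^sub>0 e \<Longrightarrow> ((\<lambda>\<xi>. \<phi> \<xi> z) has_derivative \<phi>' \<xi> z) (at \<xi>)"
    and int: "\<And>\<xi>. \<xi> \<in> ball \<xi>\<^sub>0 e \<Longrightarrow> integrable M (\<phi> \<xi>)"
    and meas: "\<And>h. (\<lambda>z. \<phi>' \<xi>\<^sub>0 z h) \<in> borel_measurable M"
    and bound: "\<And>\<xi> z h. \<xi> \<in> ball \<xi>\<^sub>0 e \<Longrightarrow> \<bar>\<phi>' \<xi> z h\<bar> \<le> B z * norm h"
    and intB: "integrable M B"
  shows "((\<lambda>\<xi>. LINT z|M. \<phi> \<xi> z) has_derivative (\<lambda>h. LINT z|M. \<phi>' \<xi>\<^sub>0 z h)) (at \<xi>\<^sub>0)"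
proof -
  have c0: "\<xi>\<^sub>0 \<in> ball \<xi>\<^sub>0 e" using e by simp
  have lin: "linear (\<phi>' \<xi>\<^sub>0 z)" for z using der[OF c0] has_derivative_linear by blast
  have int': "integrable M (\<lambda>z. \<phi>' \<xi>\<^sub>0 z h)" for h
    by (rule Bochner_Integration.integrable_bound[OF integrable_mult_left[OF intB, of "norm h"] meas])
       (use bound[OF c0] in \<open>auto intro!: AE_I2 order_trans[OF _ abs_ge_self]\<close>)
  have bl: "bounded_linear (\<lambda>h. LINT z|M. \<phi>' \<xi>\<^sub>0 z h)"
  proof (rule bounded_linear_intro[where K = "LINT z|M. B z"])
    fix x y show "(LINT z|M. \<phi>' \<xi>\<^sub>0 z (x + y)) = (LINT z|M. \<phi>' \<xi>\<^sub>0 z x) + (LINT z|M. \<phi>' \<xi>\<^sub>0 z y)"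
      by (simp add: linear_add[OF lin] int')
  next
    fix r :: real and x show "(LINT z|M. \<phi>' \<xi>\<^sub>0 z (r *\<^sub>R x)) = r *\<^sub>R (LINT z|M. \<phi>' \<xi>\<^sub>0 z x)"
      by (simp add: linear_cmul[OF lin])
  next
    fix h
    have "norm (LINT z|M. \<phi>' \<xi>\<^sub>0 z h) \<le> (LINT z|M. norm (\<phi>' \<xi>\<^sub>0 z h))"
      by (rule integral_norm_bound)
    also have "\<dots> \<le> (LINT z|M. B z * norm h)"
      by (rule integral_mono) (use int' intB bound[OF c0] in auto)
    finally have "norm (LINT z|M. \<phi>' \<xi>\<^sub>0 z h) \<le> (LINT z|M. B z * norm h)" .
    thus "norm (LINT z|M. \<phi>' \<xi>\<^sub>0 z h) \<le> norm h * (LINT z|M. B z)" by (simp add: mult.commute)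
  qed
  let ?q = "\<lambda>y z. (\<phi> y z - \<phi> \<xi>\<^sub>0 z - \<phi>' \<xi>\<^sub>0 z (y - \<xi>\<^sub>0)) /\<^sub>R norm (y - \<xi>\<^sub>0)"
  have qint: "(LINT z|M. ?q y z) = (((LINT z|M. \<phi> y z) - (LINT z|M. \<phi> \<xi>\<^sub>0 z)) - (LINT z|M. \<phi>' \<xi>\<^sub>0 z (y - \<xi>\<^sub>0))) /\<^sub>R norm (y - \<xi>\<^sub>0)"
    if "y \<in> ball \<xi>\<^sub>0 e" for y using int[OF that] int[OF c0] int' by simp
  have qbd: "norm (?q y z) \<le> 2 * B z" if y: "y \<in> ball \<xi>\<^sub>0 e" "y \<noteq> \<xi>\<^sub>0" for y z
  proof -
    have "0 \<le> B z * norm (y - \<xi>\<^sub>0)" using bound[OF c0, of z "y - \<xi>\<^sub>0"] by linarith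
    hence B0: "0 \<le> B z" using y(2) by (simp add: zero_le_mult_iff)
    have "norm (\<phi> y z - \<phi> \<xi>\<^sub>0 z) \<le> B z * norm (y - \<xi>\<^sub>0)"
    proof (rule differentiable_bound[where S = "ball \<xi>\<^sub>0 e" and f = "\<lambda>\<xi>. \<phi> \<xi> z" and f' = "\<lambda>\<xi>. \<phi>' \<xi> z"])
      fix x assume x: "x \<in> ball \<xi>\<^sub>0 e"
      show "((\<lambda>\<xi>. \<phi> \<xi> z) has_derivative \<phi>' x z) (at x within ball \<xi>\<^sub>0 e)"
        using der[OF x] has_derivative_at_withinI by blast
      show "onorm (\<phi>' x z) \<le> B z"
        by (rule onorm_bound[OF B0]) (use bound[OF x] in auto)
    qed (use y c0 in auto)
    moreover have "\<bar>\<phi>' \<xi>\<^sub>0 z (y - \<xi>\<^sub>0)\<bar> \<le> B z * norm (y - \<xi>\<^sub>0)" by (rule bound[OF c0])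
    ultimately have "\<bar>\<phi> y z - \<phi> \<xi>\<^sub>0 z - \<phi>' \<xi>\<^sub>0 z (y - \<xi>\<^sub>0)\<bar> \<le> 2 * B z * norm (y - \<xi>\<^sub>0)" by simp
    thus ?thesis using y by (simp add: field_simps divide_simps abs_divide)
  qed
  have lim: "((\<lambda>y. ?q y z) \<longlongrightarrow> 0) (at \<xi>\<^sub>0)" for z
    using der[OF c0, of z] unfolding has_derivative_at_within by simp
  have "((\<lambda>y. LINT z|M. ?q y z) \<longlongrightarrow> 0) (at \<xi>\<^sub>0)"
    unfolding tendsto_at_iff_sequentially comp_def
  proof (intro allI impI)
    fix X :: "nat \<Rightarrow> 'p" assume X: "\<forall>i. X i \<in> UNIV - {\<xi>\<^sub>0}" "X \<longlonglongrightarrow> \<xi>\<^sub>0"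
    obtain N where N: "\<And>n. n \<ge> N \<Longrightarrow> X n \<in> ball \<xi>\<^sub>0 e"
      using X(2) e by (metis LIMSEQ_iff_nz dist_commute lim_sequentially mem_ball)
    have "(\<lambda>n. LINT z|M. ?q (X (n + N)) z) \<longlonglongrightarrow> (LINT z|M. 0)"
    proof (rule integral_dominated_convergence[where w = "\<lambda>z. 2 * B z"])
      fix n
      show "(\<lambda>z. ?q (X (n + N)) z) \<in> borel_measurable M"
        using int[OF N[of "n+N"]] int[OF c0] int' by measurable
      show "AE z in M. norm (?q (X (n + N)) z) \<le> 2 * B z"
        using N[of "n+N"] X(1) by (intro AE_I2 qbd) auto
    next
      show "AE z in M. (\<lambda>n. ?q (X (n + N)) z) \<longlonglongrightarrow> 0"
      proof (rule AE_I2)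
        fix z
        have "(\<lambda>n. ?q (X n) z) \<longlonglongrightarrow> 0"
          using lim[of z] X unfolding tendsto_at_iff_sequentially comp_def by blast
        thus "(\<lambda>n. ?q (X (n + N)) z) \<longlonglongrightarrow> 0" by (rule LIMSEQ_ignore_initial_segment)
      qed
    qed (use intB in auto)
    thus "(\<lambda>n. LINT z|M. ?q (X n) z) \<longlonglongrightarrow> 0" by (simp add: LIMSEQ_offset)
  qed
  moreover have "\<forall>\<^sub>F y in at \<xi>\<^sub>0. (LINT z|M. ?q y z) = (((LINT z|M. \<phi> y z) - (LINT z|M. \<phi> \<xi>\<^sub>0 z)) - (LINT z|M. \<phi>' \<xi>\<^sub>0 z (y - \<xi>\<^sub>0))) /\<^sub>R norm (y - \<xi>\<^sub>0)"
    by (rule eventually_mono[OF eventually_at_ball[OF e, of \<xi>\<^sub>0 UNIV]]) (rule qint, blast)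
  ultimately have "((\<lambda>y. (((LINT z|M. \<phi> y z) - (LINT z|M. \<phi> \<xi>\<^sub>0 z)) - (LINT z|M. \<phi>' \<xi>\<^sub>0 z (y - \<xi>\<^sub>0))) /\<^sub>R norm (y - \<xi>\<^sub>0)) \<longlongrightarrow> 0) (at \<xi>\<^sub>0)"
    by (rule Lim_transform_eventually)
  thus ?thesis unfolding has_derivative_at_within using bl by simp
qed

section \<open>Growth, partial derivatives and the kernel\<close>

text \<open>\<open>growth a \<phi>\<close> means \<open>\<phi> = O((1 + |y|)\<^sup>a)\<close> on the whole space. The exponent may be negative, so
  that the same notion records the decay of the kernels.\<close>
definition growth :: "real \<Rightarrow> ('a::euclidean_space \<Rightarrow> real) \<Rightarrow> bool" where
  "growth a \<phi> \<longleftrightarrow> (\<exists>K\<ge>0. \<forall>y. \<bar>\<phi> y\<bar> \<le> K * (1 + norm y) powr a)"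

text \<open>\<open>\<phi>\<close> is differentiable everywhere and \<open>\<phi>' b\<close> is its partial derivative in the basis direction
  \<open>b\<close>; the values of \<open>\<phi>'\<close> off the basis are irrelevant.\<close>
definition has_partials :: "('a::euclidean_space \<Rightarrow> real) \<Rightarrow> ('a \<Rightarrow> 'a \<Rightarrow> real) \<Rightarrow> bool" where
  "has_partials \<phi> \<phi>' \<longleftrightarrow>
     (\<forall>y. (\<phi> has_derivative (\<lambda>h. \<Sum>b\<in>Basis. \<phi>' b y * (h \<bullet> b))) (at y))"

text \<open>The unnormalised Poisson-type kernel at height one. The kernel of the problem has
  \<open>2 s = d + \<alpha>\<close>, where \<open>d\<close> is the dimension.\<close>
definition kern :: "real \<Rightarrow> 'a::euclidean_space \<Rightarrow> real" where
  "kern s z = (1 + (norm z)\<^sup>2) powr (- s)"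

text \<open>The average of \<open>\<phi>\<close> around \<open>x = fst \<xi>\<close> at scale \<open>r = snd \<xi>\<close> with weight \<open>p\<close>. In this
  normalisation the derivatives in \<open>x\<close> and in \<open>r\<close> fall on \<open>\<phi>\<close>, and \<open>r\<close> may be zero or negative.\<close>
definition kavg :: "('a::euclidean_space \<Rightarrow> real) \<Rightarrow> ('a \<Rightarrow> real) \<Rightarrow> 'a \<times> real \<Rightarrow> real" where
  "kavg \<phi> p \<xi> = (LINT z|lborel. \<phi> (fst \<xi> + snd \<xi> *\<^sub>R z) * p z)"

lemma one_plus_norm_pos [simp]: "0 < 1 + norm z" "1 + norm z \<noteq> 0" "0 \<le> 1 + norm z" "1 \<le> 1 + norm z"
  by (auto simp: add_pos_nonneg) (smt (verit) norm_ge_zero)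

lemma growthI:
  fixes \<phi> :: "'a::euclidean_space \<Rightarrow> real"
  assumes *: "\<And>y. \<bar>\<phi> y\<bar> \<le> K * (1 + norm y) powr a"
  shows "growth a \<phi>"
  unfolding growth_def
proof (intro exI[of _ "max K 0"] conjI allI)
  fix y :: 'a
  have "K * (1 + norm y) powr a \<le> max K 0 * (1 + norm y) powr a"
    by (intro mult_right_mono) auto
  thus "\<bar>\<phi> y\<bar> \<le> max K 0 * (1 + norm y) powr a" using *[of y] by linarith
qed auto

lemma growthE:
  assumes "growth a \<phi>"
  obtains K where "K \<ge> 0" "\<And>y. \<bar>\<phi> y\<bar> \<le> K * (1 + norm y) powr a"
  using assms unfolding growth_def by blast

lemma growth_const: "growth 0 (\<lambda>_. c)"
  by (rule growthI[of _ "\<bar>c\<bar>"]) simp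

lemma growth_mono:
  assumes "growth a \<phi>" "a \<le> b"
  shows "growth b \<phi>"
proof -
  obtain K where K: "K \<ge> 0" "\<And>y. \<bar>\<phi> y\<bar> \<le> K * (1 + norm y) powr a" using assms growthE by blast
  have "\<bar>\<phi> y\<bar> \<le> K * (1 + norm y) powr b" for y
  proof -
    have "(1 + norm y) powr a \<le> (1 + norm y) powr b" using assms(2) by (intro powr_mono) auto
    from mult_left_mono[OF this K(1)] show ?thesis using K(2)[of y] by linarith
  qed
  thus ?thesis by (rule growthI)
qed

lemma growth_eq: "growth a \<phi> \<Longrightarrow> a = b \<Longrightarrow> growth b \<phi>"
  by simp

lemma growth_mult:
  assumes "growth a \<phi>" "growth b \<psi>"
  shows "growth (a + b) (\<lambda>y. \<phi> y * \<psi> y)"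
proof -
  obtain K where K: "K \<ge> 0" "\<And>y. \<bar>\<phi> y\<bar> \<le> K * (1 + norm y) powr a" using assms growthE by blast
  obtain L where L: "L \<ge> 0" "\<And>y. \<bar>\<psi> y\<bar> \<le> L * (1 + norm y) powr b" using assms growthE by blast
  have "\<bar>\<phi> y * \<psi> y\<bar> \<le> (K * L) * (1 + norm y) powr (a + b)" for y
    using mult_mono[OF K(2)[of y] L(2)[of y]] K(1) by (simp add: abs_mult powr_add mult_ac)
  thus ?thesis by (rule growthI)
qed

lemma growth_cmult: "growth a \<phi> \<Longrightarrow> growth a (\<lambda>y. c * \<phi> y)"
  using growth_mult[OF growth_const[of c], of a \<phi>] by simp

lemma growth_uminus: "growth a \<phi> \<Longrightarrow> growth a (\<lambda>y. - \<phi> y)"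
  unfolding growth_def by simp

lemma growth_add:
  assumes "growth a \<phi>" "growth a \<psi>"
  shows "growth a (\<lambda>y. \<phi> y + \<psi> y)"
proof -
  obtain K where K: "K \<ge> 0" "\<And>y. \<bar>\<phi> y\<bar> \<le> K * (1 + norm y) powr a" using assms growthE by blast
  obtain L where L: "L \<ge> 0" "\<And>y. \<bar>\<psi> y\<bar> \<le> L * (1 + norm y) powr a" using assms growthE by blast
  have "\<bar>\<phi> y + \<psi> y\<bar> \<le> (K + L) * (1 + norm y) powr a" for y
    using K(2)[of y] L(2)[of y] by (simp add: distrib_right)
  thus ?thesis by (rule growthI)
qed

lemma growth_diff:
  "growth a \<phi> \<Longrightarrow> growth a \<psi> \<Longrightarrow> growth a (\<lambda>y. \<phi> y - \<psi> y)"
  using growth_add[OF _ growth_uminus, of a \<phi> \<psi>] by simp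

lemma growth_inner: "growth 1 (\<lambda>z. z \<bullet> b)"
proof (rule growthI[of _ "norm b"])
  fix z :: 'a
  show "\<bar>z \<bullet> b\<bar> \<le> norm b * (1 + norm z) powr 1"
    using Cauchy_Schwarz_ineq2[of z b] norm_ge_zero[of b]
    by (simp add: distrib_left mult.commute[of "norm b"] add_increasing)
qed

lemma growth_compose:
  assumes "growth a \<phi>" "a \<ge> 0"
  shows "growth a (\<lambda>z. \<phi> (x + r *\<^sub>R z))"
proof -
  obtain K where K: "K \<ge> 0" "\<And>y. \<bar>\<phi> y\<bar> \<le> K * (1 + norm y) powr a" using assms growthE by blast
  have "\<bar>\<phi> (x + r *\<^sub>R z)\<bar> \<le> (K * (1 + norm x + \<bar>r\<bar>) powr a) * (1 + norm z) powr a" for z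
  proof -
    have "norm (x + r *\<^sub>R z) \<le> norm x + \<bar>r\<bar> * norm z" using norm_triangle_ineq[of x "r *\<^sub>R z"] by simp
    hence "1 + norm (x + r *\<^sub>R z) \<le> (1 + norm x + \<bar>r\<bar>) * (1 + norm z)"
      by (simp add: algebra_simps) (smt (verit) norm_ge_zero mult_nonneg_nonneg)
    hence "(1 + norm (x + r *\<^sub>R z)) powr a \<le> ((1 + norm x + \<bar>r\<bar>) * (1 + norm z)) powr a"
      using assms(2) by (intro powr_mono2) auto
    also have "\<dots> = (1 + norm x + \<bar>r\<bar>) powr a * (1 + norm z) powr a"
      by (simp add: powr_mult)
    finally have "K * (1 + norm (x + r *\<^sub>R z)) powr a \<le> K * ((1 + norm x + \<bar>r\<bar>) powr a * (1 + norm z) powr a)"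
      using K(1) by (rule mult_left_mono)
    thus ?thesis using K(2)[of "x + r *\<^sub>R z"] by (simp add: mult_ac)
  qed
  thus ?thesis by (rule growthI)
qed

lemma growth_integrable:
  fixes \<phi> :: "'a::euclidean_space \<Rightarrow> real"
  assumes "growth a \<phi>" "a < - real DIM('a)" "\<phi> \<in> borel_measurable borel"
  shows "integrable lborel \<phi>"
proof -
  obtain K where K: "K \<ge> 0" "\<And>y. \<bar>\<phi> y\<bar> \<le> K * (1 + norm y) powr a" using assms growthE by blast
  have "integrable lborel (\<lambda>z::'a. K * (1 + norm z) powr (- (- a)))"
    using assms(2) by (intro integrable_mult_right integrable_one_plus_norm_powr) auto
  thus ?thesis
    by (rule Bochner_Integration.integrable_bound)
       (use assms K in \<open>auto intro!: AE_I2 order_trans[OF _ abs_ge_self]\<close>)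
qed

lemma growth_antiderivative:
  assumes "has_partials \<phi> \<phi>'" "\<And>b. b \<in> Basis \<Longrightarrow> growth a (\<phi>' b)" "a \<ge> 0"
  shows "growth (a + 1) (\<phi> :: 'a::euclidean_space \<Rightarrow> real)"
proof -
  have "\<forall>b\<in>Basis. \<exists>K\<ge>0. \<forall>y. \<bar>\<phi>' b y\<bar> \<le> K * (1 + norm y) powr a"
    using assms(2) unfolding growth_def by blast
  then obtain K where K: "\<And>b. b \<in> Basis \<Longrightarrow> K b \<ge> 0"
      "\<And>b y. b \<in> Basis \<Longrightarrow> \<bar>\<phi>' b y\<bar> \<le> K b * (1 + norm y) powr a" by metis
  define L where "L = (\<Sum>b\<in>Basis. K b)"
  have L0: "L \<ge> 0" unfolding L_def by (intro sum_nonneg K)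
  have "\<bar>\<phi> y\<bar> \<le> (\<bar>\<phi> 0\<bar> + L) * (1 + norm y) powr (a + 1)" for y
  proof -
    let ?B = "L * (1 + norm y) powr a"
    have "norm (\<phi> y - \<phi> 0) \<le> ?B * norm (y - 0)"
    proof (rule differentiable_bound[where S = "cball 0 (norm y)" and f' = "\<lambda>x h. \<Sum>b\<in>Basis. \<phi>' b x * (h \<bullet> b)"])
      fix x :: 'a assume x: "x \<in> cball 0 (norm y)"
      show "(\<phi> has_derivative (\<lambda>h. \<Sum>b\<in>Basis. \<phi>' b x * (h \<bullet> b))) (at x within cball 0 (norm y))"
        using assms(1) has_derivative_at_withinI unfolding has_partials_def by blast
      show "onorm (\<lambda>h. \<Sum>b\<in>Basis. \<phi>' b x * (h \<bullet> b)) \<le> ?B"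
      proof (rule onorm_bound)
        fix h
        have "norm (\<Sum>b\<in>Basis. \<phi>' b x * (h \<bullet> b)) \<le> (\<Sum>b\<in>Basis. K b * (1 + norm y) powr a * norm h)"
        proof (rule sum_norm_le)
          fix b :: 'a assume b: "b \<in> Basis"
          have "\<bar>\<phi>' b x\<bar> \<le> K b * (1 + norm y) powr a"
          proof -
            have "(1 + norm x) powr a \<le> (1 + norm y) powr a"
              using x assms(3) by (intro powr_mono2) auto
            from mult_left_mono[OF this K(1)[OF b]] show ?thesis using K(2)[OF b, of x] by linarith
          qed
          thus "norm (\<phi>' b x * (h \<bullet> b)) \<le> K b * (1 + norm y) powr a * norm h"
            using Basis_le_norm[OF b, of h] K(1)[OF b] by (auto simp: abs_mult intro!: mult_mono)
        qed
        thus "norm (\<Sum>b\<in>Basis. \<phi>' b x * (h \<bullet> b)) \<le> ?B * norm h"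
          by (simp add: L_def sum_distrib_right)
      qed (use L0 in auto)
    qed auto
    hence "\<bar>\<phi> y\<bar> \<le> \<bar>\<phi> 0\<bar> + L * (1 + norm y) powr a * norm y" by simp
    also have "\<dots> \<le> \<bar>\<phi> 0\<bar> * (1 + norm y) powr (a + 1) + L * (1 + norm y) powr (a + 1)"
    proof (rule add_mono)
      have "1 \<le> (1 + norm y) powr (a + 1)" using assms(3) by (intro ge_one_powr_ge_zero) auto
      thus "\<bar>\<phi> 0\<bar> \<le> \<bar>\<phi> 0\<bar> * (1 + norm y) powr (a + 1)" by (simp add: mult_le_cancel_left1)
      have "L * (1 + norm y) powr a * norm y \<le> L * (1 + norm y) powr a * (1 + norm y)"
        using L0 by (intro mult_left_mono) auto
      thus "L * (1 + norm y) powr a * norm y \<le> L * (1 + norm y) powr (a + 1)" by (simp add: powr_add)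
    qed
    finally show ?thesis by (simp add: distrib_right)
  qed
  thus ?thesis by (rule growthI)
qed

lemma kern_pos: "kern s z > 0"
  unfolding kern_def using zero_le_power2[of "norm z"] by (smt (verit) powr_gt_zero)

lemma growth_kern: "s \<ge> 0 \<Longrightarrow> growth (- 2 * s) (kern s)"
proof (rule growthI[of _ "2 powr s"])
  fix z :: 'a assume s: "s \<ge> 0"
  have p: "0 < 1 + (norm z)\<^sup>2" by (simp add: add_pos_nonneg)
  have "(1 + norm z)\<^sup>2 \<le> 2 * (1 + (norm z)\<^sup>2)" using sum_squares_bound[of 1 "norm z"] by (simp add: power2_eq_square algebra_simps)
  hence "(2 * (1 + (norm z)\<^sup>2)) powr (- s) \<le> ((1 + norm z)\<^sup>2) powr (- s)"
    using s by (intro powr_mono2') auto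
  also have "((1 + norm z)\<^sup>2) powr (- s) = (1 + norm z) powr (- 2 * s)"
    using powr_powr[of "1 + norm z" 2 "-s"] by simp
  also have "(2 * (1 + (norm z)\<^sup>2)) powr (- s) = 2 powr (-s) * kern s z"
    unfolding kern_def by (rule powr_mult)
  finally show "\<bar>kern s z\<bar> \<le> 2 powr s * (1 + norm z) powr (- 2 * s)"
    using kern_pos[of s z] by (simp add: powr_minus field_simps)
qed

lemma continuous_kern: "continuous_on UNIV (kern s)"
  unfolding kern_def by (intro continuous_intros) (smt (verit) zero_le_power2)

lemma measurable_kern [measurable]: "kern s \<in> borel_measurable borel"
  using continuous_kern by (rule borel_measurable_continuous_onI)

lemma kern_Suc: "(1 + (norm z)\<^sup>2) * kern (s + 1) z = kern s z"
proof -
  have "0 < 1 + (norm z)\<^sup>2" by (simp add: add_pos_nonneg)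
  thus ?thesis by (simp add: kern_def powr_diff)
qed

lemma has_derivative_kern:
  "(kern s has_derivative (\<lambda>h. - 2 * s * kern (s + 1) z * (z \<bullet> h))) (at z)"
proof -
  have p: "0 < 1 + z \<bullet> z" by (simp add: add_pos_nonneg)
  have k: "kern s = (\<lambda>z::'a. (1 + z \<bullet> z) powr (- s))" for s
    by (simp add: kern_def power2_norm_eq_inner fun_eq_iff)
  have "((\<lambda>z. 1 + z \<bullet> z) has_derivative (\<lambda>h. z \<bullet> h + h \<bullet> z)) (at z)"
    by (auto intro!: derivative_eq_intros)
  from DERIV_compose_FDERIV[OF has_real_derivative_powr[OF p, of "- s"] this]
  have d: "((\<lambda>z. (1 + z \<bullet> z) powr (- s)) has_derivative
      (\<lambda>h. (z \<bullet> h + h \<bullet> z) * (- s * (1 + z \<bullet> z) powr (- s - 1)))) (at z)" .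
  have e: "- s - 1 = - (s + 1)" by simp
  have r: "(z \<bullet> h + h \<bullet> z) * (- s * (1 + z \<bullet> z) powr (- s - 1))
      = - 2 * s * (1 + z \<bullet> z) powr (- (s + 1)) * (z \<bullet> h)" for h
    unfolding inner_commute[of h z] e by algebra
  show ?thesis unfolding k by (rule has_derivative_eq_rhs[OF d ext]) (rule r)
qed

lemma has_partials_continuous_on:
  fixes \<phi> :: "'a::euclidean_space \<Rightarrow> real"
  assumes "has_partials \<phi> \<phi>'"
  shows "continuous_on UNIV \<phi>"
  using assms unfolding has_partials_def
  by (meson continuous_at_imp_continuous_on has_derivative_continuous)

section \<open>Kernel averages\<close>

lemma isCont_integral_dominated:
  fixes \<phi> :: "'p::{first_countable_topology,metric_space} \<Rightarrow> 'z \<Rightarrow> real"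
  assumes e: "e > 0"
    and cont: "\<And>z. isCont (\<lambda>\<xi>. \<phi> \<xi> z) \<xi>\<^sub>0"
    and meas: "\<And>\<xi>. \<phi> \<xi> \<in> borel_measurable M"
    and bound: "\<And>\<xi> z. \<xi> \<in> ball \<xi>\<^sub>0 e \<Longrightarrow> \<bar>\<phi> \<xi> z\<bar> \<le> B z"
    and intB: "integrable M B"
  shows "isCont (\<lambda>\<xi>. LINT z|M. \<phi> \<xi> z) \<xi>\<^sub>0"
  unfolding isCont_def tendsto_at_iff_sequentially comp_def
proof (intro allI impI)
  fix X :: "nat \<Rightarrow> 'p" assume X: "\<forall>i. X i \<in> UNIV - {\<xi>\<^sub>0}" "X \<longlonglongrightarrow> \<xi>\<^sub>0"
  obtain N where N: "\<And>n. n \<ge> N \<Longrightarrow> X n \<in> ball \<xi>\<^sub>0 e"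
    using X(2) e by (metis LIMSEQ_iff_nz dist_commute lim_sequentially mem_ball)
  have "(\<lambda>n. LINT z|M. \<phi> (X (n + N)) z) \<longlonglongrightarrow> (LINT z|M. \<phi> \<xi>\<^sub>0 z)"
  proof (rule integral_dominated_convergence[where w = B])
    show "AE z in M. (\<lambda>n. \<phi> (X (n + N)) z) \<longlonglongrightarrow> \<phi> \<xi>\<^sub>0 z"
    proof (rule AE_I2)
      fix z
      have "(\<lambda>n. \<phi> (X n) z) \<longlonglongrightarrow> \<phi> \<xi>\<^sub>0 z"
        by (rule isCont_tendsto_compose[OF cont X(2)])
      thus "(\<lambda>n. \<phi> (X (n + N)) z) \<longlonglongrightarrow> \<phi> \<xi>\<^sub>0 z" by (rule LIMSEQ_ignore_initial_segment)
    qed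
    show "AE z in M. norm (\<phi> (X (n + N)) z) \<le> B z" for n
      using bound[OF N[of "n+N"]] by (intro AE_I2) auto
  qed (use intB meas in auto)
  thus "(\<lambda>n. LINT z|M. \<phi> (X n) z) \<longlonglongrightarrow> (LINT z|M. \<phi> \<xi>\<^sub>0 z)" by (simp add: LIMSEQ_offset)
qed

text \<open>Growth along the points \<open>x + r z\<close>, uniformly for \<open>(x, r)\<close> in a unit ball.\<close>
lemma growth_affine_bound:
  fixes \<phi> :: "'a::euclidean_space \<Rightarrow> real" and \<xi>\<^sub>0 :: "'a \<times> real"
  assumes "\<And>y. \<bar>\<phi> y\<bar> \<le> K * (1 + norm y) powr a" "K \<ge> 0" "a \<ge> 0" "\<xi> \<in> ball \<xi>\<^sub>0 1"
  shows "\<bar>\<phi> (fst \<xi> + snd \<xi> *\<^sub>R z)\<bar> \<le> K * (2 + norm \<xi>\<^sub>0) powr a * (1 + norm z) powr a"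
proof -
  have n1: "norm \<xi> \<le> 1 + norm \<xi>\<^sub>0" using assms(4) norm_triangle_sub[of \<xi> \<xi>\<^sub>0] by (simp add: dist_norm norm_minus_commute)
  have "norm (fst \<xi> + snd \<xi> *\<^sub>R z) \<le> norm (fst \<xi>) + \<bar>snd \<xi>\<bar> * norm z"
    using norm_triangle_ineq[of "fst \<xi>" "snd \<xi> *\<^sub>R z"] by simp
  also have "\<dots> \<le> (1 + norm \<xi>\<^sub>0) + (1 + norm \<xi>\<^sub>0) * norm z"
    using n1 norm_fst_le[of "fst \<xi>" "snd \<xi>"] norm_snd_le[of "snd \<xi>" "fst \<xi>"] by (intro add_mono mult_right_mono) auto
  finally have "norm (fst \<xi> + snd \<xi> *\<^sub>R z) \<le> (1 + norm \<xi>\<^sub>0) + (1 + norm \<xi>\<^sub>0) * norm z" .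
  have "1 + norm (fst \<xi> + snd \<xi> *\<^sub>R z) \<le> (2 + norm \<xi>\<^sub>0) * (1 + norm z)"
  proof -
    have "(2 + norm \<xi>\<^sub>0) * (1 + norm z) = 1 + ((1 + norm \<xi>\<^sub>0) + (1 + norm \<xi>\<^sub>0) * norm z) + norm z" by algebra
    thus ?thesis using \<open>norm (fst \<xi> + snd \<xi> *\<^sub>R z) \<le> (1 + norm \<xi>\<^sub>0) + (1 + norm \<xi>\<^sub>0) * norm z\<close> norm_ge_zero[of z] by linarith
  qed
  hence "(1 + norm (fst \<xi> + snd \<xi> *\<^sub>R z)) powr a \<le> ((2 + norm \<xi>\<^sub>0) * (1 + norm z)) powr a"
    using assms(3) by (intro powr_mono2) auto
  also have "\<dots> = (2 + norm \<xi>\<^sub>0) powr a * (1 + norm z) powr a"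
    by (simp add: powr_mult)
  finally show ?thesis
    using assms(1)[of "fst \<xi> + snd \<xi> *\<^sub>R z"] assms(2) by (smt (verit, best) mult.assoc mult_left_mono)
qed

lemma kavg_integrable:
  fixes \<phi> p :: "'a::euclidean_space \<Rightarrow> real"
  assumes "continuous_on UNIV \<phi>" "growth a \<phi>" "a \<ge> 0" "growth c p" "p \<in> borel_measurable borel"
    and "a + c < - real DIM('a)"
  shows "integrable lborel (\<lambda>z. \<phi> (x + r *\<^sub>R z) * p z)"
proof (rule growth_integrable)
  show "growth (a + c) (\<lambda>z. \<phi> (x + r *\<^sub>R z) * p z)"
    using assms by (intro growth_mult growth_compose)
  have "(\<lambda>z. \<phi> (x + r *\<^sub>R z)) \<in> borel_measurable borel"
    by (intro borel_measurable_continuous_onI continuous_on_compose2[OF assms(1)] continuous_intros) auto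
  thus "(\<lambda>z. \<phi> (x + r *\<^sub>R z) * p z) \<in> borel_measurable borel" using assms(5) by measurable
qed fact

lemma isCont_kavg:
  fixes \<phi> p :: "'a::euclidean_space \<Rightarrow> real"
  assumes cont: "continuous_on UNIV \<phi>" and a: "growth a \<phi>" "a \<ge> 0" and c: "growth c p"
    and p: "p \<in> borel_measurable borel" and ac: "a + c < - real DIM('a)"
  shows "isCont (kavg \<phi> p) \<xi>"
proof -
  obtain K where K: "K \<ge> 0" "\<And>y. \<bar>\<phi> y\<bar> \<le> K * (1 + norm y) powr a" using a growthE by blast
  obtain L where L: "L \<ge> 0" "\<And>y. \<bar>p y\<bar> \<le> L * (1 + norm y) powr c" using c growthE by blast
  define B where "B z = K * L * (2 + norm \<xi>) powr a * (1 + norm z) powr (a + c)" for z :: 'a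
  show ?thesis unfolding kavg_def
  proof (rule isCont_integral_dominated[where e = 1 and B = B])
    fix z
    have c1: "isCont \<phi> y" for y using cont by (simp add: continuous_on_eq_continuous_at)
    have c2: "isCont (\<lambda>\<xi>. fst \<xi> + snd \<xi> *\<^sub>R z) \<xi>"
      by (intro continuous_intros)
    show "isCont (\<lambda>\<xi>. \<phi> (fst \<xi> + snd \<xi> *\<^sub>R z) * p z) \<xi>"
      by (rule continuous_mult[OF isCont_o2[OF c2 c1] continuous_const])
  next
    fix \<eta> :: "'a \<times> real"
    have "(\<lambda>z. \<phi> (fst \<eta> + snd \<eta> *\<^sub>R z)) \<in> borel_measurable borel"
      by (intro borel_measurable_continuous_onI continuous_on_compose2[OF cont] continuous_intros) auto
    thus "(\<lambda>z. \<phi> (fst \<eta> + snd \<eta> *\<^sub>R z) * p z) \<in> borel_measurable lborel" using p by simp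
  next
    fix \<eta> z assume "\<eta> \<in> ball \<xi> 1"
    from growth_affine_bound[OF K(2) K(1) a(2) this, of z]
    have "\<bar>\<phi> (fst \<eta> + snd \<eta> *\<^sub>R z) * p z\<bar> \<le> (K * (2 + norm \<xi>) powr a * (1 + norm z) powr a) * (L * (1 + norm z) powr c)"
      unfolding abs_mult using L K by (intro mult_mono) auto
    thus "\<bar>\<phi> (fst \<eta> + snd \<eta> *\<^sub>R z) * p z\<bar> \<le> B z" by (simp add: B_def powr_add mult_ac)
  next
    show "integrable lborel B" unfolding B_def
      using ac integrable_one_plus_norm_powr[where 'a='a, of "-(a+c)", unfolded minus_minus]
      by (intro integrable_mult_right) linarith
  qed auto
qed

lemma has_derivative_kavg:
  fixes \<phi> p :: "'a::euclidean_space \<Rightarrow> real"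
  assumes der: "has_partials \<phi> \<phi>'"
    and cont: "\<And>b. b \<in> Basis \<Longrightarrow> continuous_on UNIV (\<phi>' b)"
    and a: "\<And>b. b \<in> Basis \<Longrightarrow> growth a (\<phi>' b)" "a \<ge> 0"
    and c: "growth c p" and p: "p \<in> borel_measurable borel"
    and ac: "a + 1 + c < - real DIM('a)"
  shows "(kavg \<phi> p has_derivative
     (\<lambda>h. (\<Sum>b\<in>Basis. (fst h \<bullet> b) * kavg (\<phi>' b) p \<xi>)
        + snd h * (\<Sum>b\<in>Basis. kavg (\<phi>' b) (\<lambda>z. (z \<bullet> b) * p z) \<xi>))) (at \<xi>)"
proof -
  have der': "(\<phi> has_derivative (\<lambda>h. \<Sum>b\<in>Basis. \<phi>' b y * (h \<bullet> b))) (at y)" for y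
    using der by (simp add: has_partials_def)
  note contphi = has_partials_continuous_on[OF der]
  have "\<forall>b\<in>Basis. \<exists>K\<ge>0. \<forall>y. \<bar>\<phi>' b y\<bar> \<le> K * (1 + norm y) powr a"
    using a unfolding growth_def by blast
  then obtain K where K: "\<And>b. b \<in> Basis \<Longrightarrow> K b \<ge> 0"
      "\<And>b y. b \<in> Basis \<Longrightarrow> \<bar>\<phi>' b y\<bar> \<le> K b * (1 + norm y) powr a" by metis
  obtain L where L: "L \<ge> 0" "\<And>y. \<bar>p y\<bar> \<le> L * (1 + norm y) powr c" using c growthE by blast
  define B where "B z = (\<Sum>b\<in>Basis. K b * L * (2 + norm \<xi>) powr a * (1 + norm z) powr (a + 1 + c))" for z :: 'a
  define F where "F \<eta> z h = (\<Sum>b\<in>Basis. \<phi>' b (fst \<eta> + snd \<eta> *\<^sub>R z) * ((fst h + snd h *\<^sub>R z) \<bullet> b)) * p z"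
    for \<eta> h :: "'a \<times> real" and z :: 'a
  have m: "(\<lambda>z. \<phi>' b (fst \<eta> + snd \<eta> *\<^sub>R z)) \<in> borel_measurable borel" if "b \<in> Basis" for b and \<eta> :: "'a \<times> real"
    by (intro borel_measurable_continuous_onI continuous_on_compose2[OF cont[OF that]] continuous_intros) auto
  have "((\<lambda>\<xi>. LINT z|lborel. \<phi> (fst \<xi> + snd \<xi> *\<^sub>R z) * p z) has_derivative (\<lambda>h. LINT z|lborel. F \<xi> z h)) (at \<xi>)"
  proof (rule has_derivative_integral_dominated[where e = 1 and B = B])
    fix \<eta> :: "'a \<times> real" and z :: 'a
    show "((\<lambda>\<xi>. \<phi> (fst \<xi> + snd \<xi> *\<^sub>R z) * p z) has_derivative F \<eta> z) (at \<eta>)"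
      unfolding F_def
      by (rule has_derivative_mult_left, rule has_derivative_compose[where g = \<phi>, OF _ der'])
         (auto intro!: derivative_eq_intros)
  next
    fix \<eta> :: "'a \<times> real"
    show "integrable lborel (\<lambda>z. \<phi> (fst \<eta> + snd \<eta> *\<^sub>R z) * p z)"
      using growth_antiderivative[OF der a] a(2) c p ac
      by (intro kavg_integrable[OF contphi, where a = "a+1" and c = c]) auto
  next
    fix h show "(\<lambda>z. F \<xi> z h) \<in> borel_measurable lborel"
      unfolding F_def using m p by measurable
  next
    fix \<eta> :: "'a \<times> real" and z :: 'a and h assume \<eta>: "\<eta> \<in> ball \<xi> 1"
    have "\<bar>F \<eta> z h\<bar> \<le> (\<Sum>b\<in>Basis. K b * (2 + norm \<xi>) powr a * (1 + norm z) powr a * ((1 + norm z) * norm h)) * (L * (1 + norm z) powr c)"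
      unfolding F_def abs_mult
    proof (rule mult_mono)
      show "\<bar>\<Sum>b\<in>Basis. \<phi>' b (fst \<eta> + snd \<eta> *\<^sub>R z) * ((fst h + snd h *\<^sub>R z) \<bullet> b)\<bar>
        \<le> (\<Sum>b\<in>Basis. K b * (2 + norm \<xi>) powr a * (1 + norm z) powr a * ((1 + norm z) * norm h))"
        unfolding real_norm_def[symmetric]
      proof (rule sum_norm_le)
        fix b :: 'a assume b: "b \<in> Basis"
        have "\<bar>(fst h + snd h *\<^sub>R z) \<bullet> b\<bar> \<le> norm (fst h + snd h *\<^sub>R z)" using b by (rule Basis_le_norm)
        also have "\<dots> \<le> norm (fst h) + \<bar>snd h\<bar> * norm z" using norm_triangle_ineq[of "fst h" "snd h *\<^sub>R z"] by simp
        also have "\<dots> \<le> norm h + norm h * norm z"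
          using norm_fst_le[of "fst h" "snd h"] norm_snd_le[of "snd h" "fst h"] by (intro add_mono mult_right_mono) auto
        finally have "\<bar>(fst h + snd h *\<^sub>R z) \<bullet> b\<bar> \<le> (1 + norm z) * norm h" by (simp add: algebra_simps)
        thus "norm (\<phi>' b (fst \<eta> + snd \<eta> *\<^sub>R z) * ((fst h + snd h *\<^sub>R z) \<bullet> b))
          \<le> K b * (2 + norm \<xi>) powr a * (1 + norm z) powr a * ((1 + norm z) * norm h)"
          using growth_affine_bound[OF K(2)[OF b] K(1)[OF b] a(2) \<eta>, of z] K(1)[OF b]
          unfolding real_norm_def abs_mult by (intro mult_mono) auto
      qed
      show "0 \<le> (\<Sum>b\<in>Basis. K b * (2 + norm \<xi>) powr a * (1 + norm z) powr a * ((1 + norm z) * norm h))"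
        using K by (intro sum_nonneg) auto
    qed (use L in auto)
    also have "\<dots> = B z * norm h"
      unfolding B_def sum_distrib_right powr_add powr_one[OF one_plus_norm_pos(3)]
      by (intro sum.cong refl) (simp only: mult_ac)
    finally show "\<bar>F \<eta> z h\<bar> \<le> B z * norm h" .
  next
    show "integrable lborel B" unfolding B_def
      using ac integrable_one_plus_norm_powr[where 'a='a, of "-(a+1+c)", unfolded minus_minus]
      by (intro Bochner_Integration.integrable_sum integrable_mult_right) linarith
  qed auto
  moreover have "(LINT z|lborel. F \<xi> z h) = (\<Sum>b\<in>Basis. (fst h \<bullet> b) * kavg (\<phi>' b) p \<xi>)
        + snd h * (\<Sum>b\<in>Basis. kavg (\<phi>' b) (\<lambda>z. (z \<bullet> b) * p z) \<xi>)" for h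
  proof -
    have i1: "integrable lborel (\<lambda>z. \<phi>' b (fst \<xi> + snd \<xi> *\<^sub>R z) * p z)" if "b \<in> Basis" for b
      using kavg_integrable[OF cont a(1) a(2) c p] that ac by auto
    have i2: "integrable lborel (\<lambda>z. \<phi>' b (fst \<xi> + snd \<xi> *\<^sub>R z) * ((z \<bullet> b) * p z))" if "b \<in> Basis" for b
    proof (rule kavg_integrable[OF cont a(1) a(2)])
      show "growth (1 + c) (\<lambda>z. (z \<bullet> b) * p z)" by (intro growth_mult growth_inner c)
    qed (use that ac p in auto)
    have "F \<xi> z h = (\<Sum>b\<in>Basis. (fst h \<bullet> b) * (\<phi>' b (fst \<xi> + snd \<xi> *\<^sub>R z) * p z)
        + snd h * (\<phi>' b (fst \<xi> + snd \<xi> *\<^sub>R z) * ((z \<bullet> b) * p z)))" for z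
      unfolding F_def sum_distrib_right
      by (intro sum.cong refl) (simp add: inner_add_left algebra_simps)
    thus ?thesis
      using i1 i2 by (simp add: kavg_def sum.distrib sum_distrib_left)
  qed
  ultimately show ?thesis by (simp add: kavg_def[abs_def])
qed

section \<open>Integrals of partial derivatives\<close>

lemma lborel_integral_translate:
  fixes u :: "'a::euclidean_space \<Rightarrow> real"
  assumes "u \<in> borel_measurable borel"
  shows "(LINT z|lborel. u (z + c)) = (LINT z|lborel. u z)"
proof -
  have "(LINT z|lborel. u z) = (LINT z|distr lborel borel ((+) c). u z)"
    by (simp add: lborel_distr_plus)
  also have "\<dots> = (LINT z|lborel. u (c + z))"
    using assms by (subst integral_distr) auto
  finally show ?thesis by (simp add: add.commute)
qed

lemma one_plus_norm_translate:
  fixes z b :: "'a::euclidean_space"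
  assumes "norm b = 1" "\<bar>s\<bar> \<le> 1" "q \<ge> 0"
  shows "(1 + norm (z + s *\<^sub>R b)) powr (- q) \<le> 2 powr q * (1 + norm z) powr (- q)"
proof -
  have "norm z \<le> norm (z + s *\<^sub>R b) + norm (s *\<^sub>R b)"
    using norm_triangle_ineq4[of "z + s *\<^sub>R b" "s *\<^sub>R b"] by simp
  moreover have "norm (s *\<^sub>R b) \<le> 1" using assms by simp
  moreover have "(1 + m) / 2 \<le> 1 + n" if "m \<le> n + k" "k \<le> 1" "0 \<le> n" for k m n :: real using that by argo
  ultimately have "(1 + norm z) / 2 \<le> 1 + norm (z + s *\<^sub>R b)" using norm_ge_zero by blast
  moreover have "0 < (1 + norm z) / 2" by simp
  ultimately have "(1 + norm (z + s *\<^sub>R b)) powr (- q) \<le> ((1 + norm z) / 2) powr (- q)"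
    using assms(3) by (intro powr_mono2') auto
  also have "\<dots> = 2 powr q * (1 + norm z) powr (- q)"
    by (simp add: powr_divide powr_minus field_simps)
  finally show ?thesis .
qed

text \<open>The integral of \<open>z \<mapsto> u (z + s b)\<close> does not depend on \<open>s\<close>; differentiate it at \<open>s = 0\<close>.\<close>
lemma integral_directional_derivative_zero_integrable:
  fixes u u' :: "'a::euclidean_space \<Rightarrow> real"
  assumes b: "b \<in> Basis"
    and der: "\<And>z. ((\<lambda>s. u (z + s *\<^sub>R b)) has_real_derivative u' z) (at 0)"
    and gu: "growth (- q) u" and gu': "growth (- q) u'" and q: "q > real DIM('a)"
    and mu: "u \<in> borel_measurable borel" and mu': "u' \<in> borel_measurable borel"
  shows "(LINT z|lborel. u' z) = 0"
proof -
  obtain K where K: "K \<ge> 0" "\<And>y. \<bar>u' y\<bar> \<le> K * (1 + norm y) powr (- q)" using gu' growthE by blast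
  have q0: "q \<ge> 0" using q by simp
  have "((\<lambda>s. LINT z|lborel. u (z + s *\<^sub>R b)) has_derivative (\<lambda>h. LINT z|lborel. u' (z + 0 *\<^sub>R b) * h)) (at 0)"
  proof (rule has_derivative_integral_dominated[where e = 1 and B = "\<lambda>z. K * (2 powr q * (1 + norm z) powr (- q))"
      and \<phi>' = "\<lambda>s z h. u' (z + s *\<^sub>R b) * h"])
    fix s :: real and z
    have "((\<lambda>t. u ((z + s *\<^sub>R b) + (t - s) *\<^sub>R b)) has_real_derivative u' (z + s *\<^sub>R b)) (at s)"
      using DERIV_shift[of "\<lambda>t. u ((z + s *\<^sub>R b) + (t - s) *\<^sub>R b)" _ 0 s] der[of "z + s *\<^sub>R b"] by simp
    moreover have "(z + s *\<^sub>R b) + (t - s) *\<^sub>R b = z + t *\<^sub>R b" for t by (simp add: algebra_simps)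
    ultimately show "((\<lambda>t. u (z + t *\<^sub>R b)) has_derivative (*) (u' (z + s *\<^sub>R b))) (at s)"
      by (simp add: has_field_derivative_def)
  next
    fix s :: real
    have i: "integrable lborel u" using gu q mu by (intro growth_integrable) auto
    have "integrable (distr lborel borel ((+) (s *\<^sub>R b))) u" using i by (simp add: lborel_distr_plus)
    thus "integrable lborel (\<lambda>z. u (z + s *\<^sub>R b))"
      using mu by (subst (asm) integrable_distr_eq) (auto simp: add.commute)
  next
    fix s :: real and z :: 'a and h :: real assume "s \<in> ball 0 1"
    hence "(1 + norm (z + s *\<^sub>R b)) powr (- q) \<le> 2 powr q * (1 + norm z) powr (- q)"
      using b q0 by (intro one_plus_norm_translate) auto
    from mult_left_mono[OF this K(1)] K(2)[of "z + s *\<^sub>R b"]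
    have "\<bar>u' (z + s *\<^sub>R b)\<bar> \<le> K * (2 powr q * (1 + norm z) powr (- q))" by linarith
    thus "\<bar>u' (z + s *\<^sub>R b) * h\<bar> \<le> K * (2 powr q * (1 + norm z) powr (- q)) * norm h"
      unfolding abs_mult real_norm_def by (intro mult_right_mono) auto
  next
    show "integrable lborel (\<lambda>z::'a. K * (2 powr q * (1 + norm z) powr (- q)))"
      using q by (intro integrable_mult_right integrable_one_plus_norm_powr)
  qed (use mu' in auto)
  moreover have "(\<lambda>s. LINT z|lborel. u (z + s *\<^sub>R b)) = (\<lambda>s. LINT z|lborel. u z)"
    using lborel_integral_translate[OF mu] by simp
  ultimately have "((\<lambda>s::real. LINT z|lborel. u z) has_derivative (\<lambda>h. LINT z|lborel. u' z * h)) (at 0)"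
    by simp
  from has_derivative_unique[OF this has_derivative_const]
  have "(LINT z|lborel. u' z * 1) = 0" by (rule fun_cong)
  thus ?thesis by simp
qed

text \<open>Here \<open>u\<close> itself need not be integrable, since it decays one order more slowly than \<open>u'\<close>. This is
  needed for the second moments of the kernel when \<open>\<alpha> \<le> 3\<close>.\<close>
lemma integral_directional_derivative_zero:
  fixes u u' :: "'a::euclidean_space \<Rightarrow> real"
  assumes b: "b \<in> Basis"
    and der: "\<And>z. ((\<lambda>s. u (z + s *\<^sub>R b)) has_real_derivative u' z) (at 0)"
    and gu: "growth (1 - q) u" and gu': "growth (- q) u'" and q: "q > real DIM('a)"
    and mu: "u \<in> borel_measurable borel" and mu': "u' \<in> borel_measurable borel"
  shows "(LINT z|lborel. u' z) = 0"
proof -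
  obtain K where K: "K \<ge> 0" "\<And>y. \<bar>u y\<bar> \<le> K * (1 + norm y) powr (1 - q)" using gu growthE by blast
  obtain K' where K': "K' \<ge> 0" "\<And>y. \<bar>u' y\<bar> \<le> K' * (1 + norm y) powr (- q)" using gu' growthE by blast
  \<comment> \<open>Multiply \<open>u\<close> by the cutoff \<open>1 / (1 + \<delta> |z|\<^sup>2)\<close>, whose derivative \<open>c\<close> is at most \<open>3 / (1 + |z|)\<close>
    uniformly in \<open>\<delta> \<le> 1\<close>, and let \<open>\<delta>\<close> tend to zero.\<close>
  define \<delta> where "\<delta> k = inverse (real (Suc k))" for k
  have \<delta>: "\<delta> k > 0" "\<delta> k \<le> 1" for k by (auto simp: \<delta>_def field_simps)
  define w where "w k z = 1 + \<delta> k * (z \<bullet> z)" for k and z :: 'a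
  have w1: "w k z \<ge> 1" for k z using \<delta>(1)[of k] by (simp add: w_def)
  hence w0: "w k z > 0" for k z by (rule less_le_trans[OF zero_less_one])
  have wi: "\<bar>inverse (w k z)\<bar> \<le> 1" for k z
    using w1[of k z] w0[of k z] le_imp_inverse_le[of 1 "w k z"] by simp
  define c where "c k z = - (2 * \<delta> k * (z \<bullet> b)) / (w k z)\<^sup>2" for k z
  have cb: "\<bar>c k z\<bar> \<le> 3 * (1 + norm z) powr (- 1)" for k z
  proof -
    let ?n = "norm z"
    have n: "w k z = 1 + \<delta> k * ?n\<^sup>2" by (simp add: w_def power2_norm_eq_inner)
    have "2 * ?n \<le> 1 + ?n\<^sup>2" using sum_squares_bound[of 1 ?n] by simp
    from mult_left_mono[OF this, of "\<delta> k"] have "2 * \<delta> k * ?n \<le> \<delta> k + \<delta> k * ?n\<^sup>2"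
      using \<delta>[of k] by (simp add: algebra_simps)
    hence "2 * \<delta> k * ?n * (1 + ?n) \<le> 3 * w k z"
      using \<delta>[of k] n by (simp add: algebra_simps power2_eq_square)
    also have "\<dots> \<le> 3 * (w k z)\<^sup>2" using w1[of k z] by (simp add: power2_eq_square mult_le_cancel_left1)
    finally have "2 * \<delta> k * ?n * (1 + ?n) \<le> 3 * (w k z)\<^sup>2" .
    moreover have "\<bar>z \<bullet> b\<bar> \<le> ?n" using b Basis_le_norm by blast
    hence "2 * \<delta> k * \<bar>z \<bullet> b\<bar> * (1 + ?n) \<le> 2 * \<delta> k * ?n * (1 + ?n)"
      using \<delta>(1)[of k] by (intro mult_right_mono mult_left_mono) auto
    ultimately have "2 * \<delta> k * \<bar>z \<bullet> b\<bar> * (1 + ?n) \<le> 3 * (w k z)\<^sup>2" by linarith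
    hence "2 * \<delta> k * \<bar>z \<bullet> b\<bar> / (w k z)\<^sup>2 \<le> 3 / (1 + ?n)"
      using w0[of k z] by (simp add: field_simps)
    thus ?thesis using \<delta>(1)[of k] by (simp add: c_def abs_mult powr_minus divide_inverse)
  qed
  have wb: "\<bar>inverse (w k z)\<bar> \<le> (2 * inverse (\<delta> k)) * (1 + norm z) powr (- 1)" for k z
  proof -
    have "(1 + norm z) \<le> 2 * (1 + (norm z)\<^sup>2)"
    proof -
      have "1 + n \<le> 2 * (1 + m)" if "2 * n \<le> 1 + m" "0 \<le> m" for m n :: real using that by argo
      moreover have "2 * norm z \<le> 1 + (norm z)\<^sup>2" using sum_squares_bound[of 1 "norm z"] by simp
      ultimately show ?thesis using zero_le_power2 by blast
    qed
    also have "\<dots> \<le> 2 * inverse (\<delta> k) * w k z"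
      using \<delta>[of k] by (simp add: w_def power2_norm_eq_inner field_simps)
    finally have "inverse (w k z) * (1 + norm z) \<le> inverse (w k z) * (2 * inverse (\<delta> k) * w k z)"
      using w0[of k z] by (intro mult_left_mono) auto
    also have "\<dots> = 2 * inverse (\<delta> k)" using w0[of k z] by simp
    finally have "inverse (w k z) \<le> 2 * inverse (\<delta> k) / (1 + norm z)"
      by (subst pos_le_divide_eq) auto
    thus ?thesis using w0[of k z] by (simp add: powr_minus_divide)
  qed
  have mw [measurable]: "w k \<in> borel_measurable borel" for k unfolding w_def by measurable
  have mc [measurable]: "c k \<in> borel_measurable borel" for k unfolding c_def by measurable
  have z: "(LINT z|lborel. u' z * inverse (w k z) + u z * c k z) = 0" for k
  proof (rule integral_directional_derivative_zero_integrable[OF b, where u = "\<lambda>z. u z * inverse (w k z)" and q = q])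
    fix z
    have dw: "((\<lambda>s. inverse (w k (z + s *\<^sub>R b))) has_real_derivative c k z) (at 0)"
      unfolding w_def c_def using w0[of k z, unfolded w_def]
      by (auto intro!: derivative_eq_intros simp: inner_add_left inner_add_right inner_commute power2_eq_square divide_simps)
    show "((\<lambda>s. u (z + s *\<^sub>R b) * inverse (w k (z + s *\<^sub>R b))) has_real_derivative u' z * inverse (w k z) + u z * c k z) (at 0)"
      using DERIV_mult'[OF der[of z] dw] by (simp add: algebra_simps)
  next
    have "growth (- 1) (\<lambda>z. inverse (w k z))" using wb by (rule growthI)
    from growth_mult[OF gu this] show "growth (- q) (\<lambda>z. u z * inverse (w k z))" by simp
    have "growth 0 (\<lambda>z. inverse (w k z))"
      using wi[of k] by (intro growthI[of _ 1]) simp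
    from growth_mult[OF gu' this] have 1: "growth (- q) (\<lambda>z. u' z * inverse (w k z))" by simp
    have "growth (- 1) (c k)" using cb by (rule growthI)
    from growth_mult[OF gu this] have 2: "growth (- q) (\<lambda>z. u z * c k z)" by simp
    show "growth (- q) (\<lambda>z. u' z * inverse (w k z) + u z * c k z)" by (rule growth_add[OF 1 2])
  qed (use mu mu' q in measurable)
  have "(\<lambda>k. LINT z|lborel. u' z * inverse (w k z) + u z * c k z) \<longlonglongrightarrow> (LINT z|lborel. u' z)"
  proof (rule integral_dominated_convergence[where w = "\<lambda>z. (K' + 3 * K) * (1 + norm z) powr (- q)"])
    fix k
    show "AE z in lborel. norm (u' z * inverse (w k z) + u z * c k z) \<le> (K' + 3 * K) * (1 + norm z) powr (- q)"
    proof (rule AE_I2)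
      fix z :: 'a
      have "\<bar>u' z * inverse (w k z)\<bar> \<le> K' * (1 + norm z) powr (- q) * 1"
        unfolding abs_mult using K' wi[of k z] by (intro mult_mono) auto
      moreover have "\<bar>u z * c k z\<bar> \<le> (K * (1 + norm z) powr (1 - q)) * (3 * (1 + norm z) powr (- 1))"
        unfolding abs_mult using K cb[of k z] by (intro mult_mono) auto
      moreover have "(1 + norm z) powr (1 - q) * (1 + norm z) powr (- 1) = (1 + norm z) powr (- q)"
        using powr_add[of "1 + norm z" "1 - q" "- 1"] by simp
      moreover have "(K * (1 + norm z) powr (1 - q)) * (3 * (1 + norm z) powr (- 1))
          = 3 * K * ((1 + norm z) powr (1 - q) * (1 + norm z) powr (- 1))" by (simp only: mult_ac)
      ultimately have "\<bar>u' z * inverse (w k z)\<bar> + \<bar>u z * c k z\<bar>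
          \<le> K' * (1 + norm z) powr (- q) + 3 * K * (1 + norm z) powr (- q)"
        by (simp only: mult_1_right)
      thus "norm (u' z * inverse (w k z) + u z * c k z) \<le> (K' + 3 * K) * (1 + norm z) powr (- q)"
        using abs_triangle_ineq[of "u' z * inverse (w k z)" "u z * c k z"] by (simp add: distrib_right)
    qed
  next
    show "AE z in lborel. (\<lambda>k. u' z * inverse (w k z) + u z * c k z) \<longlonglongrightarrow> u' z"
    proof (rule AE_I2)
      fix z :: 'a
      have d0: "\<delta> \<longlonglongrightarrow> 0" unfolding \<delta>_def by (rule LIMSEQ_inverse_real_of_nat)
      have "(\<lambda>k. w k z) \<longlonglongrightarrow> 1 + 0 * (z \<bullet> z)" unfolding w_def by (intro tendsto_intros d0)
      hence l1: "(\<lambda>k. w k z) \<longlonglongrightarrow> 1" by simp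
      have "(\<lambda>k. u' z * inverse (w k z) + u z * c k z) \<longlonglongrightarrow> u' z * inverse 1 + u z * (- (2 * 0 * (z \<bullet> b)) / 1\<^sup>2)"
        unfolding c_def by (intro tendsto_intros d0 l1) auto
      thus "(\<lambda>k. u' z * inverse (w k z) + u z * c k z) \<longlonglongrightarrow> u' z" by simp
    qed
  next
    show "integrable lborel (\<lambda>z::'a. (K' + 3 * K) * (1 + norm z) powr (- q))"
      using q by (intro integrable_mult_right integrable_one_plus_norm_powr)
  qed (use mu mu' in measurable)
  thus ?thesis unfolding z by (simp add: LIMSEQ_const_iff)
qed

section \<open>Moments of the kernel\<close>

lemma has_derivative_directional:
  fixes g :: "'a::real_normed_vector \<Rightarrow> real"
  assumes "(g has_derivative g') (at x)"
  shows "((\<lambda>s. g (x + s *\<^sub>R b)) has_real_derivative g' b) (at 0)"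
proof -
  have l: "((\<lambda>s. x + s *\<^sub>R b) has_derivative (\<lambda>h. h *\<^sub>R b)) (at 0)"
    by (auto intro!: derivative_eq_intros)
  have "((\<lambda>s. g (x + s *\<^sub>R b)) has_derivative (\<lambda>h. g' (h *\<^sub>R b))) (at 0)"
    by (rule has_derivative_compose[OF l, of g]) (use assms in simp)
  moreover have "g' (h *\<^sub>R b) = g' b * h" for h
    using linear_cmul[OF has_derivative_linear[OF assms], of h b] by simp
  ultimately show ?thesis by (simp add: has_field_derivative_def)
qed

lemma has_partials_directional:
  assumes "has_partials \<phi> \<phi>'" "b \<in> Basis"
  shows "((\<lambda>s. \<phi> (x + s *\<^sub>R b)) has_real_derivative \<phi>' b x) (at 0)"
proof -
  have e: "(\<Sum>c\<in>Basis. \<phi>' c x * (b \<bullet> c)) = \<phi>' b x"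
    using assms(2) by (simp add: inner_Basis if_distrib cong: if_cong)
  have "(\<phi> has_derivative (\<lambda>h. \<Sum>c\<in>Basis. \<phi>' c x * (h \<bullet> c))) (at x)"
    using assms(1) by (simp add: has_partials_def)
  from has_derivative_directional[OF this, of b] show ?thesis unfolding e .
qed

lemma kern_directional:
  "((\<lambda>t. kern s (z + t *\<^sub>R b)) has_real_derivative - 2 * s * kern (s + 1) z * (z \<bullet> b)) (at 0)"
  by (rule has_derivative_directional[OF has_derivative_kern])

lemma kern_integrable: "2 * s > real DIM('a) \<Longrightarrow> integrable lborel (kern s :: 'a::euclidean_space \<Rightarrow> real)"
  by (rule growth_integrable[OF growth_kern]) auto

lemma integral_kern_pos:
  assumes "2 * s > real DIM('a)"
  shows "0 < (LINT z|lborel. kern s (z::'a::euclidean_space))"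
proof -
  have "(LINT z|lborel. kern s (z::'a)) \<ge> 0" using kern_pos[of s] by (intro Bochner_Integration.integral_nonneg) (auto intro: less_imp_le)
  moreover have "(LINT z|lborel. kern s (z::'a)) \<noteq> 0"
  proof
    assume "(LINT z|lborel. kern s (z::'a)) = 0"
    hence "AE z in lborel. kern s (z::'a) = 0"
      using integral_nonneg_eq_0_iff_AE[OF kern_integrable[OF assms]] kern_pos[of s]
      by (auto intro: less_imp_le)
    hence "AE z in (lborel::'a measure). False"
      by (rule AE_mp) (use kern_pos[of s] in \<open>auto intro!: AE_I2 simp: less_le\<close>)
    hence "UNIV \<in> null_sets (lborel :: 'a measure)"
      using AE_iff_null[of "lborel :: 'a measure" "\<lambda>_. False"] by simp
    hence "emeasure (lborel :: 'a measure) UNIV = 0" by blast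
    thus False by simp
  qed
  ultimately show ?thesis by linarith
qed

text \<open>The integrand is a multiple of the derivative of \<open>kern (s - 1)\<close> in the direction \<open>b\<close>.\<close>
lemma integral_first_moment_kern:
  fixes b :: "'a::euclidean_space"
  assumes b: "b \<in> Basis" and s: "2 * s - 1 > real DIM('a)"
  shows "(LINT z|lborel. (z \<bullet> b) * kern s z) = 0"
proof -
  have "DIM('a) \<ge> 1" by (simp add: Suc_leI)
  hence s1: "s > 1" using s by linarith
  have "(LINT z|lborel. - 2 * (s - 1) * kern s z * (z \<bullet> b)) = 0"
  proof (rule integral_directional_derivative_zero[OF b, where u = "kern (s - 1)" and q = "2 * s - 1"])
    show "((\<lambda>t. kern (s - 1) (z + t *\<^sub>R b)) has_real_derivative - 2 * (s - 1) * kern s z * (z \<bullet> b)) (at 0)" for z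
      using kern_directional[of "s - 1" z b] by simp
    show "growth (1 - (2 * s - 1)) (kern (s - 1) :: 'a \<Rightarrow> real)"
      using growth_kern[of "s - 1", where 'a = 'a] s1 by (simp add: algebra_simps)
    have "growth (- 2 * s + 1) (\<lambda>z. (- 2 * (s - 1) * kern s z) * (z \<bullet> b))"
      by (rule growth_mult[OF growth_cmult[OF growth_kern] growth_inner]) (use s1 in simp)
    thus "growth (- (2 * s - 1)) (\<lambda>z. - 2 * (s - 1) * kern s z * (z \<bullet> b))" by simp
  qed (use s in measurable)
  hence "- 2 * (s - 1) * (LINT z|lborel. (z \<bullet> b) * kern s z) = 0"
    by (simp add: mult.assoc mult.commute[of "kern s _"] del: mult_minus_left)
  thus ?thesis using s1 by simp
qed

lemma integrable_second_moment_kern: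
  fixes b c :: "'a::euclidean_space"
  assumes "2 * s - 2 > real DIM('a)"
  shows "integrable lborel (\<lambda>z. (z \<bullet> b) * (z \<bullet> c) * kern s z)"
proof (rule growth_integrable)
  have "s \<ge> 0" using assms by simp
  from growth_mult[OF growth_mult[OF growth_inner[of b] growth_inner[of c]] growth_kern[OF this]]
  show "growth (2 - 2 * s) (\<lambda>z. (z \<bullet> b) * (z \<bullet> c) * kern s z)" by simp
qed (use assms in auto)

text \<open>Integrating the \<open>b\<close>-derivative of \<open>(z \<bullet> c) kern (s - 1) z\<close> expresses every second moment through
  \<open>L\<close>, the integral of \<open>kern (s - 1)\<close>. Since \<open>kern (s - 1) z = (1 + |z|\<^sup>2) kern s z\<close>, the trace of the
  moments and the mass of \<open>kern s\<close> add up to \<open>L\<close>, which determines \<open>L\<close>.\<close>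
lemma integral_second_moment_kern:
  fixes b c :: "'a::euclidean_space"
  assumes b: "b \<in> Basis" and c: "c \<in> Basis" and s: "2 * s - 2 > real DIM('a)"
  shows "(LINT z|lborel. (z \<bullet> b) * (z \<bullet> c) * kern s z)
    = (b \<bullet> c) * (LINT z|lborel. kern s (z::'a)) / (2 * s - 2 - real DIM('a))"
proof -
  have "DIM('a) \<ge> 1" by (simp add: Suc_leI)
  hence s1: "s > 1" using s by linarith
  define L where "L = (LINT z|lborel. kern (s - 1) (z::'a))"
  define M where "M b c = (LINT z|lborel. (z \<bullet> b) * (z \<bullet> c) * kern s z)" for b c :: 'a
  note iM = integrable_second_moment_kern[OF s]
  have iL: "integrable lborel (kern (s - 1) :: 'a \<Rightarrow> real)" using s by (intro kern_integrable) simp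
  have iA: "integrable lborel (kern s :: 'a \<Rightarrow> real)" using s by (intro kern_integrable) simp
  have M: "2 * (s - 1) * M b c = (b \<bullet> c) * L" if b: "b \<in> Basis" for b c :: 'a
  proof -
    have "(LINT z|lborel. (b \<bullet> c) * kern (s - 1) z - 2 * (s - 1) * ((z \<bullet> b) * (z \<bullet> c) * kern s z)) = 0"
    proof (rule integral_directional_derivative_zero[OF b, where u = "\<lambda>z. (z \<bullet> c) * kern (s - 1) z" and q = "2 * s - 2"])
      fix z
      have d: "((\<lambda>t. (z + t *\<^sub>R b) \<bullet> c) has_real_derivative b \<bullet> c) (at 0)"
        by (auto intro!: derivative_eq_intros simp: inner_add_left)
      show "((\<lambda>t. ((z + t *\<^sub>R b) \<bullet> c) * kern (s - 1) (z + t *\<^sub>R b)) has_real_derivative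
        (b \<bullet> c) * kern (s - 1) z - 2 * (s - 1) * ((z \<bullet> b) * (z \<bullet> c) * kern s z)) (at 0)"
        using DERIV_mult'[OF d kern_directional[of "s - 1" z b]] by (simp add: algebra_simps)
    next
      have gk: "growth (2 - 2 * s) (kern (s - 1) :: 'a \<Rightarrow> real)"
        using growth_kern[of "s - 1", where 'a = 'a] s1 by (simp add: algebra_simps)
      from growth_mult[OF growth_inner[of c] gk]
      show "growth (1 - (2 * s - 2)) (\<lambda>z. (z \<bullet> c) * kern (s - 1) z)" by (simp add: algebra_simps)
      have "growth (1 + 1 + - 2 * s) (\<lambda>z. (z \<bullet> b) * (z \<bullet> c) * kern s z)"
        using s1 by (intro growth_mult growth_inner growth_kern) auto
      hence "growth (2 - 2 * s) (\<lambda>z. (z \<bullet> b) * (z \<bullet> c) * kern s z)" by simp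
      from growth_diff[OF growth_cmult[OF gk] growth_cmult[OF this]]
      show "growth (- (2 * s - 2)) (\<lambda>z. (b \<bullet> c) * kern (s - 1) z - 2 * (s - 1) * ((z \<bullet> b) * (z \<bullet> c) * kern s z))"
        by simp
    qed (use s in measurable)
    thus ?thesis using iM iL by (simp add: M_def L_def)
  qed
  have "L = (LINT z|lborel. kern s z + (\<Sum>b\<in>Basis. (z \<bullet> b) * (z \<bullet> b) * kern s (z::'a)))"
    unfolding L_def
  proof (rule Bochner_Integration.integral_cong[OF refl])
    fix z :: 'a
    have "(norm z)\<^sup>2 = (\<Sum>b\<in>Basis. (z \<bullet> b) * (z \<bullet> b))"
      unfolding power2_norm_eq_inner by (rule euclidean_inner)
    thus "kern (s - 1) z = kern s z + (\<Sum>b\<in>Basis. (z \<bullet> b) * (z \<bullet> b) * kern s z)"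
      using kern_Suc[of z "s - 1"] by (simp add: sum_distrib_left algebra_simps)
  qed
  also have "\<dots> = (LINT z|lborel. kern s (z::'a)) + (\<Sum>b\<in>Basis. M b b)"
    using iA iM by (simp add: M_def)
  finally have L: "L = (LINT z|lborel. kern s (z::'a)) + (\<Sum>b\<in>Basis. M b b)" .
  have "2 * (s - 1) * (\<Sum>b\<in>Basis. M b b) = (\<Sum>b\<in>(Basis::'a set). L)"
    unfolding sum_distrib_left using M by (intro sum.cong) (auto simp: inner_Basis)
  hence "2 * (s - 1) * L = 2 * (s - 1) * (LINT z|lborel. kern s (z::'a)) + real DIM('a) * L"
    by (subst L) (simp add: distrib_left)
  hence "(2 * s - 2 - real DIM('a)) * L = 2 * (s - 1) * (LINT z|lborel. kern s (z::'a))"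
    by (simp add: algebra_simps)
  hence "L = 2 * (s - 1) * (LINT z|lborel. kern s (z::'a)) / (2 * s - 2 - real DIM('a))"
    using s by (simp add: field_simps)
  hence e: "2 * (s - 1) * M b c = 2 * (s - 1) * ((b \<bullet> c) * (LINT z|lborel. kern s (z::'a)) / (2 * s - 2 - real DIM('a)))"
    using M[OF b, of c] by simp
  have "2 * (s - 1) \<noteq> 0" using s1 by simp
  from iffD1[OF mult_left_cancel[OF this] e] show ?thesis unfolding M_def .
qed

section \<open>A Liouville theorem\<close>

text \<open>Liouville's theorem. For a kernel \<open>kern s\<close> with large \<open>s\<close>, harmonicity makes the average
  \<open>kavg v (kern s) (x, r)\<close> independent of \<open>r\<close>, hence equal to \<open>v x\<close> times the mass of the kernel.
  Differentiating in \<open>x\<close> and moving the derivative to the kernel bounds \<open>r |\<nabla> v|\<close> for all \<open>r\<close>.\<close>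
lemma bounded_harmonic_constant:
  fixes v :: "'a::euclidean_space \<Rightarrow> real"
  assumes v: "has_partials v v'"
    and v': "\<And>b. b \<in> Basis \<Longrightarrow> has_partials (v' b) (v'' b)"
    and cont: "\<And>b c. b \<in> Basis \<Longrightarrow> c \<in> Basis \<Longrightarrow> continuous_on UNIV (v'' b c)"
    and gr: "\<And>b c. b \<in> Basis \<Longrightarrow> c \<in> Basis \<Longrightarrow> growth a (v'' b c)" and a: "a \<ge> 0"
    and bdd: "\<And>y. \<bar>v y\<bar> \<le> S"
    and harm: "\<And>y. (\<Sum>b\<in>Basis. v'' b b y) = 0"
  shows "v x = v y"
proof -
  \<comment> \<open>This choice gives \<open>v\<close>, whose growth exponent is at most \<open>a + 2\<close>, and its derivatives an
    integrable product with the kernels that occur below.\<close>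
  define s where "s = (real DIM('a) + a + 6) / 2"
  have s: "2 * s = real DIM('a) + a + 6" by (simp add: s_def)
  have s1: "s > 1" using a by (simp add: s_def)
  have gv': "growth (a + 1) (v' b)" if "b \<in> Basis" for b
    using growth_antiderivative[OF v'[OF that] gr[OF that] a] .
  have gv: "growth (a + 2) v"
    using growth_antiderivative[OF v gv'] a by (simp add: add.assoc)
  note cv0 = has_partials_continuous_on[OF v] and cv1 = has_partials_continuous_on[OF v']
  define A where "A = (LINT z|lborel. kern s (z::'a))"
  have A: "A > 0" unfolding A_def using s a by (intro integral_kern_pos) simp
  have mcomp: "(\<lambda>z. \<phi> (x + r *\<^sub>R z)) \<in> borel_measurable borel" if "continuous_on UNIV \<phi>" for \<phi> :: "'a \<Rightarrow> real" and x r
    by (intro borel_measurable_continuous_onI continuous_on_compose2[OF that] continuous_intros) auto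
  have dcomp: "((\<lambda>t. \<phi> (x + r *\<^sub>R (z + t *\<^sub>R b))) has_real_derivative r * \<phi>' b (x + r *\<^sub>R z)) (at 0)"
    if "has_partials \<phi> \<phi>'" "b \<in> Basis" for \<phi> \<phi>' x r z b
  proof -
    have "((\<lambda>t. \<phi> ((x + r *\<^sub>R z) + (r * t) *\<^sub>R b)) has_real_derivative \<phi>' b (x + r *\<^sub>R z) * r) (at 0)"
      by (rule DERIV_chain2[where f = "\<lambda>s. \<phi> ((x + r *\<^sub>R z) + s *\<^sub>R b)"])
         (use has_partials_directional[OF that, of "x + r *\<^sub>R z"] in \<open>auto intro!: derivative_eq_intros\<close>)
    thus ?thesis by (simp add: algebra_simps)
  qed
  have gk: "growth (- 2 * s) (kern s :: 'a \<Rightarrow> real)" "growth (2 - 2 * s) (kern (s - 1) :: 'a \<Rightarrow> real)"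
    "growth (- 2 - 2 * s) (kern (s + 1) :: 'a \<Rightarrow> real)"
    using growth_kern[of s, where 'a = 'a] growth_kern[of "s - 1", where 'a = 'a] growth_kern[of "s + 1", where 'a = 'a] s1
    by (simp_all add: algebra_simps)
  \<comment> \<open>Integration by parts: \<open>(z \<bullet> b) kern s z\<close> is, up to a factor, the derivative of \<open>kern (s - 1)\<close>.\<close>
  have ibp1: "2 * (s - 1) * kavg (v' b) (\<lambda>z. (z \<bullet> b) * kern s z) (x, r) = r * kavg (v'' b b) (kern (s - 1)) (x, r)"
    if b: "b \<in> Basis" for b x r
  proof -
    have g1: "growth (- (real DIM('a) + 4)) (\<lambda>z. v'' b b (x + r *\<^sub>R z) * kern (s - 1) z)"
      by (rule growth_eq[OF growth_mult[OF growth_compose[OF gr[OF b b] a] gk(2)]]) (simp add: s)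
    have "growth (a + 1 + (1 + - 2 * s)) (\<lambda>z. v' b (x + r *\<^sub>R z) * ((z \<bullet> b) * kern s z))"
      using a by (intro growth_mult growth_compose gv' b growth_inner gk) auto
    hence g2: "growth (- (real DIM('a) + 4)) (\<lambda>z. v' b (x + r *\<^sub>R z) * ((z \<bullet> b) * kern s z))" by (rule growth_eq) (simp add: s)
    have "(LINT z|lborel. r * (v'' b b (x + r *\<^sub>R z) * kern (s - 1) z)
       - (2 * (s - 1)) * (v' b (x + r *\<^sub>R z) * ((z \<bullet> b) * kern s z))) = 0"
    proof (rule integral_directional_derivative_zero[OF b, where u = "\<lambda>z. v' b (x + r *\<^sub>R z) * kern (s - 1) z" and q = "real DIM('a) + 4"])
      fix z
      show "((\<lambda>t. v' b (x + r *\<^sub>R (z + t *\<^sub>R b)) * kern (s - 1) (z + t *\<^sub>R b)) has_real_derivative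
        r * (v'' b b (x + r *\<^sub>R z) * kern (s - 1) z) - (2 * (s - 1)) * (v' b (x + r *\<^sub>R z) * ((z \<bullet> b) * kern s z))) (at 0)"
        by (rule DERIV_cong[OF DERIV_mult'[OF dcomp[OF v'[OF b] b] kern_directional[of "s - 1" z b]]])
           (simp add: algebra_simps)
      have "growth (a + 1 + (2 - 2 * s)) (\<lambda>z. v' b (x + r *\<^sub>R z) * kern (s - 1) z)"
        using a by (intro growth_mult growth_compose gv' b gk) auto
      thus "growth (1 - (real DIM('a) + 4)) (\<lambda>z. v' b (x + r *\<^sub>R z) * kern (s - 1) z)" by (rule growth_eq) (simp add: s)
      show "growth (- (real DIM('a) + 4)) (\<lambda>z. r * (v'' b b (x + r *\<^sub>R z) * kern (s - 1) z)
       - (2 * (s - 1)) * (v' b (x + r *\<^sub>R z) * ((z \<bullet> b) * kern s z)))"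
        by (intro growth_diff growth_cmult g1 g2)
    qed (use mcomp[OF cont[OF b b]] mcomp[OF cv1[OF b]] in measurable)
    moreover have "integrable lborel (\<lambda>z. v'' b b (x + r *\<^sub>R z) * kern (s - 1) z)"
      by (rule growth_integrable[OF g1]) (use mcomp[OF cont[OF b b]] in measurable)
    moreover have "integrable lborel (\<lambda>z. v' b (x + r *\<^sub>R z) * ((z \<bullet> b) * kern s z))"
      by (rule growth_integrable[OF g2]) (use mcomp[OF cv1[OF b]] in measurable)
    ultimately show ?thesis by (simp add: kavg_def)
  qed
  have sum0: "(\<Sum>b\<in>Basis. kavg (v' b) (\<lambda>z. (z \<bullet> b) * kern s z) (x, r)) = 0" for x r
  proof -
    have "2 * (s - 1) * (\<Sum>b\<in>Basis. kavg (v' b) (\<lambda>z. (z \<bullet> b) * kern s z) (x, r))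
        = r * (\<Sum>b\<in>Basis. kavg (v'' b b) (kern (s - 1)) (x, r))"
      unfolding sum_distrib_left using ibp1 by (intro sum.cong) auto
    also have "(\<Sum>b\<in>Basis. kavg (v'' b b) (kern (s - 1)) (x, r))
        = (LINT z|lborel. (\<Sum>b\<in>Basis. v'' b b (x + r *\<^sub>R z) * kern (s - 1) z))"
      unfolding kavg_def fst_conv snd_conv
      by (rule Bochner_Integration.integral_sum[symmetric])
         (intro kavg_integrable[OF cont gr a gk(2)], auto simp: s)
    also have "\<dots> = 0" by (simp add: sum_distrib_right[symmetric] harm)
    finally show ?thesis using s1 by simp
  qed
  \<comment> \<open>By \<open>sum0\<close> the derivative of the average with respect to \<open>r\<close> vanishes.\<close>
  have mean: "kavg v (kern s) (x, r) = v x * A" for x r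
  proof -
    have d: "((\<lambda>r. kavg v (kern s) (x, r)) has_real_derivative 0) (at r)" for r
    proof -
      have "((\<lambda>r. (x, r)) has_derivative (\<lambda>k. (0, k))) (at r)" by (auto intro!: derivative_eq_intros)
      from has_derivative_compose[OF this, where g = "kavg v (kern s)", OF has_derivative_kavg[OF v cv1 gv' _ gk(1)]]
      have "((\<lambda>r. kavg v (kern s) (x, r)) has_derivative (\<lambda>k. 0)) (at r)"
        using a by (simp add: sum0 s)
      thus ?thesis by (simp add: has_field_derivative_def lambda_zero)
    qed
    have "kavg v (kern s) (x, r) = kavg v (kern s) (x, 0)" using DERIV_isconst_all[of "\<lambda>r. kavg v (kern s) (x, r)" r 0] d by blast
    thus ?thesis by (simp add: kavg_def A_def)
  qed
  have grad: "v' b x = 0" if b: "b \<in> Basis" for b x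
  proof (rule ccontr)
    assume nz: "v' b x \<noteq> 0"
    define C where "C = 2 * s * S * (LINT z|lborel. \<bar>z \<bullet> b\<bar> * kern (s + 1) z)"
    have bound: "r * \<bar>v' b x * A\<bar> \<le> C" if r: "r > 0" for r
    proof -
      have c: "(\<lambda>x. kavg v (kern s) (x, r)) = (\<lambda>x. v x * A)" using mean by auto
      have "((\<lambda>x. (x, r)) has_derivative (\<lambda>h. (h, 0))) (at x)" by (auto intro!: derivative_eq_intros)
      from has_derivative_compose[OF this, where g = "kavg v (kern s)", OF has_derivative_kavg[OF v cv1 gv' _ gk(1)]]
      have "((\<lambda>x. kavg v (kern s) (x, r)) has_derivative (\<lambda>h. \<Sum>c\<in>Basis. (h \<bullet> c) * kavg (v' c) (kern s) (x, r))) (at x)"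
        using a by (simp add: s)
      hence "((\<lambda>x. v x * A) has_derivative (\<lambda>h. \<Sum>c\<in>Basis. (h \<bullet> c) * kavg (v' c) (kern s) (x, r))) (at x)" by (simp add: c)
      moreover have "((\<lambda>x. v x * A) has_derivative (\<lambda>h. (\<Sum>c\<in>Basis. v' c x * (h \<bullet> c)) * A)) (at x)"
        using v unfolding has_partials_def by (intro has_derivative_mult_left) auto
      ultimately have "(\<lambda>h. \<Sum>c\<in>Basis. (h \<bullet> c) * kavg (v' c) (kern s) (x, r)) = (\<lambda>h. (\<Sum>c\<in>Basis. v' c x * (h \<bullet> c)) * A)"
        by (rule has_derivative_unique)
      from fun_cong[OF this, of b] have k: "kavg (v' b) (kern s) (x, r) = v' b x * A"
        using b by (simp add: inner_Basis if_distrib if_distribR cong: if_cong)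
      have g1: "growth (- (real DIM('a) + 5)) (\<lambda>z. v' b (x + r *\<^sub>R z) * kern s z)"
        by (rule growth_eq[OF growth_mult[OF growth_compose[OF gv'[OF b]] gk(1)]]) (use a in \<open>simp_all add: s\<close>)
      have "growth (a + 2 + (1 + (- 2 - 2 * s))) (\<lambda>z. v (x + r *\<^sub>R z) * ((z \<bullet> b) * kern (s + 1) z))"
        using a by (intro growth_mult growth_compose gv growth_inner gk) auto
      hence g2: "growth (- (real DIM('a) + 5)) (\<lambda>z. v (x + r *\<^sub>R z) * ((z \<bullet> b) * kern (s + 1) z))" by (rule growth_eq) (simp add: s)
      have "(LINT z|lborel. r * (v' b (x + r *\<^sub>R z) * kern s z)
         - (2 * s) * (v (x + r *\<^sub>R z) * ((z \<bullet> b) * kern (s + 1) z))) = 0"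
      proof (rule integral_directional_derivative_zero[OF b, where u = "\<lambda>z. v (x + r *\<^sub>R z) * kern s z" and q = "real DIM('a) + 5"])
        fix z
        show "((\<lambda>t. v (x + r *\<^sub>R (z + t *\<^sub>R b)) * kern s (z + t *\<^sub>R b)) has_real_derivative
          r * (v' b (x + r *\<^sub>R z) * kern s z) - (2 * s) * (v (x + r *\<^sub>R z) * ((z \<bullet> b) * kern (s + 1) z))) (at 0)"
          by (rule DERIV_cong[OF DERIV_mult'[OF dcomp[OF v b] kern_directional[of s z b]]])
             (simp add: algebra_simps)
        have "growth (a + 2 + - 2 * s) (\<lambda>z. v (x + r *\<^sub>R z) * kern s z)"
          using a by (intro growth_mult growth_compose gv gk) auto
        thus "growth (1 - (real DIM('a) + 5)) (\<lambda>z. v (x + r *\<^sub>R z) * kern s z)" by (rule growth_eq) (simp add: s)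
        show "growth (- (real DIM('a) + 5)) (\<lambda>z. r * (v' b (x + r *\<^sub>R z) * kern s z)
         - (2 * s) * (v (x + r *\<^sub>R z) * ((z \<bullet> b) * kern (s + 1) z)))"
          by (intro growth_diff growth_cmult g1 g2)
      qed (use mcomp[OF cv0] mcomp[OF cv1[OF b]] in measurable)
      moreover have "integrable lborel (\<lambda>z. v' b (x + r *\<^sub>R z) * kern s z)"
        by (rule growth_integrable[OF g1]) (use mcomp[OF cv1[OF b]] in measurable)
      moreover have i2: "integrable lborel (\<lambda>z. v (x + r *\<^sub>R z) * ((z \<bullet> b) * kern (s + 1) z))"
        by (rule growth_integrable[OF g2]) (use mcomp[OF cv0] in measurable)
      ultimately have e: "r * (v' b x * A) = 2 * s * (LINT z|lborel. v (x + r *\<^sub>R z) * ((z \<bullet> b) * kern (s + 1) z))"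
        by (simp add: k[symmetric] kavg_def)
      have i3: "integrable lborel (\<lambda>z. \<bar>z \<bullet> b\<bar> * kern (s + 1) z)"
      proof (rule growth_integrable)
        from growth_mult[OF growth_inner[of b] gk(3)]
        show "growth (- 1 - 2 * s) (\<lambda>z. \<bar>z \<bullet> b\<bar> * kern (s + 1) z)"
          unfolding growth_def by (simp add: abs_mult)
      qed (use s a in auto)
      have "\<bar>LINT z|lborel. v (x + r *\<^sub>R z) * ((z \<bullet> b) * kern (s + 1) z)\<bar>
        \<le> (LINT z|lborel. \<bar>v (x + r *\<^sub>R z) * ((z \<bullet> b) * kern (s + 1) z)\<bar>)"
        by (rule integral_abs_bound)
      also have "\<dots> \<le> (LINT z|lborel. S * (\<bar>z \<bullet> b\<bar> * kern (s + 1) z))"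
      proof (rule integral_mono)
        fix z
        show "\<bar>v (x + r *\<^sub>R z) * ((z \<bullet> b) * kern (s + 1) z)\<bar> \<le> S * (\<bar>z \<bullet> b\<bar> * kern (s + 1) z)"
          using bdd[of "x + r *\<^sub>R z"] kern_pos[of "s + 1" z]
          by (auto simp: abs_mult intro!: mult_right_mono)
      qed (use i2 i3 in auto)
      finally have "2 * s * \<bar>LINT z|lborel. v (x + r *\<^sub>R z) * ((z \<bullet> b) * kern (s + 1) z)\<bar>
         \<le> 2 * s * (S * (LINT z|lborel. \<bar>z \<bullet> b\<bar> * kern (s + 1) z))"
        using s1 by (intro mult_left_mono) auto
      moreover have "r * \<bar>v' b x * A\<bar> = 2 * s * \<bar>LINT z|lborel. v (x + r *\<^sub>R z) * ((z \<bullet> b) * kern (s + 1) z)\<bar>"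
        using arg_cong[OF e, of abs] r s1 by (simp add: abs_mult)
      ultimately show ?thesis by (simp add: C_def)
    qed
    have p: "\<bar>v' b x * A\<bar> > 0" using nz A by simp
    obtain n :: nat where n: "C < real n * \<bar>v' b x * A\<bar>" using reals_Archimedean3[OF p] by blast
    have "C < (real n + 1) * \<bar>v' b x * A\<bar>" using n p by (simp add: distrib_right)
    with bound[of "real n + 1"] show False by (simp add: add_pos_nonneg)
  qed
  have "(v has_derivative (\<lambda>h. 0)) (at x within UNIV)" for x
    using v grad unfolding has_partials_def by (auto cong: sum.cong)
  from has_derivative_zero_constant[OF convex_UNIV this] obtain c where "\<And>x. v x = c" by auto
  thus ?thesis by simp
qed

section \<open>The equation for functions of \<open>x\<close> and \<open>|t|\<close>\<close>

lemma sum_Basis_Pair: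
  fixes g :: "'a::euclidean_space \<times> 'b::euclidean_space \<Rightarrow> real"
  shows "sum g Basis = (\<Sum>u\<in>Basis. g (u, 0)) + (\<Sum>e\<in>Basis. g (0, e))"
proof -
  have "inj_on (\<lambda>u. (u::'a, 0::'b)) Basis" "inj_on (\<lambda>u. (0::'a, u::'b)) Basis"
    by (auto intro!: inj_onI)
  thus ?thesis unfolding Basis_prod_def
    by (subst sum.union_disjoint) (auto simp: Basis_prod_def sum.reindex)
qed

text \<open>With \<open>D = exp L\<close> the field is \<open>D powr k \<nabla> D = exp ((k + 1) L) \<nabla> L\<close>, so its divergence is
  \<open>exp ((k + 1) L) (\<Delta> L + (k + 1) |\<nabla> L|\<^sup>2)\<close>. The equation \<open>D = exp L\<close> is only needed near \<open>p\<close>.\<close>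
lemma divergence_exp_form:
  fixes D L :: "'a::euclidean_space \<Rightarrow> real"
  assumes W: "open W" "p \<in> W" and D: "\<And>z. z \<in> W \<Longrightarrow> D z = exp (L z)"
    and d1: "\<And>z. z \<in> W \<Longrightarrow> (L has_derivative L' z) (at z)"
    and d2: "\<And>b. b \<in> Basis \<Longrightarrow> ((\<lambda>z. L' z b) has_derivative L'' b) (at p)"
  shows "divergence (\<lambda>z. D z powr k *\<^sub>R gradient D z) p
    = exp ((k + 1) * L p) * ((\<Sum>b\<in>Basis. L'' b b) + (k + 1) * (\<Sum>b\<in>Basis. (L' p b)\<^sup>2))"
proof -
  have dD: "(D has_derivative (\<lambda>h. exp (L z) * L' z h)) (at z)" if z: "z \<in> W" for z
  proof (rule has_derivative_transform_within_open[OF _ W(1) z])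
    show "((\<lambda>z. exp (L z)) has_derivative (\<lambda>h. exp (L z) * L' z h)) (at z)"
      using d1[OF z] by (auto intro!: derivative_eq_intros)
  qed (use D in auto)
  have V: "(D z powr k *\<^sub>R gradient D z) \<bullet> b = exp ((k + 1) * L z) * L' z b"
    if z: "z \<in> W" and b: "b \<in> Basis" for z b
  proof -
    have "gradient D z \<bullet> b = partial_deriv b D z"
      unfolding gradient_def using b by (simp add: inner_sum_left inner_Basis if_distrib cong: if_cong)
    also have "\<dots> = exp (L z) * L' z b"
      unfolding partial_deriv_def using frechet_derivative_at[OF dD[OF z]] by metis
    finally have "gradient D z \<bullet> b = exp (L z) * L' z b" .
    moreover have "exp ((k + 1) * L z) = exp (L z * k) * exp (L z)"
      by (simp add: exp_add[symmetric] algebra_simps)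
    ultimately show ?thesis using D[OF z] by (simp add: exp_powr_real)
  qed
  have "partial_deriv b (\<lambda>z. (D z powr k *\<^sub>R gradient D z) \<bullet> b) p
      = exp ((k + 1) * L p) * (L'' b b + (k + 1) * (L' p b)\<^sup>2)" if b: "b \<in> Basis" for b
  proof -
    have "((\<lambda>z. (D z powr k *\<^sub>R gradient D z) \<bullet> b) has_derivative
       (\<lambda>h. exp ((k + 1) * L p) * L'' b h + exp ((k + 1) * L p) * ((k + 1) * L' p h) * L' p b)) (at p)"
    proof (rule has_derivative_transform_within_open[OF _ W])
      show "((\<lambda>z. exp ((k + 1) * L z) * L' z b) has_derivative
        (\<lambda>h. exp ((k + 1) * L p) * L'' b h + exp ((k + 1) * L p) * ((k + 1) * L' p h) * L' p b)) (at p)"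
      proof (rule has_derivative_mult[OF _ d2[OF b]])
        show "((\<lambda>z. exp ((k + 1) * L z)) has_derivative (\<lambda>h. exp ((k + 1) * L p) * ((k + 1) * L' p h))) (at p)"
          using d1[OF W(2)] by (auto intro!: derivative_eq_intros)
      qed
    qed (use V b in auto)
    from frechet_derivative_at[OF this] show ?thesis
      unfolding partial_deriv_def by (simp add: fun_eq_iff algebra_simps power2_eq_square)
  qed
  thus ?thesis by (simp add: divergence_def sum_distrib_left sum.distrib distrib_left)
qed

text \<open>The same for \<open>L (x, t) = \<Phi> (x, |t|)\<close>: the Laplacian in \<open>t\<close> becomes
  \<open>\<Phi>\<^sub>r\<^sub>r + (m - 1) \<Phi>\<^sub>r / r\<close>, where \<open>m\<close> is the dimension of the space of \<open>t\<close>. The function \<open>\<Phi>xx b\<close> is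
  the derivative of \<open>\<Phi>x b\<close>, of which only the value at \<open>(b, 0)\<close> occurs.\<close>
lemma divergence_exp_radial:
  fixes D :: "'a::euclidean_space \<times> 'b::euclidean_space \<Rightarrow> real" and \<Phi> :: "'a \<times> real \<Rightarrow> real"
  assumes D: "\<And>x t. t \<noteq> 0 \<Longrightarrow> D (x, t) = exp (\<Phi> (x, norm t))"
    and d1: "\<And>\<xi>. snd \<xi> > 0 \<Longrightarrow> (\<Phi> has_derivative (\<lambda>h. (\<Sum>b\<in>Basis. (fst h \<bullet> b) * \<Phi>x b \<xi>) + snd h * \<Phi>r \<xi>)) (at \<xi>)"
    and d2: "\<And>b. b \<in> Basis \<Longrightarrow> (\<Phi>x b has_derivative \<Phi>xx b) (at (x, norm t))"
    and d3: "(\<Phi>r has_derivative \<Phi>rr) (at (x, norm t))"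
    and t: "t \<noteq> 0"
  shows "divergence (\<lambda>z. D z powr k *\<^sub>R gradient D z) (x, t)
    = exp ((k + 1) * \<Phi> (x, norm t)) * ((\<Sum>b\<in>Basis. \<Phi>xx b (b, 0)) + \<Phi>rr (0, 1)
        + (real DIM('b) - 1) / norm t * \<Phi>r (x, norm t)
        + (k + 1) * ((\<Sum>b\<in>Basis. (\<Phi>x b (x, norm t))\<^sup>2) + (\<Phi>r (x, norm t))\<^sup>2))"
proof -
  define N where "N z = (fst z, norm (snd z))" for z :: "'a \<times> 'b"
  define W where "W = {z :: 'a \<times> 'b. snd z \<noteq> 0}"
  have W: "open W" unfolding W_def by (intro open_Collect_neq continuous_intros)
  have nn: "((\<lambda>z :: 'a \<times> 'b. norm (snd z)) has_derivative (\<lambda>h. (snd h \<bullet> snd z) / norm (snd z))) (at z)"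
    if "z \<in> W" for z
  proof -
    have "snd z \<noteq> 0" using that by (simp add: W_def)
    from has_derivative_compose[OF has_derivative_snd[OF has_derivative_ident] has_derivative_norm[OF this]]
    show ?thesis by (simp add: sgn_div_norm divide_inverse mult.commute)
  qed
  have dN: "(N has_derivative (\<lambda>h. (fst h, (snd h \<bullet> snd z) / norm (snd z)))) (at z)" if "z \<in> W" for z
    unfolding N_def by (intro has_derivative_Pair has_derivative_fst has_derivative_ident nn that)
  define L' where "L' z h = (\<Sum>b\<in>Basis. (fst h \<bullet> b) * \<Phi>x b (N z)) + (snd h \<bullet> snd z) / norm (snd z) * \<Phi>r (N z)"
    for z h :: "'a \<times> 'b"
  define r where "r = norm t"
  have r: "r > 0" using t by (simp add: r_def)
  have p: "(x, t) \<in> W" using t by (simp add: W_def)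
  have Np: "N (x, t) = (x, r)" by (simp add: N_def r_def)
  have l1: "((\<lambda>z. \<Phi> (N z)) has_derivative L' z) (at z)" if z: "z \<in> W" for z
  proof -
    have "snd (N z) > 0" using z by (simp add: N_def W_def)
    from has_derivative_compose[OF dN[OF z] d1[OF this]] show ?thesis
      unfolding L'_def by simp
  qed
  \<comment> \<open>Basis vectors of the product space have the form \<open>(u, 0)\<close> or \<open>(0, e)\<close>; the test
    \<open>snd b = 0\<close> distinguishes them.\<close>
  define L'' where "L'' b h = (if snd b = 0
      then \<Phi>xx (fst b) (fst h, (snd h \<bullet> t) / r)
      else (snd b \<bullet> t) / r * \<Phi>rr (fst h, (snd h \<bullet> t) / r)
         + ((snd b \<bullet> snd h) / r - (snd b \<bullet> t) * (snd h \<bullet> t) / r ^ 3) * \<Phi>r (x, r))" for b h :: "'a \<times> 'b"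
  have dNp: "(N has_derivative (\<lambda>h. (fst h, (snd h \<bullet> t) / r))) (at (x, t))"
    using dN[OF p] by (simp add: r_def)
  have l2: "((\<lambda>z. L' z b) has_derivative L'' b) (at (x, t))" if b: "b \<in> Basis" for b
  proof -
    from b consider u where "u \<in> Basis" "b = (u, 0)" | e where "e \<in> Basis" "b = (0, e)"
      by (auto simp: Basis_prod_def)
    thus ?thesis
    proof cases
      case 1
      have "L' z b = \<Phi>x u (N z)" for z
        using 1 by (simp add: L'_def inner_Basis if_distrib if_distribR cong: if_cong)
      moreover have "(\<Phi>x u has_derivative \<Phi>xx u) (at (N (x, t)))" using d2[OF 1(1)] by (simp add: N_def)
      from has_derivative_compose[OF dNp this]
      have "((\<lambda>z. \<Phi>x u (N z)) has_derivative L'' b) (at (x, t))"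
        using 1 by (simp add: L''_def[abs_def])
      ultimately show ?thesis by simp
    next
      case 2
      have e: "L' z b = (e \<bullet> snd z) / norm (snd z) * \<Phi>r (N z)" for z
        using 2 by (simp add: L'_def)
      have "(\<Phi>r has_derivative \<Phi>rr) (at (N (x, t)))" using d3 by (simp add: N_def)
      note c = has_derivative_compose[OF dNp this]
      have q: "((\<lambda>z :: 'a \<times> 'b. (e \<bullet> snd z) / norm (snd z)) has_derivative
         (\<lambda>h. (e \<bullet> snd h) / r - (e \<bullet> t) * (snd h \<bullet> t) / r ^ 3)) (at (x, t))"
      proof -
        have "((\<lambda>z :: 'a \<times> 'b. e \<bullet> snd z) has_derivative (\<lambda>h. e \<bullet> snd h)) (at (x, t))"
          by (auto intro!: derivative_eq_intros)
        from has_derivative_divide'[OF this nn[OF p]] show ?thesis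
          using t r by (simp add: r_def[symmetric]) (simp add: field_simps power3_eq_cube)
      qed
      have "e \<noteq> 0" using 2 by auto
      thus ?thesis unfolding e
        using has_derivative_mult[OF q c] 2 t by (simp add: L''_def[abs_def] Np r_def[symmetric])
    qed
  qed
  have lin: "\<Phi>rr (0, c) = c * \<Phi>rr (0, 1)" for c
    using linear_cmul[OF has_derivative_linear[OF d3], of c "(0, 1)"] by simp
  have "divergence (\<lambda>z. D z powr k *\<^sub>R gradient D z) (x, t)
    = exp ((k + 1) * \<Phi> (N (x, t))) * ((\<Sum>b\<in>Basis. L'' b b) + (k + 1) * (\<Sum>b\<in>Basis. (L' (x, t) b)\<^sup>2))"
    by (rule divergence_exp_form[OF W p _ l1 l2]) (auto simp: W_def N_def D)
  moreover have "(\<Sum>b\<in>Basis. L'' b b) = (\<Sum>b\<in>Basis. \<Phi>xx b (b, 0)) + (\<Phi>rr (0, 1) + (real DIM('b) - 1) / r * \<Phi>r (x, r))"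
  proof -
    have sq: "(\<Sum>e\<in>Basis. (e \<bullet> t) * (e \<bullet> t)) = r\<^sup>2"
      unfolding r_def power2_norm_eq_inner using euclidean_inner[of t t] by (simp add: inner_commute)
    have "(\<Sum>e\<in>Basis. L'' (0, e) (0, e)) = (\<Sum>e\<in>Basis. (e \<bullet> t) * (e \<bullet> t) * (\<Phi>rr (0, 1) / r\<^sup>2 - \<Phi>r (x, r) / r ^ 3) + \<Phi>r (x, r) / r)"
    proof (rule sum.cong[OF refl])
      fix e :: 'b assume e: "e \<in> Basis"
      hence "e \<noteq> 0" by auto
      thus "L'' (0, e) (0, e) = (e \<bullet> t) * (e \<bullet> t) * (\<Phi>rr (0, 1) / r\<^sup>2 - \<Phi>r (x, r) / r ^ 3) + \<Phi>r (x, r) / r"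
        using e lin[of "(e \<bullet> t) / r"] by (simp add: L''_def inner_Basis algebra_simps power2_eq_square)
    qed
    also have "\<dots> = r\<^sup>2 * (\<Phi>rr (0, 1) / r\<^sup>2 - \<Phi>r (x, r) / r ^ 3) + real DIM('b) * (\<Phi>r (x, r) / r)"
      by (simp add: sum.distrib sum_distrib_right[symmetric] sq)
    also have "\<dots> = \<Phi>rr (0, 1) + (real DIM('b) - 1) / r * \<Phi>r (x, r)"
      using r by (simp add: field_simps power2_eq_square power3_eq_cube)
    finally show ?thesis by (simp add: sum_Basis_Pair L''_def)
  qed
  moreover have "(\<Sum>b\<in>Basis. (L' (x, t) b)\<^sup>2) = (\<Sum>b\<in>Basis. (\<Phi>x b (x, r))\<^sup>2) + (\<Phi>r (x, r))\<^sup>2"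
  proof -
    have sq: "(\<Sum>e\<in>Basis. (e \<bullet> t)\<^sup>2) = r\<^sup>2"
      unfolding r_def power2_norm_eq_inner using euclidean_inner[of t t] by (simp add: inner_commute power2_eq_square)
    have 1: "(L' (x, t) (u, 0))\<^sup>2 = (\<Phi>x u (x, r))\<^sup>2" if "u \<in> Basis" for u
      using that by (simp add: L'_def Np inner_Basis if_distrib if_distribR cong: if_cong)
    have "(L' (x, t) (0, e))\<^sup>2 = (e \<bullet> t)\<^sup>2 * ((\<Phi>r (x, r))\<^sup>2 / r\<^sup>2)" for e
      by (simp add: L'_def Np r_def[symmetric] power_mult_distrib power_divide)
    hence "(\<Sum>e\<in>Basis. (L' (x, t) (0, e))\<^sup>2) = (\<Sum>e\<in>Basis. (e \<bullet> t)\<^sup>2) * ((\<Phi>r (x, r))\<^sup>2 / r\<^sup>2)"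
      unfolding sum_distrib_right by simp
    hence "(\<Sum>e\<in>Basis. (L' (x, t) (0, e))\<^sup>2) = (\<Phi>r (x, r))\<^sup>2"
      using r by (simp add: sq)
    thus ?thesis using 1 by (simp add: sum_Basis_Pair)
  qed
  ultimately show ?thesis by (simp add: Np r_def add.assoc)
qed

text \<open>The equation \<open>L D = 0\<close> at the point \<open>(x, t)\<close>, rewritten as a differential equation for
  \<open>G\<close> at \<open>(x, |t|)\<close>. Here \<open>ln D = const + ln r - (ln G)/\<alpha>\<close>.\<close>
lemma divergence_log_equation:
  fixes D :: "'a::euclidean_space \<times> 'b::euclidean_space \<Rightarrow> real" and G :: "'a \<times> real \<Rightarrow> real"
  assumes D: "\<And>x t. t \<noteq> 0 \<Longrightarrow> D (x, t) = (\<kappa> * norm t powr (- \<alpha>) * G (x, norm t)) powr (- 1 / \<alpha>)"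
    and \<kappa>: "\<kappa> > 0" and \<alpha>: "\<alpha> > 0" and G0: "\<And>\<xi>. G \<xi> > 0"
    and d1: "\<And>\<xi>. (G has_derivative (\<lambda>h. (\<Sum>b\<in>Basis. (fst h \<bullet> b) * Gx b \<xi>) + snd h * Gr \<xi>)) (at \<xi>)"
    and d2: "\<And>b \<xi>. b \<in> Basis \<Longrightarrow> (Gx b has_derivative Gxx b \<xi>) (at \<xi>)"
    and d3: "\<And>\<xi>. (Gr has_derivative Grr \<xi>) (at \<xi>)"
    and eq: "divergence (\<lambda>z. D z powr (1 - real DIM('b)) *\<^sub>R gradient D z) (x, t) = 0"
    and t: "t \<noteq> 0"
  shows "G (x, norm t) * ((\<Sum>b\<in>Basis. Gxx b (x, norm t) (b, 0)) + Grr (x, norm t) (0, 1))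
     - (real DIM('b) - 3) * G (x, norm t) * (Gr (x, norm t) / norm t)
     + ((real DIM('b) - 2) / \<alpha> - 1) * ((\<Sum>b\<in>Basis. (Gx b (x, norm t))\<^sup>2) + (Gr (x, norm t))\<^sup>2) = 0"
proof -
  define m where "m = real DIM('b)"
  define r where "r = norm t"
  have r: "r > 0" using t by (simp add: r_def)
  define \<Phi> where "\<Phi> \<xi> = - (ln \<kappa> / \<alpha>) + ln (snd \<xi>) - ln (G \<xi>) / \<alpha>" for \<xi> :: "'a \<times> real"
  define \<Phi>x where "\<Phi>x b \<xi> = - (Gx b \<xi> / G \<xi>) / \<alpha>" for b \<xi>
  define \<Phi>r where "\<Phi>r \<xi> = 1 / snd \<xi> - (Gr \<xi> / G \<xi>) / \<alpha>" for \<xi>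
  define \<Phi>xx where "\<Phi>xx b h = - ((Gxx b (x, r) h * G (x, r) - Gx b (x, r) * ((\<Sum>b\<in>Basis. (fst h \<bullet> b) * Gx b (x, r)) + snd h * Gr (x, r))) / (G (x, r) * G (x, r))) / \<alpha>" for b h
  define \<Phi>rr where "\<Phi>rr h = - snd h / r\<^sup>2 - ((Grr (x, r) h * G (x, r) - Gr (x, r) * ((\<Sum>b\<in>Basis. (fst h \<bullet> b) * Gx b (x, r)) + snd h * Gr (x, r))) / (G (x, r) * G (x, r))) / \<alpha>" for h
  have Gn: "G \<xi> \<noteq> 0" for \<xi> using G0[of \<xi>] by simp
  have DL: "D (x, t) = exp (\<Phi> (x, norm t))" if "t \<noteq> 0" for x t
  proof -
    have n: "norm t > 0" using that by simp
    have pw: "X powr a = exp (a * ln X)" if "X > 0" for X a :: real using that by (simp add: powr_def)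
    have l: "ln (\<kappa> * norm t powr (- \<alpha>) * G (x, norm t)) = ln \<kappa> - \<alpha> * ln (norm t) + ln (G (x, norm t))"
      using n \<kappa> G0[of "(x, norm t)"] by (simp add: ln_mult ln_powr)
    have "\<kappa> * norm t powr (- \<alpha>) * G (x, norm t) > 0" using n \<kappa> G0[of "(x, norm t)"] by simp
    hence "D (x, t) = exp (- 1 / \<alpha> * (ln \<kappa> - \<alpha> * ln (norm t) + ln (G (x, norm t))))"
      unfolding D[OF that] l[symmetric] by (rule pw)
    also have "- 1 / \<alpha> * (ln \<kappa> - \<alpha> * ln (norm t) + ln (G (x, norm t))) = \<Phi> (x, norm t)"
      using \<alpha> by (simp add: \<Phi>_def field_simps)
    finally show ?thesis .
  qed
  have e1: "(\<Phi> has_derivative (\<lambda>h. (\<Sum>b\<in>Basis. (fst h \<bullet> b) * \<Phi>x b \<xi>) + snd h * \<Phi>r \<xi>)) (at \<xi>)"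
    if "snd \<xi> > 0" for \<xi>
  proof -
    let ?G' = "\<lambda>h. (\<Sum>b\<in>Basis. (fst h \<bullet> b) * Gx b \<xi>) + snd h * Gr \<xi>"
    have "(\<Phi> has_derivative (\<lambda>h. snd h / snd \<xi> - ?G' h / G \<xi> / \<alpha>)) (at \<xi>)"
      unfolding \<Phi>_def using that G0[of \<xi>] \<alpha>
      by (auto intro!: derivative_eq_intros d1 simp: divide_inverse)
    moreover have "(\<Sum>b\<in>Basis. (fst h \<bullet> b) * \<Phi>x b \<xi>) = - (\<Sum>b\<in>Basis. (fst h \<bullet> b) * Gx b \<xi>) / G \<xi> / \<alpha>" for h :: "'a \<times> real"
      unfolding \<Phi>x_def by (simp add: sum_divide_distrib sum_negf)
    hence "snd h / snd \<xi> - ?G' h / G \<xi> / \<alpha> = (\<Sum>b\<in>Basis. (fst h \<bullet> b) * \<Phi>x b \<xi>) + snd h * \<Phi>r \<xi>" for h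
      by (simp add: \<Phi>r_def diff_divide_distrib add_divide_distrib right_diff_distrib)
    ultimately show ?thesis by simp
  qed
  note dv = bounded_linear.has_derivative[OF bounded_linear_divide[of \<alpha>]]
  have e2: "(\<Phi>x b has_derivative \<Phi>xx b) (at (x, norm t))" if b: "b \<in> Basis" for b
    unfolding \<Phi>x_def \<Phi>xx_def r_def[symmetric]
    by (rule dv[OF has_derivative_minus[OF has_derivative_divide'[OF d2[OF b] d1 Gn]]])
  have e3: "(\<Phi>r has_derivative \<Phi>rr) (at (x, norm t))"
  proof -
    have "((\<lambda>\<xi>::'a\<times>real. 1 / snd \<xi>) has_derivative (\<lambda>h. - snd h / r\<^sup>2)) (at (x, r))"
      using r by (auto intro!: derivative_eq_intros simp: power2_eq_square divide_inverse)
    from has_derivative_diff[OF this dv[OF has_derivative_divide'[OF d3 d1 Gn]]]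
    show ?thesis unfolding \<Phi>r_def \<Phi>rr_def r_def[symmetric] .
  qed
  define S where "S = (\<Sum>b\<in>Basis. Gxx b (x, r) (b, 0))"
  define T where "T = (\<Sum>b\<in>Basis. (Gx b (x, r))\<^sup>2)"
  define g where "g = G (x, r)"
  define gr where "gr = Gr (x, r)"
  define grr where "grr = Grr (x, r) (0, 1)"
  have g: "g > 0" using G0 by (simp add: g_def)
  have s1: "(\<Sum>b\<in>Basis. \<Phi>xx b (b, 0)) = - (S * g - T) / (g * g) / \<alpha>"
  proof -
    have "(\<Sum>b\<in>Basis. \<Phi>xx b (b, 0)) = (\<Sum>b\<in>Basis. - ((Gxx b (x, r) (b, 0) * g - (Gx b (x, r))\<^sup>2) / (g * g)) / \<alpha>)"
      unfolding \<Phi>xx_def g_def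
      by (intro sum.cong refl) (simp add: inner_Basis if_distrib if_distribR power2_eq_square cong: if_cong)
    also have "\<dots> = - (\<Sum>b\<in>Basis. (Gxx b (x, r) (b, 0) * g - (Gx b (x, r))\<^sup>2)) / (g * g) / \<alpha>"
    proof -
      have "(\<Sum>b\<in>(Basis::'a set). - (X b / (g * g)) / \<alpha>) = - (\<Sum>b\<in>Basis. X b) / (g * g) / \<alpha>" for X
        by (simp add: sum_negf sum_divide_distrib)
      thus ?thesis .
    qed
    also have "(\<Sum>b\<in>Basis. (Gxx b (x, r) (b, 0) * g - (Gx b (x, r))\<^sup>2)) = S * g - T"
      by (simp add: S_def T_def sum_subtractf sum_distrib_right)
    finally show ?thesis .
  qed
  have s2: "\<Phi>rr (0, 1) = - 1 / r\<^sup>2 - (grr * g - gr\<^sup>2) / (g * g) / \<alpha>"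
    by (simp add: \<Phi>rr_def g_def gr_def grr_def power2_eq_square)
  have s3: "(\<Sum>b\<in>Basis. (\<Phi>x b (x, r))\<^sup>2) = T / (g\<^sup>2 * \<alpha>\<^sup>2)"
    by (simp add: \<Phi>x_def T_def g_def power_divide sum_divide_distrib power_mult_distrib)
  have s4: "\<Phi>r (x, r) = 1 / r - gr / g / \<alpha>" by (simp add: \<Phi>r_def g_def gr_def)
  have k: "1 - real DIM('b) + 1 = 2 - m" by (simp add: m_def)
  have "- (S * g - T) / (g * g) / \<alpha> + (- 1 / r\<^sup>2 - (grr * g - gr\<^sup>2) / (g * g) / \<alpha>)
        + (m - 1) / r * (1 / r - gr / g / \<alpha>)
        + (2 - m) * (T / (g\<^sup>2 * \<alpha>\<^sup>2) + (1 / r - gr / g / \<alpha>)\<^sup>2) = 0" (is "?X = 0")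
    using divergence_exp_radial[where D = D and \<Phi> = \<Phi> and x = x and t = t and k = "1 - real DIM('b)", OF DL e1 e2 e3 t] eq
    unfolding k r_def[symmetric] s1 s2 s3 s4 by (simp add: m_def)
  hence "- \<alpha> * g\<^sup>2 * ?X = 0" by simp
  moreover have "- \<alpha> * g\<^sup>2 * ?X = g * (S + grr) - (m - 3) * g * (gr / r) + ((m - 2) / \<alpha> - 1) * (T + gr\<^sup>2)"
    using g r \<alpha> by (simp add: field_simps) algebra
  ultimately have "g * (S + grr) - (m - 3) * g * (gr / r) + ((m - 2) / \<alpha> - 1) * (T + gr\<^sup>2) = 0"
    by (simp only:)
  thus ?thesis unfolding S_def T_def g_def gr_def grr_def m_def r_def .
qed

section \<open>The equation on the boundary\<close>

lemma kavg_at_zero: "kavg \<phi> p (x, 0) = \<phi> x * (LINT z|lborel. p z)"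
  by (simp add: kavg_def)

text \<open>The limit of \<open>divergence_log_equation\<close> at the boundary point \<open>(x, 0)\<close>.\<close>
lemma boundary_equation:
  fixes f :: "'a::euclidean_space \<Rightarrow> real" and D :: "'a \<times> 'b::euclidean_space \<Rightarrow> real"
  assumes \<alpha>: "\<alpha> > 2 + \<epsilon>" and \<epsilon>: "\<epsilon> \<ge> 0" and \<kappa>: "\<kappa> > 0" and s: "2 * s = real DIM('a) + \<alpha>"
    and D: "\<And>x t. t \<noteq> 0 \<Longrightarrow> D (x, t) = (\<kappa> * norm t powr (- \<alpha>) * kavg f (kern s) (x, norm t)) powr (- 1 / \<alpha>)"
    and pos: "\<And>\<xi>. kavg f (kern s) \<xi> > 0"
    and f: "has_partials f f'"
    and f': "\<And>b. b \<in> Basis \<Longrightarrow> has_partials (f' b) (f'' b)"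
    and cont: "\<And>b c. b \<in> Basis \<Longrightarrow> c \<in> Basis \<Longrightarrow> continuous_on UNIV (f'' b c)"
    and gr: "\<And>b c. b \<in> Basis \<Longrightarrow> c \<in> Basis \<Longrightarrow> growth \<epsilon> (f'' b c)"
    and eq: "\<And>x t. t \<noteq> 0 \<Longrightarrow> divergence (\<lambda>z. D z powr (1 - real DIM('b)) *\<^sub>R gradient D z) (x, t) = 0"
  shows "f x * (\<Sum>b\<in>Basis. f'' b b x) * (1 - (real DIM('b) - 4) / (\<alpha> - 2))
     + ((real DIM('b) - 2) / \<alpha> - 1) * (\<Sum>b\<in>Basis. (f' b x)\<^sup>2) = 0"
proof -
  have s0: "s \<ge> 0" using s \<alpha> \<epsilon> by simp
  have gf': "growth (\<epsilon> + 1) (f' b)" if "b \<in> Basis" for b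
    using growth_antiderivative[OF f'[OF that] gr[OF that] \<epsilon>] .
  note cv1 = has_partials_continuous_on[OF f']
  let ?w = "kern s :: 'a \<Rightarrow> real"
  have gk: "growth (- 2 * s) ?w" using s0 by (rule growth_kern)
  have gk1: "growth (1 - 2 * s) (\<lambda>z. (z \<bullet> b) * ?w z)" for b
    using growth_mult[OF growth_inner gk] by simp
  have gk2: "growth (2 - 2 * s) (\<lambda>z. (z \<bullet> c) * ((z \<bullet> b) * ?w z))" for b c
    by (rule growth_eq[OF growth_mult[OF growth_inner gk1]]) simp
  have mk2: "(\<lambda>z. (z \<bullet> c) * ((z \<bullet> b) * ?w z)) \<in> borel_measurable borel" for b c by measurable
  define G where "G = kavg f ?w"
  define Gx where "Gx b = kavg (f' b) ?w" for b
  define Gr where "Gr \<xi> = (\<Sum>b\<in>Basis. kavg (f' b) (\<lambda>z. (z \<bullet> b) * ?w z) \<xi>)" for \<xi>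
  define Gxx where "Gxx b \<xi> h = (\<Sum>c\<in>Basis. (fst h \<bullet> c) * kavg (f'' b c) ?w \<xi>)
      + snd h * (\<Sum>c\<in>Basis. kavg (f'' b c) (\<lambda>z. (z \<bullet> c) * ?w z) \<xi>)" for b \<xi> and h :: "'a \<times> real"
  define Grr where "Grr \<xi> h = (\<Sum>b\<in>Basis. (\<Sum>c\<in>Basis. (fst h \<bullet> c) * kavg (f'' b c) (\<lambda>z. (z \<bullet> b) * ?w z) \<xi>)
      + snd h * (\<Sum>c\<in>Basis. kavg (f'' b c) (\<lambda>z. (z \<bullet> c) * ((z \<bullet> b) * ?w z)) \<xi>))" for \<xi> and h :: "'a \<times> real"
  have d1: "(G has_derivative (\<lambda>h. (\<Sum>b\<in>Basis. (fst h \<bullet> b) * Gx b \<xi>) + snd h * Gr \<xi>)) (at \<xi>)" for \<xi>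
    unfolding G_def Gx_def Gr_def
    by (rule has_derivative_kavg[OF f cv1 gf' _ gk]) (use \<epsilon> s \<alpha> in auto)
  have d2: "(Gx b has_derivative Gxx b \<xi>) (at \<xi>)" if b: "b \<in> Basis" for b \<xi>
    unfolding Gx_def Gxx_def
    by (rule has_derivative_kavg[OF f'[OF b] cont[OF b] gr[OF b] _ gk]) (use \<epsilon> s \<alpha> in auto)
  have d3: "(Gr has_derivative Grr \<xi>) (at \<xi>)" for \<xi>
    unfolding Gr_def Grr_def
  proof (rule has_derivative_sum)
    fix b :: 'a assume b: "b \<in> Basis"
    show "(kavg (f' b) (\<lambda>z. (z \<bullet> b) * ?w z) has_derivative
      (\<lambda>h. (\<Sum>c\<in>Basis. (fst h \<bullet> c) * kavg (f'' b c) (\<lambda>z. (z \<bullet> b) * ?w z) \<xi>)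
      + snd h * (\<Sum>c\<in>Basis. kavg (f'' b c) (\<lambda>z. (z \<bullet> c) * ((z \<bullet> b) * ?w z)) \<xi>))) (at \<xi>)"
      by (rule has_derivative_kavg[OF f'[OF b] cont[OF b] gr[OF b] _ gk1]) (use \<epsilon> s \<alpha> in auto)
  qed
  define A where "A = (LINT z|lborel. ?w z)"
  have A: "A > 0" unfolding A_def using s \<alpha> \<epsilon> by (intro integral_kern_pos) simp
  define \<Delta> where "\<Delta> = (\<Sum>b\<in>Basis. f'' b b x)"
  have m1: "(LINT z|lborel. (z \<bullet> b) * ?w z) = 0" if "b \<in> Basis" for b
    using that s \<alpha> \<epsilon> by (intro integral_first_moment_kern) auto
  have m2: "(LINT z|lborel. (z \<bullet> c) * ((z \<bullet> b) * ?w z)) = (c \<bullet> b) * (A / (\<alpha> - 2))" if "b \<in> Basis" "c \<in> Basis" for b c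
    using integral_second_moment_kern[of c b s] that s \<alpha> \<epsilon> by (simp add: A_def mult.assoc)
  have G0: "G (x, 0) = f x * A" by (simp add: G_def kavg_at_zero A_def)
  have Gx0: "Gx b (x, 0) = f' b x * A" for b by (simp add: Gx_def kavg_at_zero A_def)
  have Gr0: "Gr (x, 0) = 0" by (simp add: Gr_def kavg_at_zero m1)
  have Gxx_b: "Gxx b \<xi> (b, 0) = kavg (f'' b b) ?w \<xi>" if "b \<in> Basis" for b \<xi>
    using that by (simp add: Gxx_def inner_Basis if_distrib if_distribR cong: if_cong)
  have Grr_1: "Grr \<xi> (0, 1) = (\<Sum>b\<in>Basis. \<Sum>c\<in>Basis. kavg (f'' b c) (\<lambda>z. (z \<bullet> c) * ((z \<bullet> b) * ?w z)) \<xi>)" for \<xi>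
    by (simp add: Grr_def)
  have Grr0: "Grr (x, 0) (0, 1) = \<Delta> * (A / (\<alpha> - 2))"
  proof -
    have "Grr (x, 0) (0, 1) = (\<Sum>b\<in>Basis. \<Sum>c\<in>Basis. f'' b c x * ((c \<bullet> b) * (A / (\<alpha> - 2))))"
      unfolding Grr_1 kavg_at_zero by (intro sum.cong refl) (simp add: m2)
    also have "\<dots> = (\<Sum>b\<in>Basis. f'' b b x * (A / (\<alpha> - 2)))"
      by (intro sum.cong refl) (simp add: inner_Basis if_distrib if_distribR cong: if_cong)
    finally show ?thesis unfolding \<Delta>_def sum_distrib_right .
  qed
  have line: "((\<lambda>r. \<phi> (x, r)) \<longlongrightarrow> \<phi> (x, 0)) (at_right 0)" if "isCont \<phi> (x, 0)" for \<phi> :: "'a \<times> real \<Rightarrow> real"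
  proof -
    have "((\<lambda>r. (x, r)) \<longlongrightarrow> (x, 0)) (at_right (0::real))" by (intro tendsto_intros)
    thus ?thesis using isCont_tendsto_compose[OF that] by blast
  qed
  have l1: "((\<lambda>r. G (x, r)) \<longlongrightarrow> f x * A) (at_right 0)"
    using line[OF has_derivative_continuous[OF d1]] by (simp add: G0)
  have l2: "((\<lambda>r. Gx b (x, r)) \<longlongrightarrow> f' b x * A) (at_right 0)" if "b \<in> Basis" for b
    using line[OF has_derivative_continuous[OF d2[OF that]]] by (simp add: Gx0)
  have l3: "((\<lambda>r. Gr (x, r)) \<longlongrightarrow> 0) (at_right 0)"
    using line[OF has_derivative_continuous[OF d3]] by (simp add: Gr0)
  have l4: "((\<lambda>r. \<Sum>b\<in>Basis. Gxx b (x, r) (b, 0)) \<longlongrightarrow> (\<Sum>b\<in>Basis. f'' b b x * A)) (at_right 0)"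
  proof (rule tendsto_sum)
    fix b :: 'a assume b: "b \<in> Basis"
    have "isCont (kavg (f'' b b) ?w) (x, 0)"
      by (rule isCont_kavg[OF cont[OF b b] gr[OF b b] \<epsilon> gk]) (use s \<alpha> in auto)
    from line[OF this] show "((\<lambda>r. Gxx b (x, r) (b, 0)) \<longlongrightarrow> f'' b b x * A) (at_right 0)"
      by (simp add: Gxx_b[OF b] kavg_at_zero A_def)
  qed
  have l5: "((\<lambda>r. Grr (x, r) (0, 1)) \<longlongrightarrow> \<Delta> * (A / (\<alpha> - 2))) (at_right 0)"
  proof -
    have "((\<lambda>r. \<Sum>b\<in>Basis. \<Sum>c\<in>Basis. kavg (f'' b c) (\<lambda>z. (z \<bullet> c) * ((z \<bullet> b) * ?w z)) (x, r))
       \<longlongrightarrow> (\<Sum>b\<in>Basis. \<Sum>c\<in>Basis. kavg (f'' b c) (\<lambda>z. (z \<bullet> c) * ((z \<bullet> b) * ?w z)) (x, 0))) (at_right 0)"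
    proof (intro tendsto_sum line)
      fix b c :: 'a assume b: "b \<in> Basis" and c: "c \<in> Basis"
      show "isCont (kavg (f'' b c) (\<lambda>z. (z \<bullet> c) * ((z \<bullet> b) * ?w z))) (x, 0)"
        by (rule isCont_kavg[OF cont[OF b c] gr[OF b c] \<epsilon> gk2 mk2]) (use s \<alpha> in auto)
    qed
    thus ?thesis unfolding Grr_1[symmetric] Grr0 .
  qed
  \<comment> \<open>\<open>Gr\<close> vanishes at \<open>(x, 0)\<close> because the first moments of the kernel do, so \<open>Gr / r\<close> is a
    difference quotient and has the same limit as \<open>Grr\<close>.\<close>
  have l6: "((\<lambda>r. Gr (x, r) / r) \<longlongrightarrow> \<Delta> * (A / (\<alpha> - 2))) (at_right 0)"
  proof -
    have "((\<lambda>r. Gr ((x, 0) + r *\<^sub>R (0, 1))) has_real_derivative Grr (x, 0) (0, 1)) (at 0)"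
      by (rule has_derivative_directional[OF d3])
    hence "((\<lambda>r. Gr (x, r)) has_real_derivative Grr (x, 0) (0, 1)) (at 0)" by simp
    hence "((\<lambda>r. Gr (x, r) / r) \<longlongrightarrow> Grr (x, 0) (0, 1)) (at 0)"
      by (simp add: has_field_derivative_iff Gr0)
    thus ?thesis unfolding Grr0 by (rule filterlim_mono) (simp_all add: at_le)
  qed
  define m where "m = real DIM('b)"
  let ?lhs = "\<lambda>r. G (x, r) * ((\<Sum>b\<in>Basis. Gxx b (x, r) (b, 0)) + Grr (x, r) (0, 1))
     - (m - 3) * G (x, r) * (Gr (x, r) / r)
     + ((m - 2) / \<alpha> - 1) * ((\<Sum>b\<in>Basis. (Gx b (x, r))\<^sup>2) + (Gr (x, r))\<^sup>2)"
  let ?lim = "(f x * A) * ((\<Sum>b\<in>Basis. f'' b b x * A) + \<Delta> * (A / (\<alpha> - 2)))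
     - (m - 3) * (f x * A) * (\<Delta> * (A / (\<alpha> - 2)))
     + ((m - 2) / \<alpha> - 1) * ((\<Sum>b\<in>Basis. (f' b x * A)\<^sup>2) + 0\<^sup>2)"
  have "(?lhs \<longlongrightarrow> ?lim) (at_right 0)"
    by (intro tendsto_add tendsto_diff tendsto_mult tendsto_const tendsto_sum tendsto_power l1 l2 l3 l4 l5 l6)
  moreover have "\<forall>\<^sub>F r in at_right 0. ?lhs r = 0"
  proof (rule eventually_at_right_less[THEN eventually_mono])
    fix r :: real assume r: "0 < r"
    obtain e :: 'b where e: "e \<in> Basis" using nonempty_Basis by blast
    have n: "norm (r *\<^sub>R e) = r" and nz: "r *\<^sub>R e \<noteq> 0" using e r by auto
    show "?lhs r = 0"
      using divergence_log_equation[where D = D and G = G and x = x and t = "r *\<^sub>R e" and Gx = Gx and Gr = Gr and Gxx = Gxx and Grr = Grr,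
          OF D[folded G_def] \<kappa> _ pos[folded G_def] d1 d2 d3 eq[OF nz] nz] \<alpha> \<epsilon>
      unfolding n m_def by simp
  qed
  ultimately have l: "((\<lambda>r::real. 0) \<longlongrightarrow> ?lim) (at_right (0::real))"
    by (rule Lim_transform_eventually)
  have "?lim = 0"
    by (rule tendsto_unique[OF trivial_limit_at_right_real l tendsto_const])
  also have "?lim = A\<^sup>2 * (f x * \<Delta> * (1 - (m - 4) / (\<alpha> - 2)) + ((m - 2) / \<alpha> - 1) * (\<Sum>b\<in>Basis. (f' b x)\<^sup>2))"
  proof -
    have "(\<Sum>b\<in>Basis. f'' b b x * A) = \<Delta> * A" by (simp add: \<Delta>_def sum_distrib_right)
    moreover have "(\<Sum>b\<in>Basis. (f' b x * A)\<^sup>2) = A\<^sup>2 * (\<Sum>b\<in>Basis. (f' b x)\<^sup>2)"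
      by (simp add: sum_distrib_left power_mult_distrib mult.commute)
    moreover have "\<alpha> - 2 \<noteq> 0" using \<alpha> \<epsilon> by simp
    ultimately show ?thesis
      by (simp add: divide_inverse) (simp add: algebra_simps power2_eq_square)
  qed
  finally show ?thesis using A by (simp add: m_def \<Delta>_def)
qed

section \<open>Hausdorff measure on a plane\<close>

lemma ediam_translate: "ediam ((+) a ` A) = ediam (A :: 'a::real_normed_vector set)"
  by (simp add: ediam_def image_comp comp_def)

lemma hausdorff_outer_translate_le:
  "hausdorff_outer d ((+) a ` A) \<le> hausdorff_outer d (A :: 'a::real_normed_vector set)"
  unfolding hausdorff_outer_def
proof (rule SUP_subset_mono[OF order_refl], rule INF_mono)
  fix \<delta> :: real and U :: "nat \<Rightarrow> 'a set"
  assume U: "U \<in> {U. A \<subseteq> (\<Union>i. U i) \<and> (\<forall>i. ediam (U i) \<le> ennreal \<delta>)}"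
  let ?V = "\<lambda>i. (+) a ` U i"
  have V: "?V \<in> {U. (+) a ` A \<subseteq> (\<Union>i. U i) \<and> (\<forall>i. ediam (U i) \<le> ennreal \<delta>)}"
    using U by (auto simp: ediam_translate image_UN[symmetric] intro: image_mono)
  show "\<exists>V\<in>{U. (+) a ` A \<subseteq> (\<Union>i. U i) \<and> (\<forall>i. ediam (U i) \<le> ennreal \<delta>)}.
      (\<Sum>i. if V i = {} then 0 else ennreal (unit_ball_vol (real d)) * (ediam (V i) / 2) ^ d)
      \<le> (\<Sum>i. if U i = {} then 0 else ennreal (unit_ball_vol (real d)) * (ediam (U i) / 2) ^ d)"
    by (rule bexI[OF _ V]) (simp only: ediam_translate image_is_empty order_refl cong: if_cong)
qed

lemma hausdorff_outer_translate:
  "hausdorff_outer d ((+) a ` A) = hausdorff_outer d (A :: 'a::real_normed_vector set)"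
proof (rule antisym)
  have "(+) (- a) ` (+) a ` A = A" by (simp add: image_comp comp_def)
  thus "hausdorff_outer d A \<le> hausdorff_outer d ((+) a ` A)"
    using hausdorff_outer_translate_le[of d "- a" "(+) a ` A"] by simp
qed (rule hausdorff_outer_translate_le)

lemma sets_hausdorff_measure [simp, measurable_cong]:
    "sets (hausdorff_measure d :: 'a::metric_space measure) = sets borel"
  and space_hausdorff_measure [simp]: "space (hausdorff_measure d :: 'a::metric_space measure) = UNIV"
  unfolding hausdorff_measure_def
  using sets.sigma_sets_eq[of "borel :: 'a::metric_space measure"]
  by (simp_all add: sets_measure_of space_measure_of)

lemma borel_translate:
  fixes a :: "'a::real_normed_vector"
  assumes "A \<in> sets borel" shows "(+) a ` A \<in> sets borel"
proof -
  have "(+) a ` A = (\<lambda>x. x - a) -` A \<inter> space borel"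
  proof (rule set_eqI, rule iffI)
    fix x assume "x \<in> (\<lambda>x. x - a) -` A \<inter> space borel"
    thus "x \<in> (+) a ` A" by (intro image_eqI[of _ _ "x - a"]) auto
  qed auto
  also have "\<dots> \<in> sets borel"
    by (rule measurable_sets[OF _ assms]) (intro borel_measurable_continuous_onI continuous_intros)
  finally show ?thesis .
qed

text \<open>Countable additivity of the outer measure on the Borel sets is not needed: where it fails,
  \<open>measure_of\<close> yields the zero measure, which is translation invariant too.\<close>
lemma emeasure_hausdorff_translate:
  fixes a :: "'a::real_normed_vector"
  assumes "A \<in> sets borel"
  shows "emeasure (hausdorff_measure d) ((+) a ` A) = emeasure (hausdorff_measure d) A"
proof -
  have ss: "sigma_sets UNIV (sets borel) = sets (borel :: 'a measure)"
    using sets.sigma_sets_eq[of "borel :: 'a measure"] by simp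
  show ?thesis
    unfolding hausdorff_measure_def emeasure_measure_of_conv ss
    using assms borel_translate[OF assms, of a] by (simp add: hausdorff_outer_translate)
qed

lemma translation_invariant_distr:
  fixes \<nu> :: "'a::real_normed_vector measure"
  assumes [measurable_cong]: "sets \<nu> = sets borel"
    and inv: "\<And>a A. A \<in> sets borel \<Longrightarrow> emeasure \<nu> ((+) a ` A) = emeasure \<nu> A"
  shows "distr \<nu> borel ((+) a) = \<nu>"
proof (rule measure_eqI)
  fix A assume "A \<in> sets (distr \<nu> borel ((+) a))"
  hence A: "A \<in> sets borel" by simp
  have m: "(+) a \<in> measurable \<nu> borel"
    using assms(1) measurable_cong_sets by (simp add: measurable_cong_sets[OF assms(1) refl])
  have sp: "space \<nu> = UNIV" using sets_eq_imp_space_eq[OF assms(1)] by simp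
  have "(+) a -` A = (+) (- a) ` A" 
  proof (rule set_eqI, rule iffI)
    fix x assume "x \<in> (+) a -` A"
    thus "x \<in> (+) (- a) ` A" by (intro image_eqI[of _ _ "a + x"]) auto
  qed auto
  thus "emeasure (distr \<nu> borel ((+) a)) A = emeasure \<nu> A"
    using inv[OF A, of "- a"] A m by (simp add: emeasure_distr sp)
qed (simp add: assms)

lemma sigma_finite_translation_invariant:
  fixes \<nu> :: "'a::euclidean_space measure"
  assumes s: "sets \<nu> = sets borel"
    and inv: "\<And>a A. A \<in> sets borel \<Longrightarrow> emeasure \<nu> ((+) a ` A) = emeasure \<nu> A"
    and fin: "emeasure \<nu> (ball x\<^sub>0 r) \<noteq> \<infinity>" and r: "r > 0"
  shows "sigma_finite_measure \<nu>"
proof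
  obtain D :: "'a set" where D: "countable D" "\<And>X. open X \<Longrightarrow> X \<noteq> {} \<Longrightarrow> \<exists>d\<in>D. d \<in> X"
    using countable_dense_setE by blast
  have sp: "space \<nu> = UNIV" using sets_eq_imp_space_eq[OF s] by simp
  have f: "emeasure \<nu> (ball q r) \<noteq> \<infinity>" for q
  proof -
    have "(+) (q - x\<^sub>0) ` ball x\<^sub>0 r = ball q r" by (simp add: ball_translation)
    thus ?thesis using inv[of "ball x\<^sub>0 r" "q - x\<^sub>0"] fin by simp
  qed
  have "\<exists>q\<in>D. x \<in> ball q r" for x
    using D(2)[of "ball x r"] r by (auto simp: dist_commute)
  hence "(\<Union>q\<in>D. ball q r) = space \<nu>" unfolding sp by blast
  thus "\<exists>A. countable A \<and> A \<subseteq> sets \<nu> \<and> \<Union> A = space \<nu> \<and> (\<forall>a\<in>A. emeasure \<nu> a \<noteq> \<infinity>)"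
    using D(1) f s by (intro exI[of _ "(\<lambda>q. ball q r) ` D"]) auto
qed

text \<open>Uniqueness of Haar measure: compute the integral of \<open>1\<^sub>A(x) 1\<^sub>B(x + y)\<close> over \<open>x\<close> and \<open>y\<close> with
  respect to \<open>\<nu>\<close> and Lebesgue measure in both orders.\<close>
lemma translation_invariant_proportional_lborel:
  fixes \<nu> :: "'a::euclidean_space measure"
  assumes s: "sets \<nu> = sets borel" and sf: "sigma_finite_measure \<nu>"
    and inv: "\<And>a. distr \<nu> borel ((+) a) = \<nu>"
    and A [measurable]: "A \<in> sets borel" and B [measurable]: "B \<in> sets borel"
  shows "emeasure \<nu> A * emeasure lborel B = emeasure \<nu> B * emeasure lborel A"
proof -
  note s [measurable_cong]
  interpret \<nu>: sigma_finite_measure \<nu> by (rule sf)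
  interpret P: pair_sigma_finite \<nu> lborel
    by (simp add: pair_sigma_finite_def sf lborel.sigma_finite_measure_axioms)
  have tr: "(\<integral>\<^sup>+ x. g x \<partial>\<nu>) = (\<integral>\<^sup>+ x. g (a + x) \<partial>\<nu>)" if [measurable]: "g \<in> borel_measurable borel" for g a
    by (subst inv[of a, symmetric]) (simp add: nn_integral_distr)
  have tl: "(\<integral>\<^sup>+ x. g x \<partial>lborel) = (\<integral>\<^sup>+ x. g (a + x) \<partial>lborel)" if [measurable]: "g \<in> borel_measurable borel" for g and a :: 'a
    by (subst lborel_distr_plus[of a, symmetric]) (simp add: nn_integral_distr)
  have rl: "(\<integral>\<^sup>+ x. g x \<partial>lborel) = (\<integral>\<^sup>+ x. g (a - x) \<partial>lborel)" if [measurable]: "g \<in> borel_measurable borel" for g and a :: 'a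
    by (subst lborel_affine[of "-1" a]) (simp_all add: nn_integral_distr nn_integral_density)
  have "emeasure \<nu> A * emeasure lborel B = (\<integral>\<^sup>+ x. indicator A x * emeasure lborel B \<partial>\<nu>)"
    by (simp add: nn_integral_multc s)
  also have "\<dots> = (\<integral>\<^sup>+ x. indicator A x * (\<integral>\<^sup>+ y. indicator B (x + y) \<partial>lborel) \<partial>\<nu>)"
    by (subst tl[symmetric]) (auto simp: nn_integral_indicator)
  also have "\<dots> = (\<integral>\<^sup>+ x. (\<integral>\<^sup>+ y. indicator A x * indicator B (x + y) \<partial>lborel) \<partial>\<nu>)"
    by (simp add: nn_integral_cmult)
  also have "\<dots> = (\<integral>\<^sup>+ y. (\<integral>\<^sup>+ x. indicator A x * indicator B (x + y) \<partial>\<nu>) \<partial>lborel)"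
    by (rule P.Fubini'[symmetric]) measurable
  also have "\<dots> = (\<integral>\<^sup>+ y. (\<integral>\<^sup>+ x. indicator A (x - y) * indicator B x \<partial>\<nu>) \<partial>lborel)"
  proof (rule nn_integral_cong)
    fix y :: 'a
    show "(\<integral>\<^sup>+ x. indicator A x * indicator B (x + y) \<partial>\<nu>) = (\<integral>\<^sup>+ x. indicator A (x - y) * indicator B x \<partial>\<nu>)"
      using tr[of "\<lambda>x. indicator A x * indicator B (x + y)" "- y"] by (simp add: add.commute)
  qed
  also have "\<dots> = (\<integral>\<^sup>+ x. (\<integral>\<^sup>+ y. indicator A (x - y) * indicator B x \<partial>lborel) \<partial>\<nu>)"
    by (rule P.Fubini') measurable
  also have "\<dots> = (\<integral>\<^sup>+ x. (\<integral>\<^sup>+ y. indicator A (x - y) \<partial>lborel) * indicator B x \<partial>\<nu>)"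
    by (simp add: nn_integral_multc)
  also have "\<dots> = (\<integral>\<^sup>+ x. emeasure lborel A * indicator B x \<partial>\<nu>)"
    by (subst rl[symmetric]) (auto simp: nn_integral_indicator)
  also have "\<dots> = emeasure \<nu> B * emeasure lborel A"
    by (simp add: nn_integral_multc s mult.commute[of "emeasure lborel A"])
  finally show ?thesis .
qed

lemma less_ediam_plane:
  "ennreal r < ediam (UNIV \<times> {0} :: ('a::euclidean_space \<times> 'b::euclidean_space) set)" if "r > 0"
proof -
  obtain b :: 'a where b: "b \<in> Basis" using nonempty_Basis by blast
  have "ennreal r < ennreal (r + 1)" using that by (simp add: ennreal_less_iff)
  also have "\<dots> = ennreal (dist ((r + 1) *\<^sub>R b, 0::'b) (0, 0))"
    using b that by (simp add: dist_Pair_Pair)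
  also have "\<dots> \<le> ediam (UNIV \<times> {0} :: ('a \<times> 'b) set)"
    unfolding ediam_def by (intro SUP_upper2[where i = "((r + 1) *\<^sub>R b, 0)"] SUP_upper2[where i = "(0, 0)"]) auto
  finally show ?thesis .
qed

text \<open>On the plane, Hausdorff measure is a positive multiple \<open>c\<close> of Lebesgue measure; the value of
  \<open>c\<close> is immaterial. That it is finite and not zero is read off from the Ahlfors bounds for \<open>\<mu>\<close>, and so
  are the two-sided bounds for the continuous density.\<close>
lemma ahlfors_density_on_plane:
  fixes \<mu> :: "('a::euclidean_space \<times> 'b::euclidean_space) measure" and f :: "'a \<Rightarrow> real"
  assumes d: "d = DIM('a)" and E: "E = UNIV \<times> {0}"
    and ahl: "ahlfors_regular d E \<mu>"
    and f0: "\<And>x. 0 \<le> f x" and cont: "continuous_on UNIV f"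
    and \<mu>: "\<mu> = density (hausdorff_measure d) (\<lambda>z. indicator E z * ennreal (f (fst z)))"
  obtains c a b where "c > 0" "a > 0" "\<And>x. a \<le> f x" "\<And>x. f x \<le> b"
    "\<And>\<phi> :: 'a \<times> 'b \<Rightarrow> real. \<phi> \<in> borel_measurable borel \<Longrightarrow>
       (LINT y:E|\<mu>. \<phi> y) = c * (LINT y|lborel. \<phi> (y, 0) * f y)"
proof -
  define H :: "('a \<times> 'b) measure" where "H = hausdorff_measure d"
  have sH [measurable_cong]: "sets H = sets borel" and spH: "space H = UNIV" by (simp_all add: H_def)
  have Eb [measurable]: "E \<in> sets borel"
    unfolding E by (intro borel_closed closed_Times) auto
  have fm [measurable]: "f \<in> borel_measurable borel" using cont by (rule borel_measurable_continuous_onI)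
  have fst_m [measurable]: "fst \<in> borel_measurable H"
    unfolding measurable_cong_sets[OF sH refl]
    by (intro borel_measurable_continuous_onI continuous_intros)
  \<comment> \<open>The restriction of Hausdorff measure to \<open>E\<close>, transported to the first factor.\<close>
  define \<nu> where "\<nu> = distr (density H (indicator E)) borel fst"
  have s\<nu> [measurable_cong]: "sets \<nu> = sets borel" by (simp add: \<nu>_def)
  have nnv: "(\<integral>\<^sup>+ x. g x \<partial>\<nu>) = (\<integral>\<^sup>+ z. indicator E z * g (fst z) \<partial>H)" if [measurable]: "g \<in> borel_measurable borel" for g
    unfolding \<nu>_def by (subst nn_integral_distr) (simp_all add: nn_integral_density)
  have ev: "emeasure \<nu> A = emeasure H (A \<times> {0})" if [measurable]: "A \<in> sets borel" for A
  proof -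
    have [measurable]: "A \<times> ({0}::'b set) \<in> sets borel"
      by (intro borel_Times) auto
    have "emeasure \<nu> A = (\<integral>\<^sup>+ x. indicator A x \<partial>\<nu>)" by (simp add: nn_integral_indicator s\<nu>)
    also have "\<dots> = (\<integral>\<^sup>+ z. indicator (A \<times> {0}) z \<partial>H)"
      by (subst nnv, measurable, rule nn_integral_cong) (auto simp: E indicator_def)
    finally show ?thesis by (simp add: nn_integral_indicator sH)
  qed
  have inv: "emeasure \<nu> ((+) a ` A) = emeasure \<nu> A" if A: "A \<in> sets borel" for a A
  proof -
    have AB: "A \<times> ({0}::'b set) \<in> sets borel" using A by (intro borel_Times) auto
    have "((+) a ` A) \<times> {0::'b} = (+) (a, 0) ` (A \<times> {0})" by force
    thus ?thesis
      using ev[OF A] ev[OF borel_translate[OF A, of a]] emeasure_hausdorff_translate[OF AB, of d "(a, 0)"]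
      by (simp add: H_def)
  qed
  have em: "emeasure \<mu> (ball (x, 0) r) = (\<integral>\<^sup>+ y. indicator (ball x r) y * ennreal (f y) \<partial>\<nu>)" for x r
  proof -
    have "emeasure \<mu> (ball (x, 0) r) = (\<integral>\<^sup>+ z. indicator E z * ennreal (f (fst z)) * indicator (ball (x, 0) r) z \<partial>H)"
      unfolding \<mu> H_def[symmetric] by (rule emeasure_density) measurable
    also have "\<dots> = (\<integral>\<^sup>+ z. indicator E z * (indicator (ball x r) (fst z) * ennreal (f (fst z))) \<partial>H)"
      by (intro nn_integral_cong) (auto simp: E indicator_def dist_Pair_Pair)
    also have "\<dots> = (\<integral>\<^sup>+ y. indicator (ball x r) y * ennreal (f y) \<partial>\<nu>)"
      by (rule nnv[symmetric], rule borel_measurable_times_ennreal[OF borel_measurable_indicator]) auto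
    finally show ?thesis .
  qed
  obtain C where C: "C \<ge> 1" "\<And>x r. r > 0 \<Longrightarrow> ennreal (inverse C * r ^ d) \<le> emeasure \<mu> (ball (x, 0) r)"
     "\<And>x r. r > 0 \<Longrightarrow> emeasure \<mu> (ball (x, 0) r) \<le> ennreal (C * r ^ d)"
    using ahl less_ediam_plane[where 'a = 'a and 'b = 'b] unfolding ahlfors_regular_def E by force
  have \<mu>pos: "emeasure \<mu> (ball (x, 0) 1) > 0" for x
  proof -
    have "0 < ennreal (inverse C * 1 ^ d)" using C(1) by simp
    thus ?thesis using C(2)[of 1 x] by (rule less_le_trans) simp
  qed
  obtain x0 where x0: "f x0 > 0"
  proof (rule ccontr)
    assume "\<not> thesis"
    hence "f x = 0" for x using that f0[of x] by (metis less_le)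
    hence "emeasure \<mu> (ball (0, 0) 1) = 0" unfolding em by simp
    thus False using \<mu>pos[of 0] by simp
  qed
  have near: "\<exists>r>0. \<forall>y\<in>ball x r. \<bar>f y - f x\<bar> < e" if "e > 0" for x e
  proof -
    have "isCont f x" using cont by (simp add: continuous_on_eq_continuous_at)
    thus ?thesis unfolding continuous_at_eps_delta
      using that by (fastforce simp: dist_commute dist_real_def)
  qed
  obtain r0 where r0: "r0 > 0" "\<And>y. y \<in> ball x0 r0 \<Longrightarrow> \<bar>f y - f x0\<bar> < f x0 / 2"
    using near[of "f x0 / 2" x0] x0 by auto
  have fin: "emeasure \<nu> (ball x0 r0) \<noteq> \<infinity>"
  proof
    assume inf: "emeasure \<nu> (ball x0 r0) = \<infinity>"
    have "ennreal (f x0 / 2) * emeasure \<nu> (ball x0 r0) = (\<integral>\<^sup>+ y. ennreal (f x0 / 2) * indicator (ball x0 r0) y \<partial>\<nu>)"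
      by (rule nn_integral_cmult_indicator[symmetric]) (simp add: s\<nu>)
    also have "\<dots> \<le> (\<integral>\<^sup>+ y. indicator (ball x0 r0) y * ennreal (f y) \<partial>\<nu>)"
    proof (rule nn_integral_mono)
      fix y
      show "ennreal (f x0 / 2) * indicator (ball x0 r0) y \<le> indicator (ball x0 r0) y * ennreal (f y)"
      proof (cases "y \<in> ball x0 r0")
        case True
        hence "f x0 / 2 \<le> f y" using r0(2)[OF True] by argo
        thus ?thesis using True by (simp add: ennreal_leI)
      qed simp
    qed
    also have "\<dots> \<le> ennreal (C * r0 ^ d)" using C(3)[OF r0(1), of x0] unfolding em .
    finally have "ennreal (f x0 / 2) * emeasure \<nu> (ball x0 r0) \<noteq> \<infinity>" by (auto simp: top_unique)
    thus False using inf x0 by (simp add: ennreal_mult_eq_top_iff)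
  qed
  note sf = sigma_finite_translation_invariant[OF s\<nu> inv fin r0(1)]
  note ti = translation_invariant_distr[OF s\<nu> inv]
  let ?B = "ball x0 r0"
  define c where "c = measure \<nu> ?B / measure lborel ?B"
  have lB: "measure lborel ?B > 0" using r0(1) by (simp add: content_ball_pos)
  have flB: "emeasure lborel ?B = ennreal (measure lborel ?B)"
    by (rule emeasure_eq_ennreal_measure) (use emeasure_lborel_ball_finite[of x0 r0] in auto)
  have fvB: "emeasure \<nu> ?B = ennreal (measure \<nu> ?B)"
    by (rule emeasure_eq_ennreal_measure) (use fin in auto)
  have c0: "c \<ge> 0" by (simp add: c_def)
  have proportional: "emeasure \<nu> A = ennreal c * emeasure lborel A" if A: "A \<in> sets borel" for A
  proof -
    have "emeasure \<nu> A * ennreal (measure lborel ?B) = ennreal (measure \<nu> ?B) * emeasure lborel A"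
      using translation_invariant_proportional_lborel[OF s\<nu> sf ti A borel_open[OF open_ball], of x0 r0]
      unfolding flB fvB .
    also have "ennreal (measure \<nu> ?B) = ennreal c * ennreal (measure lborel ?B)"
      using lB c0 by (simp add: ennreal_mult[symmetric] c_def)
    finally have e: "emeasure \<nu> A * ennreal (measure lborel ?B) = (ennreal c * emeasure lborel A) * ennreal (measure lborel ?B)"
      by (simp only: mult_ac)
    have "ennreal (measure lborel ?B) * ennreal (1 / measure lborel ?B) = ennreal (measure lborel ?B * (1 / measure lborel ?B))"
      by (rule ennreal_mult[symmetric]) auto
    also have "\<dots> = 1" using lB by simp
    finally have one: "ennreal (measure lborel ?B) * ennreal (1 / measure lborel ?B) = 1" .
    show ?thesis
      using arg_cong[OF e, of "\<lambda>t. t * ennreal (1 / measure lborel ?B)"] by (simp only: mult.assoc one mult_1_right)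
  qed
  have \<nu>: "\<nu> = density lborel (\<lambda>_. ennreal c)"
    by (rule measure_eqI) (auto simp: s\<nu> proportional emeasure_density_const)
  have c: "c > 0"
  proof (rule ccontr)
    assume "\<not> c > 0"
    hence "c = 0" using c0 by simp
    hence "emeasure \<mu> (ball (0, 0) 1) = 0" unfolding em \<nu> by (simp add: null_measure_eq_density[symmetric])
    thus False using \<mu>pos[of 0] by simp
  qed
  define \<omega> where "\<omega> = unit_ball_vol (real DIM('a))"
  have \<omega>: "\<omega> > 0" by (simp add: \<omega>_def)
  have eb: "(\<integral>\<^sup>+ y. indicator (ball x r) y * ennreal t \<partial>\<nu>) = ennreal (c * t * \<omega> * r ^ d)" if "r > 0" "t \<ge> 0" for x r t
  proof -
    have "(\<integral>\<^sup>+ y. indicator (ball x r) y * ennreal t \<partial>\<nu>) = emeasure \<nu> (ball x r) * ennreal t"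
      using nn_integral_cmult_indicator[of "ball x r" \<nu> "ennreal t"] by (simp add: s\<nu> mult.commute)
    also have "\<dots> = ennreal c * ennreal (\<omega> * r ^ d) * ennreal t"
      using that by (simp add: proportional emeasure_ball \<omega>_def d)
    also have "\<dots> = ennreal (c * (\<omega> * r ^ d) * t)"
      using that c0 \<omega> by (simp add: ennreal_mult)
    finally show ?thesis by (simp add: mult_ac)
  qed
  have lower: "inverse C / (c * \<omega>) \<le> f x" for x
  proof (rule field_le_epsilon)
    fix e :: real assume e: "e > 0"
    obtain r where r: "r > 0" "\<And>y. y \<in> ball x r \<Longrightarrow> \<bar>f y - f x\<bar> < e" using near[OF e, of x] by auto
    have "ennreal (inverse C * r ^ d) \<le> (\<integral>\<^sup>+ y. indicator (ball x r) y * ennreal (f y) \<partial>\<nu>)"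
      using C(2)[OF r(1), of x] unfolding em .
    also have "\<dots> \<le> (\<integral>\<^sup>+ y. indicator (ball x r) y * ennreal (f x + e) \<partial>\<nu>)"
    proof (rule nn_integral_mono)
      fix y
      show "indicator (ball x r) y * ennreal (f y) \<le> indicator (ball x r) y * ennreal (f x + e)"
      proof (cases "y \<in> ball x r")
        case True
        hence "f y \<le> f x + e" using r(2)[OF True] by argo
        thus ?thesis using True by (simp add: ennreal_leI)
      qed simp
    qed
    also have "\<dots> = ennreal (c * (f x + e) * \<omega> * r ^ d)" using r(1) e f0[of x] by (intro eb) auto
    finally have "inverse C * r ^ d \<le> c * (f x + e) * \<omega> * r ^ d"
      using c0 e f0[of x] \<omega> r(1) by (subst (asm) ennreal_le_iff) auto
    hence "inverse C \<le> c * (f x + e) * \<omega>" using r(1) by simp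
    thus "inverse C / (c * \<omega>) \<le> f x + e" using c \<omega> by (simp add: pos_divide_le_eq mult_ac)
  qed
  have upper: "f x \<le> C / (c * \<omega>)" for x
  proof (rule field_le_epsilon)
    fix e :: real assume e: "e > 0"
    obtain r where r: "r > 0" "\<And>y. y \<in> ball x r \<Longrightarrow> \<bar>f y - f x\<bar> < e" using near[OF e, of x] by auto
    let ?t = "max 0 (f x - e)"
    have "ennreal (c * ?t * \<omega> * r ^ d) = (\<integral>\<^sup>+ y. indicator (ball x r) y * ennreal ?t \<partial>\<nu>)"
      using r(1) by (intro eb[symmetric]) auto
    also have "\<dots> \<le> (\<integral>\<^sup>+ y. indicator (ball x r) y * ennreal (f y) \<partial>\<nu>)"
    proof (rule nn_integral_mono)
      fix y
      show "indicator (ball x r) y * ennreal ?t \<le> indicator (ball x r) y * ennreal (f y)"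
      proof (cases "y \<in> ball x r")
        case True
        hence "?t \<le> f y" using r(2)[OF True] f0[of y] by argo
        thus ?thesis using True by (simp add: ennreal_leI)
      qed simp
    qed
    also have "\<dots> \<le> ennreal (C * r ^ d)" using C(3)[OF r(1), of x] unfolding em .
    finally have "c * ?t * \<omega> * r ^ d \<le> C * r ^ d"
      using C(1) r(1) by (subst (asm) ennreal_le_iff) auto
    hence "c * ?t * \<omega> \<le> C" using r(1) by simp
    moreover have "c * \<omega> > 0" using c \<omega> by simp
    moreover have "?t * (c * \<omega>) = c * ?t * \<omega>" by (simp only: mult_ac)
    ultimately have "?t \<le> C / (c * \<omega>)" by (simp only: pos_le_divide_eq)
    thus "f x \<le> C / (c * \<omega>) + e" by argo
  qed
  have int: "(LINT y:E|\<mu>. \<phi> y) = c * (LINT y|lborel. \<phi> (y, 0) * f y)"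
    if [measurable]: "\<phi> \<in> borel_measurable borel" for \<phi> :: "'a \<times> 'b \<Rightarrow> real"
  proof -
    have pm [measurable]: "(\<lambda>y. (y, 0::'b)) \<in> borel_measurable borel"
      by (intro borel_measurable_continuous_onI continuous_intros)
    have [measurable]: "(\<lambda>y. \<phi> (y, 0)) \<in> borel_measurable borel"
      using measurable_compose[OF pm that] by simp
    have \<mu>': "\<mu> = density H (\<lambda>z. ennreal (indicator E z * f (fst z)))"
      unfolding \<mu> H_def[symmetric] using f0 by (intro arg_cong2[where f = density] refl ext) (simp add: indicator_def)
    have "(LINT y:E|\<mu>. \<phi> y) = (LINT z|H. (indicator E z * f (fst z)) *\<^sub>R (indicator E z *\<^sub>R \<phi> z))"
      unfolding set_lebesgue_integral_def \<mu>' using f0 by (intro integral_density) (auto simp: indicator_def)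
    also have "\<dots> = (LINT z|H. indicator E z *\<^sub>R (\<phi> (fst z, 0) * f (fst z)))"
      by (intro Bochner_Integration.integral_cong refl) (auto simp: E indicator_def)
    also have "\<dots> = (LINT z|density H (\<lambda>z. ennreal (indicator E z)). \<phi> (fst z, 0) * f (fst z))"
      by (intro integral_density[symmetric]) auto
    also have "\<dots> = (LINT y|\<nu>. \<phi> (y, 0) * f y)"
      unfolding \<nu>_def by (subst integral_distr) (auto simp: ennreal_indicator)
    also have "\<dots> = (LINT y|lborel. c *\<^sub>R (\<phi> (y, 0) * f y))"
      unfolding \<nu> using c0 by (intro integral_density) auto
    finally show ?thesis by simp
  qed
  show ?thesis
  proof (rule that[OF c _ lower upper int])
    show "0 < inverse C / (c * \<omega>)" using C(1) c \<omega> by simp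
  qed
qed

section \<open>The distance function of the plane\<close>

lemma lborel_integral_affine:
  fixes g :: "'a::euclidean_space \<Rightarrow> real"
  assumes [measurable]: "g \<in> borel_measurable borel" and r: "r > 0"
  shows "(LINT y|lborel. g y) = r ^ DIM('a) * (LINT z|lborel. g (x + r *\<^sub>R z))"
proof -
  have "(LINT y|lborel. g y) = (LINT y|density (distr lborel borel (\<lambda>z. x + r *\<^sub>R z)) (\<lambda>_. ennreal (\<bar>r\<bar> ^ DIM('a))). g y)"
    using lborel_affine[of r x] r by simp
  also have "\<dots> = (LINT y|distr lborel borel (\<lambda>z. x + r *\<^sub>R z). (\<bar>r\<bar> ^ DIM('a)) *\<^sub>R g y)"
    by (intro integral_density) auto
  also have "\<dots> = (LINT z|lborel. (\<bar>r\<bar> ^ DIM('a)) *\<^sub>R g (x + r *\<^sub>R z))"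
    by (intro integral_distr) auto
  finally show ?thesis using r by simp
qed

text \<open>The substitution \<open>y = x + r z\<close> with \<open>r = |t|\<close>.\<close>
lemma D_dist_plane:
  fixes \<mu> :: "('a::euclidean_space \<times> 'b::euclidean_space) measure"
  assumes d: "d = DIM('a)" and s: "2 * s = real DIM('a) + \<alpha>"
    and f [measurable]: "f \<in> borel_measurable borel"
    and int: "\<And>\<phi> :: 'a \<times> 'b \<Rightarrow> real. \<phi> \<in> borel_measurable borel \<Longrightarrow>
       (LINT y:E|\<mu>. \<phi> y) = c * (LINT y|lborel. \<phi> (y, 0) * f y)"
    and t: "t \<noteq> 0"
  shows "D_dist d E \<alpha> \<mu> (x, t) = (c * norm t powr (- \<alpha>) * kavg f (kern s) (x, norm t)) powr (- 1 / \<alpha>)"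
proof -
  define r where "r = norm t"
  have r: "r > 0" using t by (simp add: r_def)
  let ?\<phi> = "\<lambda>y. norm ((x, t) - y) powr (- real d - \<alpha>)"
  have m: "?\<phi> \<in> borel_measurable borel" by measurable
  have m1: "(\<lambda>y. ((x, t) - (y, 0::'b))) \<in> borel_measurable borel"
    by (intro borel_measurable_continuous_onI continuous_intros)
  have m2: "(\<lambda>y. ?\<phi> (y, 0) * f y) \<in> borel_measurable borel"
    using m1 by measurable
  have e: "?\<phi> (x + r *\<^sub>R z, 0) = r powr (- real d - \<alpha>) * kern s z" for z
  proof -
    have p: "0 \<le> 1 + (norm z)\<^sup>2" by simp
    have "norm ((x, t) - (x + r *\<^sub>R z, 0)) = sqrt (r\<^sup>2 * (1 + (norm z)\<^sup>2))"
      using r by (simp add: norm_Pair r_def[symmetric] power_mult_distrib algebra_simps)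
    also have "\<dots> = r * sqrt (1 + (norm z)\<^sup>2)" using r by (simp add: real_sqrt_mult)
    also have "sqrt (1 + (norm z)\<^sup>2) = (1 + (norm z)\<^sup>2) powr (1 / 2)" by (rule powr_half_sqrt[OF p, symmetric])
    finally have "?\<phi> (x + r *\<^sub>R z, 0) = (r * (1 + (norm z)\<^sup>2) powr (1 / 2)) powr (- real d - \<alpha>)" by simp
    also have "\<dots> = r powr (- real d - \<alpha>) * (1 + (norm z)\<^sup>2) powr (1 / 2 * (- real d - \<alpha>))"
      unfolding powr_powr[symmetric] by (rule powr_mult)
    also have "1 / 2 * (- real d - \<alpha>) = - s" using s d by simp
    finally show ?thesis by (simp add: kern_def)
  qed
  have "(LINT y|lborel. ?\<phi> (y, 0) * f y) = r ^ DIM('a) * (LINT z|lborel. ?\<phi> (x + r *\<^sub>R z, 0) * f (x + r *\<^sub>R z))"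
    by (rule lborel_integral_affine[OF m2 r])
  also have "\<dots> = r ^ DIM('a) * (LINT z|lborel. r powr (- real d - \<alpha>) * (f (x + r *\<^sub>R z) * kern s z))"
    unfolding e by (simp add: mult_ac)
  also have "\<dots> = r ^ DIM('a) * r powr (- real d - \<alpha>) * kavg f (kern s) (x, r)"
    by (simp add: kavg_def)
  also have "r ^ DIM('a) * r powr (- real d - \<alpha>) = r powr (- \<alpha>)"
    using r by (simp add: d powr_realpow[symmetric] powr_add[symmetric])
  finally have "(LINT y:E|\<mu>. ?\<phi> y) = c * r powr (- \<alpha>) * kavg f (kern s) (x, r)"
    unfolding int[OF m] by (simp add: mult.assoc)
  thus ?thesis unfolding D_dist_def r_def by simp
qed

section \<open>Regular densities\<close>

lemma has_partials_partial_deriv: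
  fixes g :: "'a::euclidean_space \<Rightarrow> real"
  assumes "g differentiable_on UNIV"
  shows "has_partials g (\<lambda>b. partial_deriv b g)"
  unfolding has_partials_def
proof
  fix y
  have "g differentiable (at y)" using assms by (simp add: differentiable_on_def)
  hence d: "(g has_derivative frechet_derivative g (at y)) (at y)" by (simp add: frechet_derivative_works)
  have "frechet_derivative g (at y) h = (\<Sum>b\<in>Basis. partial_deriv b g y * (h \<bullet> b))" for h
  proof -
    have "frechet_derivative g (at y) h = frechet_derivative g (at y) (\<Sum>b\<in>Basis. (h \<bullet> b) *\<^sub>R b)"
      by (simp add: euclidean_representation)
    also have "\<dots> = (\<Sum>b\<in>Basis. partial_deriv b g y * (h \<bullet> b))"
      using has_derivative_linear[OF d] by (simp add: linear_sum linear_cmul partial_deriv_def mult.commute)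
    finally show ?thesis .
  qed
  from d this show "(g has_derivative (\<lambda>h. \<Sum>b\<in>Basis. partial_deriv b g y * (h \<bullet> b))) (at y)"
    by (rule has_derivative_eq_rhs[OF _ ext])
qed

lemma growth_holder:
  fixes g :: "'a::euclidean_space \<Rightarrow> real"
  assumes bdd: "bdd_above {\<bar>g x - g y\<bar> / norm (x - y) powr \<gamma> | x y. x \<noteq> y}" and \<gamma>: "\<gamma> \<ge> 0"
  shows "growth \<gamma> g"
proof -
  obtain K where K: "\<And>x y. x \<noteq> y \<Longrightarrow> \<bar>g x - g y\<bar> / norm (x - y) powr \<gamma> \<le> K"
    using bdd unfolding bdd_above_def by blast
  have "\<bar>g y\<bar> \<le> (\<bar>g 0\<bar> + \<bar>K\<bar>) * (1 + norm y) powr \<gamma>" for y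
  proof -
    have one: "1 \<le> (1 + norm y) powr \<gamma>" using \<gamma> by (intro ge_one_powr_ge_zero) auto
    have "\<bar>g y - g 0\<bar> \<le> \<bar>K\<bar> * (1 + norm y) powr \<gamma>"
    proof (cases "y = 0")
      case False
      hence "\<bar>g y - g 0\<bar> \<le> K * norm y powr \<gamma>" using K[of y 0] by (simp add: pos_divide_le_eq)
      also have "\<dots> \<le> \<bar>K\<bar> * (1 + norm y) powr \<gamma>"
        using \<gamma> by (intro mult_mono powr_mono2) auto
      finally show ?thesis .
    qed (use one in auto)
    moreover have "\<bar>g 0\<bar> \<le> \<bar>g 0\<bar> * (1 + norm y) powr \<gamma>" using one by (simp add: mult_le_cancel_left1)
    ultimately show ?thesis by (simp add: distrib_right)
  qed
  thus ?thesis by (rule growthI)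
qed

lemma C_holder_2_partials:
  fixes f :: "'a::euclidean_space \<Rightarrow> real"
  assumes C: "C_holder 2 \<epsilon> f" and \<epsilon>: "\<epsilon> \<ge> 0"
  defines "f' \<equiv> \<lambda>b. partial_deriv b f"
  defines "f'' \<equiv> \<lambda>b c. partial_deriv c (partial_deriv b f)"
  shows "has_partials f f'"
    and "\<And>b. b \<in> Basis \<Longrightarrow> has_partials (f' b) (f'' b)"
    and "\<And>b c. b \<in> Basis \<Longrightarrow> c \<in> Basis \<Longrightarrow> continuous_on UNIV (f'' b c)"
    and "\<And>b c. b \<in> Basis \<Longrightarrow> c \<in> Basis \<Longrightarrow> growth \<epsilon> (f'' b c)"
proof -
  note C' = C[unfolded C_holder_def]
  have "[] \<in> lists (Basis :: 'a set)" by simp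
  with C' have "foldr partial_deriv [] f differentiable_on UNIV" by (metis list.size(3) zero_less_numeral)
  thus "has_partials f f'" unfolding f'_def by (intro has_partials_partial_deriv) simp
next
  fix b :: 'a assume b: "b \<in> Basis"
  have "foldr partial_deriv [b] f differentiable_on UNIV"
    using C[unfolded C_holder_def, THEN conjunct1, rule_format, of "[b]"] b by simp
  thus "has_partials (f' b) (f'' b)"
    unfolding f'_def f''_def by (intro has_partials_partial_deriv) simp
next
  fix b c :: 'a assume b: "b \<in> Basis" "c \<in> Basis"
  show "continuous_on UNIV (f'' b c)"
    using C[unfolded C_holder_def, THEN conjunct2, THEN conjunct1, rule_format, of "[c, b]"] b by (simp add: f''_def)
  show "growth \<epsilon> (f'' b c)"
    using C[unfolded C_holder_def, THEN conjunct2, THEN conjunct2, rule_format, of "[c, b]"] b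
    unfolding f''_def by (intro growth_holder[OF _ \<epsilon>]) simp
qed

lemma kavg_kern_pos:
  fixes f :: "'a::euclidean_space \<Rightarrow> real"
  assumes cont: "continuous_on UNIV f" and a: "a > 0" "\<And>x. a \<le> f x" and b: "\<And>x. f x \<le> b"
    and s: "2 * s > real DIM('a)"
  shows "kavg f (kern s) \<xi> > 0"
proof -
  have s0: "s \<ge> 0" using s by simp
  have "\<bar>f y\<bar> \<le> b * (1 + norm y) powr 0" for y
    using less_le_trans[OF a, of y] b[of y] by simp
  hence "growth 0 f" by (rule growthI)
  hence i: "integrable lborel (\<lambda>z. f (fst \<xi> + snd \<xi> *\<^sub>R z) * kern s z)"
    by (rule kavg_integrable[OF cont _ _ growth_kern[OF s0]]) (use s in auto)
  have "0 < a * (LINT z|lborel. kern s (z::'a))" using a(1) integral_kern_pos[OF s] by simp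
  also have "\<dots> = (LINT z|lborel. a * kern s (z::'a))" by simp
  also have "\<dots> \<le> kavg f (kern s) \<xi>"
    unfolding kavg_def
    using kern_integrable[OF s] i a(2) kern_pos[of s]
    by (intro integral_mono mult_right_mono) (auto intro: less_imp_le)
  finally show ?thesis .
qed

text \<open>The hypothesis \<open>eq\<close> says that \<open>f powr p\<close> is harmonic.\<close>
lemma powr_harmonic_constant:
  fixes f :: "'a::euclidean_space \<Rightarrow> real"
  assumes \<epsilon>: "\<epsilon> \<ge> 0" and p: "p \<noteq> 0"
    and a: "a > 0" "\<And>x. a \<le> f x" and b: "\<And>x. f x \<le> b"
    and f: "has_partials f f'"
    and f': "\<And>b. b \<in> Basis \<Longrightarrow> has_partials (f' b) (f'' b)"
    and cont: "\<And>b c. b \<in> Basis \<Longrightarrow> c \<in> Basis \<Longrightarrow> continuous_on UNIV (f'' b c)"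
    and gr: "\<And>b c. b \<in> Basis \<Longrightarrow> c \<in> Basis \<Longrightarrow> growth \<epsilon> (f'' b c)"
    and eq: "\<And>x. f x * (\<Sum>b\<in>Basis. f'' b b x) + (p - 1) * (\<Sum>b\<in>Basis. (f' b x)\<^sup>2) = 0"
  shows "f x = f y"
proof -
  have f0: "f x > 0" for x using a less_le_trans by blast
  have der: "(f has_derivative (\<lambda>h. \<Sum>b\<in>Basis. f' b y * (h \<bullet> b))) (at y)" for y
    using f by (simp add: has_partials_def)
  have der': "(f' c has_derivative (\<lambda>h. \<Sum>b\<in>Basis. f'' c b y * (h \<bullet> b))) (at y)" if "c \<in> Basis" for y c
    using f'[OF that] by (simp add: has_partials_def)
  have dpow: "((\<lambda>y. f y powr q) has_derivative (\<lambda>h. (\<Sum>b\<in>Basis. f' b y * (h \<bullet> b)) * (q * f y powr (q - 1)))) (at y)" for y q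
    by (rule DERIV_compose_FDERIV[OF has_real_derivative_powr[OF f0] der])
  have bpow: "f y powr q \<le> a powr q + b powr q" for y q
  proof (cases "q \<ge> 0")
    case True
    hence "f y powr q \<le> b powr q" using b f0[of y] by (intro powr_mono2) (auto intro: less_imp_le)
    thus ?thesis using powr_ge_zero[of a q] by linarith
  next
    case False
    hence "f y powr q \<le> a powr q" using a by (intro powr_mono2') auto
    thus ?thesis using powr_ge_zero[of b q] by linarith
  qed
  have gpow: "growth 0 (\<lambda>y. f y powr q)" for q
    by (rule growthI[of _ "a powr q + b powr q"]) (use bpow[of _ q] in simp)
  have cpow: "continuous_on UNIV (\<lambda>y. f y powr q)" for q
    using dpow by (meson continuous_at_imp_continuous_on has_derivative_continuous)
  define v where "v y = f y powr p" for y
  define v' where "v' b y = p * (f y powr (p - 1) * f' b y)" for b y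
  define v'' where "v'' b c y = p * (f y powr (p - 1) * f'' b c y + (p - 1) * f y powr (p - 2) * f' b y * f' c y)" for b c y
  have gf': "growth (\<epsilon> + 1) (f' b)" if "b \<in> Basis" for b
    using growth_antiderivative[OF f'[OF that] gr[OF that] \<epsilon>] .
  have "v x = v y"
  proof (rule bounded_harmonic_constant[where v' = v' and v'' = v'' and a = "2 * \<epsilon> + 2" and S = "a powr p + b powr p"])
    show "has_partials v v'"
      unfolding has_partials_def
    proof
      fix y
      have "(\<Sum>b\<in>Basis. f' b y * (h \<bullet> b)) * (p * f y powr (p - 1)) = (\<Sum>b\<in>Basis. v' b y * (h \<bullet> b))" for h
        unfolding v'_def sum_distrib_right by (intro sum.cong refl) (simp only: mult_ac)
      with dpow[of p y] show "(v has_derivative (\<lambda>h. \<Sum>b\<in>Basis. v' b y * (h \<bullet> b))) (at y)"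
        unfolding v_def by simp
    qed
  next
    fix c :: 'a assume c: "c \<in> Basis"
    show "has_partials (v' c) (v'' c)"
      unfolding has_partials_def
    proof
      fix y
      have "p * (f y powr (p - 1) * (\<Sum>b\<in>Basis. f'' c b y * (h \<bullet> b))
          + (\<Sum>b\<in>Basis. f' b y * (h \<bullet> b)) * ((p - 1) * f y powr (p - 1 - 1)) * f' c y)
          = (\<Sum>b\<in>Basis. v'' c b y * (h \<bullet> b))" for h
      proof -
        have e: "p - 1 - 1 = p - 2" by simp
        show ?thesis
          unfolding v''_def sum_distrib_right sum_distrib_left sum.distrib[symmetric] e
          by (intro sum.cong refl) algebra
      qed
      with has_derivative_mult_right[OF has_derivative_mult[OF dpow[of "p - 1" y] der'[OF c]], of p]
      show "(v' c has_derivative (\<lambda>h. \<Sum>b\<in>Basis. v'' c b y * (h \<bullet> b))) (at y)"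
        unfolding v'_def by simp
    qed
    fix b :: 'a assume b: "b \<in> Basis"
    show "continuous_on UNIV (v'' c b)"
      unfolding v''_def
      by (intro continuous_intros cpow cont c b has_partials_continuous_on[OF f'[OF b]] has_partials_continuous_on[OF f'[OF c]])
    have "growth (0 + \<epsilon>) (\<lambda>y. f y powr (p - 1) * f'' c b y)"
      by (intro growth_mult gpow gr c b)
    hence 1: "growth (2 * \<epsilon> + 2) (\<lambda>y. f y powr (p - 1) * f'' c b y)"
      by (rule growth_mono) (use \<epsilon> in simp)
    have "growth (0 + (\<epsilon> + 1) + (\<epsilon> + 1)) (\<lambda>y. (p - 1) * f y powr (p - 2) * f' c y * f' b y)"
      by (intro growth_mult growth_cmult gpow gf' c b)
    hence 2: "growth (2 * \<epsilon> + 2) (\<lambda>y. (p - 1) * f y powr (p - 2) * f' c y * f' b y)"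
      by (rule growth_eq) simp
    show "growth (2 * \<epsilon> + 2) (v'' c b)"
      unfolding v''_def by (intro growth_cmult growth_add 1 2)
  next
    fix y
    show "\<bar>v y\<bar> \<le> a powr p + b powr p" using bpow[of y p] by (simp add: v_def)
    have e: "f y powr (p - 1) = f y * f y powr (p - 2)"
      using f0[of y] powr_add[of "f y" 1 "p - 2"] by simp
    have "v'' b b y = p * f y powr (p - 2) * (f y * f'' b b y + (p - 1) * (f' b y)\<^sup>2)" for b
      unfolding v''_def e by (simp add: algebra_simps power2_eq_square)
    hence "(\<Sum>b\<in>Basis. v'' b b y) = p * f y powr (p - 2) * (f y * (\<Sum>b\<in>Basis. f'' b b y) + (p - 1) * (\<Sum>b\<in>Basis. (f' b y)\<^sup>2))"
      by (simp add: sum_distrib_left sum.distrib distrib_left mult.assoc)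
    thus "(\<Sum>b\<in>Basis. v'' b b y) = 0" by (simp only: eq mult_zero_right)
  qed (use \<epsilon> in auto)
  hence "(f x powr p) powr (1 / p) = (f y powr p) powr (1 / p)" by (simp add: v_def)
  thus ?thesis using p f0[of x] f0[of y] by (simp add: powr_powr)
qed

text \<open>The contrapositive of the theorem, in arbitrary Euclidean spaces. The boundary equation carries the
  factor \<open>\<alpha> - m + 2\<close>, where \<open>m\<close> is the codimension of \<open>E\<close>, and \<open>\<alpha>m\<close> allows to divide by it.\<close>
lemma solution_imp_constant_density:
  fixes \<mu> :: "('a::euclidean_space \<times> 'b::euclidean_space) measure" and f :: "'a \<Rightarrow> real"
  assumes d: "d = DIM('a)" and E: "E = UNIV \<times> {0}" and \<epsilon>: "\<epsilon> \<ge> 0"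
    and \<alpha>: "\<alpha> > 2 + \<epsilon>" and \<alpha>m: "\<alpha> \<noteq> real DIM('b) - 2"
    and ahl: "ahlfors_regular d E \<mu>" and f0: "\<And>x. 0 \<le> f x"
    and \<mu>: "\<mu> = density (hausdorff_measure d) (\<lambda>z. indicator E z * ennreal (f (fst z)))"
    and C: "C_holder 2 \<epsilon> f"
    and sol: "\<And>z. z \<in> - E \<Longrightarrow> L_op d E \<alpha> \<mu> (D_dist d E \<alpha> \<mu>) z = 0"
  shows "f x = f y"
proof -
  define f' where "f' b = partial_deriv b f" for b
  define f'' where "f'' b c = partial_deriv c (partial_deriv b f)" for b c
  note P = C_holder_2_partials[OF C \<epsilon>, folded f'_def f''_def]
  note cont = has_partials_continuous_on[OF P(1)]
  obtain c a b where c: "c > 0" and a: "a > 0" "\<And>x. a \<le> f x" and b: "\<And>x. f x \<le> b"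
    and int: "\<And>\<phi> :: 'a \<times> 'b \<Rightarrow> real. \<phi> \<in> borel_measurable borel \<Longrightarrow>
       (LINT y:E|\<mu>. \<phi> y) = c * (LINT y|lborel. \<phi> (y, 0) * f y)"
    by (rule ahlfors_density_on_plane[OF d E ahl f0 cont \<mu>]) (rule that)
  define s where "s = (real DIM('a) + \<alpha>) / 2"
  have s: "2 * s = real DIM('a) + \<alpha>" by (simp add: s_def)
  define D where "D = D_dist d E \<alpha> \<mu>"
  have D: "D (x, t) = (c * norm t powr (- \<alpha>) * kavg f (kern s) (x, norm t)) powr (- 1 / \<alpha>)" if "t \<noteq> 0" for x t
    unfolding D_def by (rule D_dist_plane[OF d s borel_measurable_continuous_onI[OF cont] int that])
  have pos: "kavg f (kern s) \<xi> > 0" for \<xi>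
    by (rule kavg_kern_pos[OF cont a b]) (use s \<alpha> \<epsilon> in simp)
  have "divergence (\<lambda>z. D z powr (1 - real DIM('b)) *\<^sub>R gradient D z) (x, t) = 0" if "t \<noteq> 0" for x t
  proof -
    have "(x, t) \<in> - E" using that by (simp add: E)
    from sol[OF this] show ?thesis unfolding L_op_def D_def[symmetric] by (simp add: d)
  qed
  hence bd: "f x * (\<Sum>b\<in>Basis. f'' b b x) * (1 - (real DIM('b) - 4) / (\<alpha> - 2))
     + ((real DIM('b) - 2) / \<alpha> - 1) * (\<Sum>b\<in>Basis. (f' b x)\<^sup>2) = 0" for x
    by (intro boundary_equation[OF \<alpha> \<epsilon> c s D pos P]) assumption+
  show ?thesis
  proof (rule powr_harmonic_constant[OF \<epsilon> _ a b P])
    show "2 / \<alpha> \<noteq> 0" using \<alpha> \<epsilon> by simp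
    fix x
    define F where "F = f x * (\<Sum>b\<in>Basis. f'' b b x)"
    define Q where "Q = (\<Sum>b\<in>Basis. (f' b x)\<^sup>2)"
    define m where "m = real DIM('b)"
    have \<alpha>2: "\<alpha> > 0" "\<alpha> - 2 > 0" using \<alpha> \<epsilon> by auto
    define k where "k = \<alpha> - m + 2"
    have k: "k \<noteq> 0" using \<alpha>m by (simp add: m_def k_def)
    have "1 - (m - 4) / (\<alpha> - 2) = k / (\<alpha> - 2)" "(m - 2) / \<alpha> - 1 = - (k / \<alpha>)"
      using \<alpha>2 by (simp_all add: k_def field_simps)
    with bd[of x] have "F * (k / (\<alpha> - 2)) + - (k / \<alpha>) * Q = 0"
      by (simp only: F_def Q_def m_def)
    hence "k * (F / (\<alpha> - 2) - Q / \<alpha>) = 0" by (simp add: right_diff_distrib mult.commute)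
    hence "F / (\<alpha> - 2) = Q / \<alpha>" using k by simp
    hence "F = (\<alpha> - 2) / \<alpha> * Q" using \<alpha>2 by (simp add: field_simps)
    hence "F + (2 / \<alpha> - 1) * Q = 0" using \<alpha>2 by (simp add: field_simps)
    thus "f x * (\<Sum>b\<in>Basis. f'' b b x) + (2 / \<alpha> - 1) * (\<Sum>b\<in>Basis. (f' b x)\<^sup>2) = 0"
      by (simp add: F_def Q_def)
  qed
qed

theorem theorem3:
  fixes n d :: nat
    and E :: "((real ^ 'd) \<times> (real ^ 'm)) set"
    and \<mu> :: "((real ^ 'd) \<times> (real ^ 'm)) measure"
    and f :: "real ^ 'd \<Rightarrow> real"
    and \<alpha> \<epsilon> \<epsilon>\<^sub>0 :: real
  assumes "d = CARD('d)" and "n = CARD('d) + CARD('m)"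
    and "int n - int d > 4"
    and "E = UNIV \<times> {0}"
    and "0 < \<epsilon>\<^sub>0" and "\<epsilon>\<^sub>0 < 1"
    and "\<alpha> > 2 + \<epsilon>\<^sub>0"
    and "\<alpha> \<noteq> real n - real d - 2"
    and "ahlfors_regular d E \<mu>"
    and "\<forall>x. 0 \<le> f x"
    and "\<mu> = density (hausdorff_measure d) (\<lambda>z. indicator E z * ennreal (f (fst z)))"
    and "\<not> f constant_on UNIV"
    and "0 < \<epsilon>" and "\<epsilon> < \<epsilon>\<^sub>0"
    and "C_holder 2 \<epsilon> f"
  shows "\<not> (\<forall>x\<in>- E. L_op d E \<alpha> \<mu> (D_dist d E \<alpha> \<mu>) x = 0)"
proof
  assume sol: "\<forall>x\<in>- E. L_op d E \<alpha> \<mu> (D_dist d E \<alpha> \<mu>) x = 0"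
  have "f x = f 0" for x
  proof (rule solution_imp_constant_density[where d = d and E = E and \<mu> = \<mu> and f = f and \<alpha> = \<alpha> and \<epsilon> = \<epsilon>])
    show "d = DIM(real ^ 'd)" using assms(1) by simp
    show "\<alpha> \<noteq> real DIM(real ^ 'm) - 2" using assms(1,2,8) by simp
    show "\<alpha> > 2 + \<epsilon>" "\<epsilon> \<ge> 0" using assms by auto
    show "L_op d E \<alpha> \<mu> (D_dist d E \<alpha> \<mu>) z = 0" if "z \<in> - E" for z using sol that by blast
    show "0 \<le> f x" for x using assms(10) by blast
  qed fact+
  hence "f constant_on UNIV" by (auto simp: constant_on_def)
  with assms(12) show False ..
qed

end
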